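(* Let $\mathbb H$ be a Hilbert space and let $\phi\in\mathrm C^1(\mathbb H)$ satisfy, for some $\tau_*>0$ and $\phi_*\in\mathbb R$, $\frac1{2\tau_*}|x|^2+\phi(x)\ge-\phi_*$ for every $x\in\mathbb H$. Then every minimal solution $u\in\mathrm{GF}_{min}[\phi]$ is strongly approximable in every compact interval. If in addition $\mathbb H$ has finite dimension or $\liminf_{t\uparrow\infty}|\nabla\phi(u(t))|=0$, then $u$ is strongly approximable.
   Context: $\mathrm{GF}[\phi]$ is the set of all $u\in\mathrm C^1([0,+\infty);\mathbb H)$ with $u'(t)=-\nabla\phi(u(t))$ for all $t\ge0$; $\mathrm R[u]:=u([0,\infty))$. For $u,v\in\mathrm{GF}[\phi]$ we write $u\succ v$ if $\mathrm R[v]\subset\overline{\mathrm R[u]}$ and there exists $\mathsf z:[0,+\infty)\to[0,+\infty)$ with $\mathsf z(0)=0$, $0\le\mathsf z(t)-\mathsf z(s)\le t-s$ for $0\le s\le t$, and $u(t)=v(\mathsf z(t))$ for every $t\ge0$. $u\in\mathrm{GF}[\phi]$ is minimal (written $u\in\mathrm{GF}_{min}[\phi]$) if for every $v\in\mathrm{GF}[\phi]$, $u\succ v$ implies $u=v$. $\mathrm{Lip}[\psi]:=\sup_{x\ne y}\frac{\psi(y)-\psi(x)}{|y-x|}$ for $\psi:\mathbb H\to\mathbb R$. $\mathbb N$ contains $0$. Given $\psi:\mathbb H\to\mathbb R$, $\tau>0$, $u_0\in\mathbb H$: $\mathrm{MS}_\tau(\psi;u_0)$ is the (possibly empty) set of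 sequences $(U^n_\tau)_{n\in\mathbb N}$ with $U^0_\tau=u_0$ and ( * ) $\frac1{2\tau}|U^n_\tau-U^{n-1}_\tau|^2+\psi(U^n_\tau)\le\frac1{2\tau}|V-U^{n-1}_\tau|^2+\psi(V)$ for every $V\in\mathbb H$, $n\ge1$. $\mathrm M_\tau(\psi;u_0)$ is the set of piecewise constant interpolations $U_\tau:[0,\infty)\to\mathbb H$, $U_\tau(0)=u_0$, $U_\tau(t)=U^n_\tau$ for $t\in((n-1)\tau,n\tau]$, of such sequences. For $T>0$ let $N(\tau,T):=\min\{n\in\mathbb N:n\tau\ge T\}$; $\mathrm M_\tau(\psi;u_0,T)$ is the set of functions $U_\tau:[0,T]\to\mathbb H$ obtained by the same formula (for $t\in[0,T]$) from finite sequences $(U^n_\tau)_{0\le n\le N(\tau,T)}$ with $U^0_\tau=u_0$ satisfying ( * ) for $1\le n\le N(\tau,T)$. $\mathsf d_T(u,v):=\sup_{t\in[0,T]}(|u(t)-v(t)|\wedge1)$ for curves on $[0,T]$, $\mathsf d_\infty(u,v):=\sup_{t\ge0}\frac1{1+t}(|u(t)-v(t)|\wedge1)$ for curves on $[0,\infty)$. For a set $\mathcal U$ of curves, $\mathsf D_T(v,\mathcal U):=\sup_{u\in\mathcal U}\mathsf d_T(v,u)$ and $\mathsf D_\infty(v,\mathcal U):=\sup_{u\in\mathcal U}\mathsf d_\infty(v,u)$, both set equal to $+\infty$ if $\mathcal U=\emptyset$. $u\in\mathrm{GF}[\phi]$ is strongly approximable if there are $\tau_o>0$ and functions $\phi_\tau:\mathbb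 H\to\mathbb R$, $\tau\in(0,\tau_o)$, with $\lim_{\tau\downarrow0}\mathrm{Lip}[\phi_\tau-\phi]=0$ and $\lim_{\tau\downarrow0}\mathsf D_\infty(u,\mathrm M_\tau(\phi_\tau;u(0)))=0$. It is strongly approximable in every compact interval if there are $\tau_o>0$ and functions $\phi_\tau:\mathbb H\to\mathbb R$, $\tau\in(0,\tau_o)$, with $\lim_{\tau\downarrow0}\mathrm{Lip}[\phi_\tau-\phi]=0$ and $\lim_{\tau\downarrow0}\mathsf D_T(u|_{[0,T]},\mathrm M_\tau(\phi_\tau;u(0),T))=0$ for every $T>0$. *)

theory Defs
  imports "HOL-Analysis.Analysis"
begin

text \<open>
  The ambient Hilbert space is a type of sort \<open>{real_inner, banach}\<close>; it may be non-separable
  and may be trivial.  Curves on \<open>[0, \<infinity>)\<close> or \<open>[0, T]\<close> are functions on \<^typ>\<open>real\<close> of which only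
  the values on the respective interval are ever used; in particular equality of curves is equality
  on that interval.
\<close>

section \<open>Gradient flows\<close>

definition C1 :: "('a::real_normed_vector \<Rightarrow> real) \<Rightarrow> bool" where
  "C1 \<phi> \<longleftrightarrow> (\<exists>D :: 'a \<Rightarrow> 'a \<Rightarrow>\<^sub>L real.
     (\<forall>x. (\<phi> has_derivative blinfun_apply (D x)) (at x)) \<and> continuous_on UNIV D)"

definition grad :: "('a::real_inner \<Rightarrow> real) \<Rightarrow> 'a \<Rightarrow> 'a" where
  "grad \<phi> x = (THE g. GDERIV \<phi> x :> g)"

lemma Riesz_representation:
  fixes f :: "'a::{real_inner,banach} \<Rightarrow> real"
  assumes "bounded_linear f"
  shows "\<exists>g. \<forall>h. f h = inner h g"
proof -
  interpret f: bounded_linear f by fact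
  define J where "J = (\<lambda>x. (norm x)\<^sup>2 - 2 * f x)"
  obtain K where K: "\<And>x. norm (f x) \<le> norm x * K" using f.bounded by blast
  have lower: "- K\<^sup>2 \<le> J x" for x
  proof -
    have "0 \<le> (norm x - K)\<^sup>2" by simp
    with K[of x] show ?thesis by (simp add: J_def power2_diff)
  qed
  then have bdd: "bdd_below (range J)" by (auto simp: bdd_below_def)
  define m where "m = (INF x. J x)"
  have m: "m \<le> J x" for x unfolding m_def using bdd by (simp add: cINF_lower)
  have "\<exists>x. J x < m + inverse (real (Suc n))" for n
    using cINF_less_iff[OF _ bdd, of "m + inverse (real (Suc n))"] by (auto simp: m_def)
  then obtain X where X: "\<And>n. J (X n) < m + inverse (real (Suc n))" by metis
  have mid: "(norm (x - y))\<^sup>2 \<le> 2 * (J x - m) + 2 * (J y - m)" for x y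
  proof -
    have "(norm (x - y))\<^sup>2 = 2 * J x + 2 * J y - 4 * J ((1/2) *\<^sub>R (x + y))"
      by (simp add: J_def f.add f.scaleR power2_norm_eq_inner inner_simps inner_commute[of y x] field_simps)
    with m[of "(1/2) *\<^sub>R (x + y)"] show ?thesis by simp
  qed
  have "Cauchy X"
  proof (rule metric_CauchyI)
    fix e :: real assume "e > 0"
    then obtain N where N: "inverse (real (Suc N)) < e\<^sup>2 / 4"
      using reals_Archimedean[of "e\<^sup>2 / 4"] by auto
    have "dist (X i) (X j) < e" if "i \<ge> N" "j \<ge> N" for i j
    proof -
      have s: "J (X k) - m < e\<^sup>2 / 4" if "k \<ge> N" for k
      proof -
        have "inverse (real (Suc k)) \<le> inverse (real (Suc N))"
          using that by (intro le_imp_inverse_le) auto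
        with X[of k] N show ?thesis by linarith
      qed
      have "(norm (X i - X j))\<^sup>2 < e\<^sup>2"
        using mid[of "X i" "X j"] s[OF that(1)] s[OF that(2)] by (simp add: field_simps)
      then show ?thesis using \<open>e > 0\<close> by (simp add: dist_norm power2_less_imp_less)
    qed
    then show "\<exists>M. \<forall>i\<ge>M. \<forall>j\<ge>M. dist (X i) (X j) < e" by blast
  qed
  then obtain g where g: "X \<longlonglongrightarrow> g" using Cauchy_convergent_iff convergent_def by blast
  have "(\<lambda>n. J (X n)) \<longlonglongrightarrow> J g" unfolding J_def by (intro tendsto_intros g f.tendsto)
  moreover have "(\<lambda>n. m + inverse (real (Suc n))) \<longlonglongrightarrow> m"
    using tendsto_add[OF tendsto_const LIMSEQ_inverse_real_of_nat] by simp
  ultimately have Jg: "J g \<le> m" by (rule LIMSEQ_le) (use X less_imp_le in blast)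
  have "f h = inner h g" for h
  proof (cases "h = 0")
    case False
    define c where "c = inner h g - f h"
    define t where "t = - c / (norm h)\<^sup>2"
    have n: "(norm h)\<^sup>2 > 0" using False by simp
    have "J g \<le> J (g + t *\<^sub>R h)" using Jg m order_trans by blast
    moreover have "(norm (g + t *\<^sub>R h))\<^sup>2 = (norm g)\<^sup>2 + 2 * t * inner h g + t\<^sup>2 * (norm h)\<^sup>2"
      unfolding power2_norm_eq_inner
      by (simp add: inner_simps inner_commute[of g h] power2_eq_square algebra_simps)
    ultimately have "0 \<le> t\<^sup>2 * (norm h)\<^sup>2 + 2 * t * c"
      by (simp add: J_def c_def f.add f.scaleR algebra_simps)
    also have "\<dots> = - c\<^sup>2 / (norm h)\<^sup>2" using n by (simp add: t_def field_simps power2_eq_square)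
    finally have "c\<^sup>2 \<le> 0" using n by (simp add: field_simps)
    then show ?thesis by (simp add: c_def)
  qed (simp add: f.zero)
  then show ?thesis by blast
qed

lemma C1_GDERIV_grad:
  fixes \<phi> :: "'a::{real_inner,banach} \<Rightarrow> real"
  assumes "C1 \<phi>"
  shows "GDERIV \<phi> x :> grad \<phi> x"
proof -
  obtain D :: "'a \<Rightarrow> 'a \<Rightarrow>\<^sub>L real" where D: "(\<phi> has_derivative blinfun_apply (D x)) (at x)"
    using assms by (auto simp: C1_def)
  obtain g where "\<And>h. D x h = inner h g"
    using Riesz_representation[OF blinfun.bounded_linear_right] by blast
  then have "blinfun_apply (D x) = (\<lambda>h. inner h g)" by auto
  with D have g: "GDERIV \<phi> x :> g" by (simp add: gderiv_def)
  moreover have "g' = g" if "GDERIV \<phi> x :> g'" for g'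
    using has_derivative_unique[OF that[unfolded gderiv_def] g[unfolded gderiv_def]]
    by (metis inner_commute vector_eq_ldot)
  ultimately show ?thesis unfolding grad_def by (rule theI)
qed

definition GF :: "('a::real_inner \<Rightarrow> real) \<Rightarrow> (real \<Rightarrow> 'a) set" where
  "GF \<phi> = {u. \<exists>u'. continuous_on {0..} u' \<and>
     (\<forall>t\<ge>0. (u has_vector_derivative u' t) (at t within {0..}) \<and> u' t = - grad \<phi> (u t))}"

definition curve_range :: "(real \<Rightarrow> 'a) \<Rightarrow> 'a set" where
  "curve_range u = u ` {0..}"

definition dominates :: "(real \<Rightarrow> 'a::topological_space) \<Rightarrow> (real \<Rightarrow> 'a) \<Rightarrow> bool"
    (infix \<open>\<succ>\<close> 50) where
  "u \<succ> v \<longleftrightarrow> curve_range v \<subseteq> closure (curve_range u) \<and>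
     (\<exists>z :: real \<Rightarrow> real. (\<forall>t\<ge>0. 0 \<le> z t) \<and> z 0 = 0 \<and>
        (\<forall>s t. 0 \<le> s \<and> s \<le> t \<longrightarrow> 0 \<le> z t - z s \<and> z t - z s \<le> t - s) \<and>
        (\<forall>t\<ge>0. u t = v (z t)))"

definition GF_min :: "('a::real_inner \<Rightarrow> real) \<Rightarrow> (real \<Rightarrow> 'a) set" where
  "GF_min \<phi> = {u \<in> GF \<phi>. \<forall>v\<in>GF \<phi>. u \<succ> v \<longrightarrow> (\<forall>t\<ge>0. u t = v t)}"

section \<open>Minimizing movements\<close>

text \<open>
  Exchanging \<open>x\<close> and \<open>y\<close> changes the sign of the quotient, so the supremum is nonnegative and nothing
  is lost by taking it in \<^typ>\<open>ennreal\<close>.  On the trivial space it is \<open>0\<close>.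
\<close>
definition Lip :: "('a::real_normed_vector \<Rightarrow> real) \<Rightarrow> ennreal" where
  "Lip \<psi> = (SUP (x, y) \<in> {(x, y). x \<noteq> y}. ennreal ((\<psi> y - \<psi> x) / norm (y - x)))"

definition MS_step :: "real \<Rightarrow> ('a::real_normed_vector \<Rightarrow> real) \<Rightarrow> 'a \<Rightarrow> 'a \<Rightarrow> bool" where
  "MS_step \<tau> \<psi> w x \<longleftrightarrow>
     (\<forall>V. 1 / (2 * \<tau>) * (norm (x - w))\<^sup>2 + \<psi> x \<le> 1 / (2 * \<tau>) * (norm (V - w))\<^sup>2 + \<psi> V)"

definition MS :: "real \<Rightarrow> ('a::real_normed_vector \<Rightarrow> real) \<Rightarrow> 'a \<Rightarrow> (nat \<Rightarrow> 'a) set" where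
  "MS \<tau> \<psi> u0 = {U. U 0 = u0 \<and> (\<forall>n\<ge>1. MS_step \<tau> \<psi> (U (n - 1)) (U n))}"

definition MM :: "real \<Rightarrow> ('a::real_normed_vector \<Rightarrow> real) \<Rightarrow> 'a \<Rightarrow> (real \<Rightarrow> 'a) set" where
  "MM \<tau> \<psi> u0 = {u. \<exists>U\<in>MS \<tau> \<psi> u0. u 0 = u0 \<and>
     (\<forall>n\<ge>1. \<forall>t\<in>{(real n - 1) * \<tau><..real n * \<tau>}. u t = U n)}"

definition num_steps :: "real \<Rightarrow> real \<Rightarrow> nat" where
  "num_steps \<tau> T = (LEAST n. T \<le> real n * \<tau>)"

text \<open>Only the entries \<open>U 0, \<dots>, U (num_steps \<tau> T)\<close> of the sequence below matter.\<close>
definition MM_on :: "real \<Rightarrow> ('a::real_normed_vector \<Rightarrow> real) \<Rightarrow> 'a \<Rightarrow> real \<Rightarrow> (real \<Rightarrow> 'a) set" where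
  "MM_on \<tau> \<psi> u0 T = {u. \<exists>U :: nat \<Rightarrow> 'a. U 0 = u0 \<and>
     (\<forall>n\<in>{1..num_steps \<tau> T}. MS_step \<tau> \<psi> (U (n - 1)) (U n)) \<and> u 0 = u0 \<and>
     (\<forall>n\<in>{1..num_steps \<tau> T}. \<forall>t\<in>{(real n - 1) * \<tau><..real n * \<tau>} \<inter> {0..T}. u t = U n)}"

section \<open>Strong approximability\<close>

definition dist_on :: "real \<Rightarrow> (real \<Rightarrow> 'a::real_normed_vector) \<Rightarrow> (real \<Rightarrow> 'a) \<Rightarrow> real" where
  "dist_on T u v = (SUP t\<in>{0..T}. min (norm (u t - v t)) 1)"

definition dist_inf :: "(real \<Rightarrow> 'a::real_normed_vector) \<Rightarrow> (real \<Rightarrow> 'a) \<Rightarrow> real" where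
  "dist_inf u v = (SUP t\<in>{0..}. 1 / (1 + t) * min (norm (u t - v t)) 1)"

definition Dist_on ::
    "real \<Rightarrow> (real \<Rightarrow> 'a::real_normed_vector) \<Rightarrow> (real \<Rightarrow> 'a) set \<Rightarrow> ennreal" where
  "Dist_on T v \<U> = (if \<U> = {} then \<infinity> else (SUP u\<in>\<U>. ennreal (dist_on T v u)))"

definition Dist_inf :: "(real \<Rightarrow> 'a::real_normed_vector) \<Rightarrow> (real \<Rightarrow> 'a) set \<Rightarrow> ennreal" where
  "Dist_inf v \<U> = (if \<U> = {} then \<infinity> else (SUP u\<in>\<U>. ennreal (dist_inf v u)))"

definition strongly_approximable :: "('a::real_inner \<Rightarrow> real) \<Rightarrow> (real \<Rightarrow> 'a) \<Rightarrow> bool" where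
  "strongly_approximable \<phi> u \<longleftrightarrow> u \<in> GF \<phi> \<and>
     (\<exists>\<tau>\<^sub>o>0. \<exists>\<Phi> :: real \<Rightarrow> 'a \<Rightarrow> real.
        ((\<lambda>\<tau>. Lip (\<lambda>x. \<Phi> \<tau> x - \<phi> x)) \<longlongrightarrow> 0) (at 0 within {0<..<\<tau>\<^sub>o}) \<and>
        ((\<lambda>\<tau>. Dist_inf u (MM \<tau> (\<Phi> \<tau>) (u 0))) \<longlongrightarrow> 0) (at 0 within {0<..<\<tau>\<^sub>o}))"

definition strongly_approximable_compact ::
    "('a::real_inner \<Rightarrow> real) \<Rightarrow> (real \<Rightarrow> 'a) \<Rightarrow> bool" where
  "strongly_approximable_compact \<phi> u \<longleftrightarrow> u \<in> GF \<phi> \<and>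
     (\<exists>\<tau>\<^sub>o>0. \<exists>\<Phi> :: real \<Rightarrow> 'a \<Rightarrow> real.
        ((\<lambda>\<tau>. Lip (\<lambda>x. \<Phi> \<tau> x - \<phi> x)) \<longlongrightarrow> 0) (at 0 within {0<..<\<tau>\<^sub>o}) \<and>
        (\<forall>T>0. ((\<lambda>\<tau>. Dist_on T u (MM_on \<tau> (\<Phi> \<tau>) (u 0) T)) \<longlongrightarrow> 0) (at 0 within {0<..<\<tau>\<^sub>o})))"

end

theory Submission
  imports Defs "HOL-Complex_Analysis.Great_Picard"
begin

text \<open>
  The idea is to perturb \<open>\<phi>\<close> so that the scheme is pulled along \<open>u\<close> at least as fast as \<open>u\<close> itself
  moves; minimality of \<open>u\<close> says that nothing can be faster.

  Fix a horizon \<open>T\<close>, sample \<open>x k = u (k \<tau>)\<close> for \<open>k \<le> M\<close> with \<open>M \<tau> \<approx> T\<close>, and add to \<open>\<phi>\<close> the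
  \<open>3 \<mu>\<close>-Lipschitz function \<open>2 \<mu> dist(v, K) + min\<^sub>k (\<mu> |v - x k| - \<kappa> k \<tau>)\<close>, where \<open>K\<close> is a
  finite-dimensional subspace that contains the samples.  Near the curve the first term forces
  minimizers into \<open>K\<close>, because the direction in which \<open>u\<close> leaves a sample lies in \<open>K\<close> up to a small
  error; since \<open>K\<close> is locally compact, this also gives their existence.  The second term, the guide,
  divided by \<open>-\<kappa>\<close> is a clock.  It is at most \<open>k \<tau>\<close>, where \<open>x k\<close> is the sample that realizes the
  minimum, and as long as it is nonnegative the distance to that sample is at most \<open>\<kappa> T / \<mu>\<close>.
  Comparing a minimizer \<open>V\<close> that follows \<open>U\<close> with the competitor
  \<open>x (k + 1) + (1 - \<theta>) (U - x k)\<close> shows that the clock advances by \<open>(1 - \<delta>) \<tau>\<close> in every step,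
  and by the far larger amount \<open>\<mu>\<^sup>2 \<tau> / (8 \<kappa>)\<close> when \<open>U\<close> is farther than \<open>\<mu> \<tau>\<close> from its sample
  (lemmas \<open>step_guide_close\<close>, \<open>step_guide_far\<close>).  Excursions off the curve are thus short in time, and
  since \<open>u\<close> never returns to a point that it has left, the chain is near \<open>u s\<close> whenever its clock
  passes \<open>s\<close> (lemma \<open>chain_near_curve\<close>).

  The constants are fixed in the order \<open>\<mu>\<close>, coarse modulus \<open>\<epsilon> = \<mu>/16\<close> of \<open>\<nabla>\<phi>\<close> with its radius \<open>\<rho>\<close>,
  \<open>\<kappa>\<close>, fine modulus \<open>\<epsilon>'\<close> with radius \<open>\<rho>'\<close>, \<open>\<tau>\<close>.  Two moduli are used because the clock is only as
  precise as \<open>\<epsilon>'\<^sup>2 / \<kappa>\<close>, whereas the tube around the curve has radius \<open>\<kappa> T / \<mu>\<close>: on the scale of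
  the tube the oscillation of \<open>\<nabla>\<phi>\<close> need not be small against \<open>\<surd>\<kappa>\<close>.  Far from the samples the
  coarse modulus suffices, since the gain there is so large; close to them one looks at the scale \<open>\<tau>\<close>.

  What the discrete estimates leave open is that the chain may be too fast.  Let \<open>Z s\<close> be the limit of
  the times at which the clock reads \<open>s\<close>; it is 1-Lipschitz.  In the limit the chain becomes a
  gradient flow \<open>v\<close> with \<open>u s = v (Z s)\<close>, so \<open>u \<succ> v\<close> and minimality yields \<open>u = v\<close>, that is
  \<open>u s = u (Z s)\<close> (lemma \<open>limit_of_followers\<close>).  If \<open>Z s < s\<close> somewhere, then \<open>u\<close> is constant from
  that time on, because the energy decreases strictly along a nonconstant flow.  A contradiction
  argument turns this into uniform convergence on compact intervals (theorem \<open>uniform_tracking\<close>); the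
  chain can meet the end \<open>u T\<close> of the sampled arc prematurely only when \<open>u\<close> has become constant, and
  then \<open>u T\<close> is a critical point that traps it.

  Finally \<open>T \<rightarrow> \<infinity>\<close> and \<open>\<mu> \<rightarrow> 0\<close> are coupled to \<open>\<tau>\<close> by a diagonal choice.  The weight \<open>1 / (1 + t)\<close>
  reduces global convergence to compact intervals once the scheme can be continued for ever.  In finite
  dimension this follows from coercivity; if \<open>\<nabla>\<phi>\<close> becomes small along \<open>u\<close>, the horizons \<open>T\<close> are
  placed where it is small, and then the end of the sampled arc holds the chain.
\<close>

section \<open>Finite-dimensional subspaces\<close>

lemma orthogonal_projection_exists:
  fixes B :: "'a::real_inner set"
  assumes "finite B"
  shows "\<exists>p\<in>span B. \<forall>w\<in>span B. inner (v - p) w = 0"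
  using assms
proof (induction B arbitrary: v rule: finite_induct)
  case empty
  then show ?case by simp
next
  case (insert b B)
  obtain pb where pb: "pb \<in> span B" "\<forall>w\<in>span B. inner (b - pb) w = 0" using insert.IH by blast
  obtain pv where pv: "pv \<in> span B" "\<forall>w\<in>span B. inner (v - pv) w = 0" using insert.IH by blast
  define b' where "b' = b - pb"
  define c where "c = inner (v - pv) b' / inner b' b'"
  have sub: "span B \<subseteq> span (insert b B)" by (intro span_mono) auto
  have b'_span: "b' \<in> span (insert b B)"
    unfolding b'_def using pb(1) sub span_base[of b "insert b B"] by (intro span_diff) auto
  have "pv + c *\<^sub>R b' \<in> span (insert b B)"
    using pv(1) b'_span sub by (intro span_add span_scale) auto
  moreover have "inner (v - (pv + c *\<^sub>R b')) w = 0" if w: "w \<in> span (insert b B)" for w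
  proof -
    obtain k where k: "w - k *\<^sub>R b \<in> span B" using w by (auto simp: span_breakdown_eq)
    define y where "y = w - k *\<^sub>R b + k *\<^sub>R pb"
    have y: "y \<in> span B" unfolding y_def using k pb(1) by (simp add: span_add span_scale)
    have w: "w = y + k *\<^sub>R b'" by (simp add: y_def b'_def algebra_simps)
    have "inner (v - pv) y = 0" "inner b' y = 0" using y pv pb by (auto simp: b'_def)
    moreover have "inner (v - pv) b' = c * inner b' b'" by (simp add: c_def)
    ultimately show ?thesis unfolding w
      by (simp add: inner_diff_left inner_add_left inner_add_right algebra_simps)
  qed
  ultimately show ?case by blast
qed

text \<open>
  Adding one vector to \<open>B\<close> and splitting off its component orthogonal to \<open>span B\<close> presents the bounded
  part of the larger span as a continuous image of a product of compact sets.
\<close>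
lemma compact_span_cball_0:
  fixes B :: "'a::real_inner set"
  assumes "finite B"
  shows "compact (span B \<inter> cball 0 r)"
  using assms
proof (induction B arbitrary: r rule: finite_induct)
  case empty
  then show ?case by (simp add: compact_Int_closed)
next
  case (insert b B)
  obtain pb where pb: "pb \<in> span B" "\<forall>w\<in>span B. inner (b - pb) w = 0"
    using orthogonal_projection_exists insert.hyps by blast
  define b' where "b' = b - pb"
  define C where "C = \<bar>r\<bar> / norm b'"
  let ?f = "\<lambda>(y, c). y + c *\<^sub>R b'"
  let ?D = "(span B \<inter> cball 0 r) \<times> {-C..C}"
  have "compact (?f ` ?D)"
    by (intro compact_continuous_image compact_Times insert.IH compact_Icc)
       (auto simp: case_prod_unfold intro!: continuous_intros)
  then have "compact (?f ` ?D \<inter> cball 0 r)" by (intro compact_Int_closed) auto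
  moreover have "span (insert b B) \<inter> cball 0 r = ?f ` ?D \<inter> cball 0 r"
  proof (intro equalityI subsetI)
    fix w assume w: "w \<in> span (insert b B) \<inter> cball 0 r"
    then obtain k where k: "w - k *\<^sub>R b \<in> span B" by (auto simp: span_breakdown_eq)
    define y where "y = w - k *\<^sub>R b + k *\<^sub>R pb"
    have y: "y \<in> span B" unfolding y_def using k pb(1) by (simp add: span_add span_scale)
    have w_eq: "w = y + k *\<^sub>R b'" by (simp add: y_def b'_def algebra_simps)
    have orth: "inner y b' = 0" using y pb by (auto simp: b'_def inner_commute)
    then have "(norm w)\<^sup>2 = (norm y)\<^sup>2 + (norm (k *\<^sub>R b'))\<^sup>2"
      unfolding w_eq power2_norm_eq_inner by (simp add: inner_add_left inner_add_right inner_commute)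
    then have "norm y \<le> norm w" "norm (k *\<^sub>R b') \<le> norm w"
      by (metis le_add_same_cancel1 le_add_same_cancel2 norm_ge_zero power2_le_imp_le zero_le_power2)+
    with w have ny: "norm y \<le> r" and nk: "\<bar>k\<bar> * norm b' \<le> \<bar>r\<bar>" by auto
    show "w \<in> ?f ` ?D \<inter> cball 0 r"
    proof (cases "b' = 0")
      case True
      then have "w = ?f (y, 0)" using w_eq by simp
      moreover have "(y, 0) \<in> ?D" using ny y by (auto simp: C_def)
      ultimately show ?thesis using w by blast
    next
      case False
      then have "\<bar>k\<bar> \<le> C" using nk by (simp add: C_def field_simps)
      then have "(y, k) \<in> ?D" using ny y by auto
      moreover have "w = ?f (y, k)" using w_eq by simp
      ultimately show ?thesis using w by blast
    qed
  next
    fix w assume w: "w \<in> ?f ` ?D \<inter> cball 0 r"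
    then obtain y c where yc: "y \<in> span B" "w = y + c *\<^sub>R b'" by auto
    have sub: "span B \<subseteq> span (insert b B)" by (intro span_mono) auto
    have "b' \<in> span (insert b B)"
      unfolding b'_def using pb(1) sub span_base[of b "insert b B"] by (intro span_diff) auto
    then show "w \<in> span (insert b B) \<inter> cball 0 r"
      using w yc sub by (auto intro: span_add span_scale)
  qed
  ultimately show ?case by simp
qed

lemma compact_span_cball:
  fixes B :: "'a::real_inner set"
  assumes "finite B"
  shows "compact (span B \<inter> cball c r)"
proof -
  have "cball c r \<subseteq> cball 0 (norm c + r)"
  proof
    fix x assume "x \<in> cball c r"
    then show "x \<in> cball 0 (norm c + r)"
      using norm_triangle_ineq2[of x c] by (simp add: dist_norm norm_minus_commute)
  qed
  then have "span B \<inter> cball c r = (span B \<inter> cball 0 (norm c + r)) \<inter> cball c r" by blast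
  then show ?thesis using compact_span_cball_0[OF assms] compact_Int_closed closed_cball by metis
qed

section \<open>Gradients and gradient flows\<close>

lemma C1_continuous_grad:
  fixes \<phi> :: "'a::{real_inner,banach} \<Rightarrow> real"
  assumes "C1 \<phi>"
  shows "continuous_on UNIV (grad \<phi>)"
proof -
  obtain D :: "'a \<Rightarrow> 'a \<Rightarrow>\<^sub>L real" where D: "\<And>x. (\<phi> has_derivative blinfun_apply (D x)) (at x)"
    and cont: "continuous_on UNIV D" using assms by (auto simp: C1_def)
  have D_eq: "D x h = inner h (grad \<phi> x)" for x h
    using has_derivative_unique[OF D C1_GDERIV_grad[OF assms, unfolded gderiv_def]] by metis
  have bound: "dist (grad \<phi> x) (grad \<phi> y) \<le> dist (D x) (D y)" for x y
  proof -
    define h where "h = grad \<phi> x - grad \<phi> y"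
    have "norm h * norm h = (D x - D y) h"
      by (simp add: blinfun.diff_left D_eq h_def inner_diff_right flip: power2_norm_eq_inner power2_eq_square)
         (simp add: power2_norm_eq_inner inner_diff_right)
    also have "\<dots> \<le> norm (D x - D y) * norm h" using norm_blinfun[of "D x - D y" h] by simp
    finally show ?thesis by (cases "h = 0") (auto simp: h_def dist_norm)
  qed
  show ?thesis
    unfolding continuous_on_iff
  proof (intro ballI allI impI)
    fix x :: 'a and e :: real assume "e > 0"
    then obtain d where "d > 0" "\<forall>y\<in>UNIV. dist y x < d \<longrightarrow> dist (D y) (D x) < e"
      using cont unfolding continuous_on_iff by blast
    then show "\<exists>d>0. \<forall>y\<in>UNIV. dist y x < d \<longrightarrow> dist (grad \<phi> y) (grad \<phi> x) < e"
      using bound by (meson le_less_trans)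
  qed
qed

text \<open>
  The mean value theorem for \<open>\<phi> - g \<bullet> _\<close>.
\<close>
lemma linearization_error:
  fixes \<phi> :: "'a::{real_inner,banach} \<Rightarrow> real"
  assumes C1: "C1 \<phi>" and S: "convex S" "V \<in> S" "W \<in> S"
    and B: "\<And>y. y \<in> S \<Longrightarrow> norm (grad \<phi> y - g) \<le> \<epsilon>"
  shows "\<bar>\<phi> V - \<phi> W - inner g (V - W)\<bar> \<le> \<epsilon> * norm (V - W)"
proof -
  have "norm ((\<phi> V - inner g V) - (\<phi> W - inner g W)) \<le> \<epsilon> * norm (V - W)"
  proof (rule differentiable_bound[OF S(1) _ _ S(2,3)])
    fix x assume x: "x \<in> S"
    have "(\<phi> has_derivative (\<lambda>h. inner h (grad \<phi> x))) (at x within S)"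
      using C1_GDERIV_grad[OF C1] has_derivative_at_withinI unfolding gderiv_def by blast
    then show "((\<lambda>y. \<phi> y - inner g y) has_derivative (\<lambda>h. inner h (grad \<phi> x) - inner g h)) (at x within S)"
      by (auto intro!: derivative_eq_intros)
    show "onorm (\<lambda>h. inner h (grad \<phi> x) - inner g h) \<le> \<epsilon>"
    proof (rule onorm_bound)
      show "0 \<le> \<epsilon>" using B[OF x] norm_ge_zero order_trans by blast
    next
      fix h
      have "inner h (grad \<phi> x) - inner g h = inner h (grad \<phi> x - g)"
        by (simp add: inner_diff_right inner_commute)
      then show "norm (inner h (grad \<phi> x) - inner g h) \<le> \<epsilon> * norm h"
        using order_trans[OF Cauchy_Schwarz_ineq2 mult_left_mono[OF B[OF x] norm_ge_zero[of h]]]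
        by (simp add: mult.commute)
    qed
  qed
  then show ?thesis by (simp add: inner_diff_right algebra_simps)
qed

text \<open>
  In infinite dimension a continuous gradient is not uniformly continuous on bounded sets, but it is
  so at the points of a compact arc, with increments in the whole space.
\<close>
lemma uniform_continuity_near_compact:
  fixes g :: "'a::metric_space \<Rightarrow> 'b::real_normed_vector"
  assumes C: "compact C" and g: "continuous_on UNIV g" and "\<epsilon> > 0"
  shows "\<exists>\<rho>>0. \<forall>x\<in>C. \<forall>y. dist y x \<le> \<rho> \<longrightarrow> norm (g y - g x) \<le> \<epsilon>"
proof -
  let ?G = "range (\<lambda>z. g -` ball z (\<epsilon>/2))"
  have "\<exists>e>0. \<forall>x\<in>C. \<exists>G\<in>?G. ball x e \<subseteq> G"
  proof (rule Heine_Borel_lemma[OF C])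
    show "C \<subseteq> \<Union>?G" 
    proof
      fix x show "x \<in> \<Union>?G" using \<open>\<epsilon> > 0\<close> by (auto intro!: exI[of _ "g x"])
    qed
    show "open G" if "G \<in> ?G" for G
      using that g by (auto simp: continuous_on_open_vimage)
  qed blast
  then obtain e where e: "e > 0" "\<And>x. x \<in> C \<Longrightarrow> \<exists>G\<in>?G. ball x e \<subseteq> G"
    by blast
  have "norm (g y - g x) \<le> \<epsilon>" if x: "x \<in> C" and d: "dist y x \<le> e/2" for x y
  proof -
    obtain z where z: "ball x e \<subseteq> g -` ball z (\<epsilon>/2)" using e(2)[OF x] by blast
    have "x \<in> ball x e" "y \<in> ball x e" using d e(1) by (auto simp: dist_commute)
    then have "dist z (g x) < \<epsilon>/2" "dist z (g y) < \<epsilon>/2" using subsetD[OF z] by fastforce+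
    then have "dist (g y) (g x) < \<epsilon>" by (metis dist_triangle_half_r)
    then show ?thesis by (simp add: dist_norm)
  qed
  then show ?thesis using e(1) by (intro exI[of _ "e/2"]) simp
qed

lemma GF_has_vector_derivative:
  assumes "u \<in> GF \<phi>" "t \<ge> 0"
  shows "(u has_vector_derivative - grad \<phi> (u t)) (at t within {0..})"
  using assms unfolding GF_def by auto

lemma GF_continuous:
  assumes "u \<in> GF \<phi>" shows "continuous_on {0..} u"
  unfolding continuous_on_eq_continuous_within
  using GF_has_vector_derivative[OF assms] has_vector_derivative_continuous by blast

lemma GF_linearization:
  assumes u: "u \<in> GF \<phi>" and st: "0 \<le> s" "s \<le> t"
    and B: "\<And>r. s \<le> r \<Longrightarrow> r \<le> t \<Longrightarrow> norm (grad \<phi> (u r) - g) \<le> \<omega>"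
  shows "norm (u t - u s + (t - s) *\<^sub>R g) \<le> (t - s) * \<omega>"
proof -
  have "norm ((u t + t *\<^sub>R g) - (u s + s *\<^sub>R g)) \<le> \<omega> * norm (t - s)"
  proof (rule differentiable_bound[of "{s..t}"])
    fix x assume x: "x \<in> {s..t}"
    then have "(u has_vector_derivative - grad \<phi> (u x)) (at x within {s..t})"
      using GF_has_vector_derivative[OF u, of x] st has_vector_derivative_within_subset[of u _ x "{0..}" "{s..t}"] by auto
    then show "((\<lambda>t. u t + t *\<^sub>R g) has_derivative (\<lambda>h. h *\<^sub>R (- grad \<phi> (u x)) + h *\<^sub>R g)) (at x within {s..t})"
      unfolding has_vector_derivative_def by (auto intro!: derivative_eq_intros)
    show "onorm (\<lambda>h. h *\<^sub>R (- grad \<phi> (u x)) + h *\<^sub>R g) \<le> \<omega>"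
    proof (rule onorm_le)
      fix h :: real
      have "h *\<^sub>R (- grad \<phi> (u x)) + h *\<^sub>R g = - (h *\<^sub>R (grad \<phi> (u x) - g))" by (simp add: algebra_simps)
      then show "norm (h *\<^sub>R (- grad \<phi> (u x)) + h *\<^sub>R g) \<le> \<omega> * norm h"
        using mult_left_mono[OF B[of x], of "\<bar>h\<bar>"] x by (simp add: mult.commute)
    qed
  qed (use st in auto)
  then show ?thesis using st by (simp add: algebra_simps)
qed

text \<open>
  Integrating \<open>|u'| \<le> c/2 |u'|\<^sup>2 + 1/(2c)\<close>, where \<open>|u'|\<^sup>2\<close> is the rate of energy dissipation.  A free
  \<open>c\<close> makes the estimate serve for monotonicity of the energy, for constancy of \<open>u\<close> where the energy
  is constant, and as the quantitative no-return property of \<open>u\<close>.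
\<close>
lemma GF_energy_estimate:
  fixes \<phi> :: "'a::{real_inner,banach} \<Rightarrow> real"
  assumes C1: "C1 \<phi>" and u: "u \<in> GF \<phi>" and st: "0 \<le> s" "s \<le> t" and c: "c > 0"
  shows "norm (u t - u s) \<le> c / 2 * (\<phi> (u s) - \<phi> (u t)) + (t - s) / (2 * c)"
proof -
  define e where "e = (1 / norm (u t - u s)) *\<^sub>R (u t - u s)"
  have ne: "norm e \<le> 1" by (simp add: e_def)
  have ie: "inner e (u t - u s) = norm (u t - u s)"
    by (simp add: e_def flip: power2_norm_eq_inner) (simp add: power2_eq_square)
  define h where "h r = inner e (u r) + c / 2 * \<phi> (u r) - r / (2 * c)" for r
  have "h t \<le> h s"
  proof (rule DERIV_nonpos_imp_decreasing_open[OF st(2)])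
    fix r assume r: "s < r" "r < t"
    let ?g = "grad \<phi> (u r)"
    have "(u has_vector_derivative - ?g) (at r)"
      using GF_has_vector_derivative[OF u, of r] r st(1) at_within_interior[of r "{0..}"] by (simp add: interior_real_atLeast)
    then have du: "(u has_derivative (\<lambda>x. x *\<^sub>R - ?g)) (at r)" by (simp add: has_vector_derivative_def)
    have "(\<phi> has_derivative (\<lambda>h. inner h ?g)) (at (u r))"
      using C1_GDERIV_grad[OF C1] unfolding gderiv_def .
    from has_derivative_compose[OF du this]
    have "((\<lambda>x. \<phi> (u x)) has_derivative (\<lambda>x. inner (x *\<^sub>R - ?g) ?g)) (at r)" .
    then have "(h has_derivative (\<lambda>x. inner e (x *\<^sub>R - ?g) + c / 2 * inner (x *\<^sub>R - ?g) ?g - x / (2 * c))) (at r)"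
      unfolding h_def using du c by (auto intro!: derivative_eq_intros)
    moreover have "(\<lambda>x. inner e (x *\<^sub>R - ?g) + c / 2 * inner (x *\<^sub>R - ?g) ?g - x / (2 * c))
       = (*) (- inner e ?g - c / 2 * inner ?g ?g - 1 / (2 * c))"
      by (auto simp: algebra_simps)
    ultimately have D: "DERIV h r :> (- inner e ?g - c / 2 * inner ?g ?g - 1 / (2 * c))"
      by (simp add: has_field_derivative_def)
    have "- inner e ?g \<le> norm ?g"
      using Cauchy_Schwarz_ineq2[of e ?g] mult_right_mono[OF ne norm_ge_zero[of ?g]] by linarith
    moreover have "norm ?g \<le> c / 2 * inner ?g ?g + 1 / (2 * c)"
    proof -
      have "0 \<le> (c * norm ?g - 1)\<^sup>2 / (2 * c)" using c by simp
      also have "\<dots> = c / 2 * inner ?g ?g + 1 / (2 * c) - norm ?g"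
        using c by (simp add: power2_diff power_mult_distrib power2_norm_eq_inner field_simps) (simp add: power2_eq_square algebra_simps)
      finally show ?thesis by simp
    qed
    ultimately show "\<exists>y. DERIV h r :> y \<and> y \<le> 0" using D by (intro exI[of _ "- inner e ?g - c / 2 * inner ?g ?g - 1 / (2 * c)"]) auto
  next
    have cu: "continuous_on {s..t} u" using GF_continuous[OF u] st continuous_on_subset by fastforce
    have "continuous_on UNIV \<phi>"
      using C1_GDERIV_grad[OF C1] unfolding gderiv_def
      by (meson continuous_at_imp_continuous_on has_derivative_continuous)
    then have "continuous_on {s..t} (\<lambda>r. \<phi> (u r))" using cu continuous_on_compose2 by blast
    then show "continuous_on {s..t} h" unfolding h_def using cu c by (intro continuous_intros) auto
  qed
  then show ?thesis using ie unfolding h_def inner_diff_right by (simp add: algebra_simps diff_divide_distrib)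
qed

lemma GF_energy_antimono:
  fixes \<phi> :: "'a::{real_inner,banach} \<Rightarrow> real"
  assumes C1: "C1 \<phi>" and u: "u \<in> GF \<phi>" and st: "0 \<le> s" "s \<le> t"
  shows "\<phi> (u t) \<le> \<phi> (u s)"
proof (rule ccontr)
  assume "\<not> ?thesis"
  then have d: "\<phi> (u t) - \<phi> (u s) > 0" by simp
  define d where "d = \<phi> (u t) - \<phi> (u s)"
  \<comment> \<open>The constant makes the energy term of the estimate exceed its time term.\<close>
  define c where "c = sqrt (2 * (t - s + 1) / d)"
  have dp: "d > 0" using d d_def by simp
  have c: "c > 0" using dp st by (simp add: c_def)
  have "c\<^sup>2 = 2 * (t - s + 1) / d" using dp st by (simp add: c_def)
  then have "c * c * d = 2 * (t - s + 1)" using dp by (simp add: power2_eq_square field_simps)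
  moreover have "0 \<le> - (c / 2 * d) + (t - s) / (2 * c)"
    using order_trans[OF norm_ge_zero GF_energy_estimate[OF C1 u st c]] unfolding d_def
    by (simp add: algebra_simps)
  then have "c * c * d \<le> t - s" using c by (simp add: field_simps)
  ultimately show False using st by simp
qed

lemma GF_constant_if_energy_constant:
  fixes \<phi> :: "'a::{real_inner,banach} \<Rightarrow> real"
  assumes C1: "C1 \<phi>" and u: "u \<in> GF \<phi>" and st: "0 \<le> s" "s \<le> t"
    and eq: "\<phi> (u s) \<le> \<phi> (u t)"
  shows "u t = u s"
proof (rule ccontr)
  assume "u t \<noteq> u s"
  then have n: "norm (u t - u s) > 0" by simp
  define c where "c = (t - s + 1) / norm (u t - u s)"
  have c: "c > 0" using n st by (simp add: c_def)
  have "norm (u t - u s) \<le> c / 2 * (\<phi> (u s) - \<phi> (u t)) + (t - s) / (2 * c)"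
    by (rule GF_energy_estimate[OF C1 u st c])
  also have "\<dots> \<le> (t - s) / (2 * c)" using c eq by (simp add: mult_nonneg_nonpos)
  also have "\<dots> = norm (u t - u s) * ((t - s) / (2 * (t - s + 1)))" by (simp add: c_def)
  also have "\<dots> < norm (u t - u s) * 1" using n st by (intro mult_strict_left_mono) auto
  finally show False by simp
qed

section \<open>One step of the perturbed scheme\<close>

text \<open>
  Recentring the coercivity assumption at an arbitrary point \<open>U\<close>.
\<close>
lemma quadratic_lower_bound:
  fixes \<phi> :: "'a::real_normed_vector \<Rightarrow> real"
  assumes lower: "1 / (2 * \<tau>\<^sub>s) * (norm V)\<^sup>2 + \<phi> V \<ge> - \<phi>\<^sub>s" and \<tau>\<^sub>s: "\<tau>\<^sub>s > 0"
  shows "\<phi> V \<ge> - \<phi>\<^sub>s - (norm U)\<^sup>2 / \<tau>\<^sub>s - (norm (V - U))\<^sup>2 / \<tau>\<^sub>s"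
proof -
  let ?d = "norm (V - U)"
  have "(norm V)\<^sup>2 \<le> (norm U + ?d)\<^sup>2" using norm_triangle_ineq[of U "V - U"] by (intro power_mono) auto
  also have "\<dots> \<le> 2 * (norm U)\<^sup>2 + 2 * ?d\<^sup>2"
    using sum_squares_bound[of "norm U" ?d] by (simp add: power2_sum)
  finally have "(norm V)\<^sup>2 / (2 * \<tau>\<^sub>s) \<le> (2 * (norm U)\<^sup>2 + 2 * ?d\<^sup>2) / (2 * \<tau>\<^sub>s)"
    using \<tau>\<^sub>s by (intro divide_right_mono) auto
  also have "\<dots> = (norm U)\<^sup>2 / \<tau>\<^sub>s + ?d\<^sup>2 / \<tau>\<^sub>s" using \<tau>\<^sub>s by (simp add: field_simps)
  finally show ?thesis using lower by simp
qed

locale perturbed_scheme =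
  fixes \<phi> :: "'a::{real_inner,banach} \<Rightarrow> real" and B :: "'a set" and x :: "nat \<Rightarrow> 'a"
    and M :: nat and \<tau> \<mu> \<kappa> :: real
  assumes C1: "C1 \<phi>" and finite_B: "finite B" and x_in: "\<And>k. k \<le> M \<Longrightarrow> x k \<in> span B"
    and \<tau>: "\<tau> > 0" and \<mu>: "\<mu> > 0" and \<kappa>: "\<kappa> > 0"
begin

definition proj :: "'a \<Rightarrow> 'a" where
  "proj v = (SOME p. p \<in> span B \<and> (\<forall>w\<in>span B. inner (v - p) w = 0))"

text \<open>
  The guide decreases along the samples at rate \<open>\<kappa>\<close> in time and increases with slope \<open>\<mu>\<close> in the distance
  from the sample that realizes the minimum.
\<close>
definition guide :: "'a \<Rightarrow> real" where
  "guide v = Min ((\<lambda>k. \<mu> * norm (v - x k) - \<kappa> * (real k * \<tau>)) ` {..M})"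

definition pot :: "'a \<Rightarrow> real" where
  "pot v = \<phi> v + 2 * \<mu> * norm (v - proj v) + guide v"

lemma proj_in: "proj v \<in> span B"
  and proj_orth: "w \<in> span B \<Longrightarrow> inner (v - proj v) w = 0"
proof -
  have "\<exists>p. p \<in> span B \<and> (\<forall>w\<in>span B. inner (v - p) w = 0)"
    using orthogonal_projection_exists[OF finite_B] by blast
  from someI_ex[OF this] show "proj v \<in> span B" "w \<in> span B \<Longrightarrow> inner (v - proj v) w = 0"
    by (auto simp: proj_def)
qed

lemma proj_pythagoras:
  assumes "w \<in> span B"
  shows "(norm (v - w))\<^sup>2 = (norm (v - proj v))\<^sup>2 + (norm (proj v - w))\<^sup>2"
proof -
  have "inner (v - proj v) (proj v - w) = 0"
    using proj_orth span_diff[OF proj_in assms] by blast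
  moreover have "v - w = (v - proj v) + (proj v - w)" by simp
  ultimately show ?thesis
    using norm_add_Pythagorean[of "v - proj v" "proj v - w"] by (simp add: orthogonal_def)
qed

lemma norm_proj_le:
  assumes "w \<in> span B"
  shows "norm (v - proj v) \<le> norm (v - w)" "norm (proj v - w) \<le> norm (v - w)"
  using proj_pythagoras[OF assms, of v] by (auto intro: power2_le_imp_le[OF _ norm_ge_zero])

lemma proj_id: "v \<in> span B \<Longrightarrow> proj v = v"
  using norm_proj_le(1)[of v v] by simp

lemma proj_dist_Lipschitz: "\<bar>norm (v - proj v) - norm (w - proj w)\<bar> \<le> norm (v - w)"
proof -
  have "norm (v - proj v) \<le> norm (v - w) + norm (w - proj w)" for v w
    using norm_proj_le(1)[OF proj_in, of v w] norm_triangle_ineq[of "v - w" "w - proj w"] by simp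
  from this[of v w] this[of w v] show ?thesis by (simp add: norm_minus_commute abs_le_iff)
qed

lemma guide_le: "k \<le> M \<Longrightarrow> guide v \<le> \<mu> * norm (v - x k) - \<kappa> * (real k * \<tau>)"
  unfolding guide_def by (intro Min_le) auto

lemma guide_attained: "\<exists>k\<le>M. guide v = \<mu> * norm (v - x k) - \<kappa> * (real k * \<tau>)"
proof -
  have "guide v \<in> (\<lambda>k. \<mu> * norm (v - x k) - \<kappa> * (real k * \<tau>)) ` {..M}"
    unfolding guide_def by (intro Min_in) auto
  then show ?thesis by auto
qed

lemma guide_ge: "guide v \<ge> - (\<kappa> * (real M * \<tau>))"
proof -
  obtain k where "k \<le> M" "guide v = \<mu> * norm (v - x k) - \<kappa> * (real k * \<tau>)"
    using guide_attained by blast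
  moreover have "\<kappa> * (real k * \<tau>) \<le> \<kappa> * (real M * \<tau>)"
    using \<open>k \<le> M\<close> \<kappa> \<tau> by (intro mult_left_mono mult_right_mono) auto
  moreover have "0 \<le> \<mu> * norm (v - x k)" using \<mu> by simp
  ultimately show ?thesis by linarith
qed

lemma guide_Lipschitz: "guide v \<le> guide w + \<mu> * norm (v - w)"
proof -
  obtain k where k: "k \<le> M" "guide w = \<mu> * norm (w - x k) - \<kappa> * (real k * \<tau>)"
    using guide_attained by blast
  have "norm (v - x k) \<le> norm (v - w) + norm (w - x k)"
    using norm_triangle_ineq[of "v - w" "w - x k"] by simp
  then have "\<mu> * norm (v - x k) \<le> \<mu> * norm (v - w) + \<mu> * norm (w - x k)"
    using \<mu> by (simp add: mult_left_mono flip: distrib_left)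
  then show ?thesis using guide_le[OF k(1), of v] k(2) by simp
qed

lemma pot_diff_Lipschitz: "(pot v - \<phi> v) - (pot w - \<phi> w) \<le> 3 * \<mu> * norm (v - w)"
proof -
  have "2 * \<mu> * norm (v - proj v) - 2 * \<mu> * norm (w - proj w) \<le> 2 * \<mu> * norm (v - w)"
    using \<mu> proj_dist_Lipschitz[of v w] mult_left_mono[of "norm (v - proj v) - norm (w - proj w)" "norm (v - w)" "2 * \<mu>"]
    by (simp add: algebra_simps)
  then show ?thesis using guide_Lipschitz[of v w] unfolding pot_def by simp
qed

lemma pot_on_span: "v \<in> span B \<Longrightarrow> pot v = \<phi> v + guide v"
  by (simp add: pot_def proj_id)

lemma pot_ge: "pot v \<ge> \<phi> v + guide v"
  using \<mu> by (simp add: pot_def)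

lemma continuous_on_pot: "continuous_on S pot"
proof -
  have "continuous_on UNIV \<phi>"
    using C1_GDERIV_grad[OF C1] unfolding gderiv_def
    by (meson continuous_at_imp_continuous_on has_derivative_continuous)
  moreover have "continuous_on UNIV (\<lambda>v. pot v - \<phi> v)"
  proof (rule lipschitz_on_continuous_on)
    show "(3 * \<mu>)-lipschitz_on UNIV (\<lambda>v. pot v - \<phi> v)"
    proof (rule lipschitz_onI)
      fix v w :: 'a
      show "dist (pot v - \<phi> v) (pot w - \<phi> w) \<le> 3 * \<mu> * dist v w"
        using pot_diff_Lipschitz[of v w] pot_diff_Lipschitz[of w v]
        unfolding dist_norm real_norm_def norm_minus_commute[of w v] by linarith
    qed (use \<mu> in simp)
  qed
  ultimately have "continuous_on UNIV (\<lambda>v. \<phi> v + (pot v - \<phi> v))" by (rule continuous_on_add)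
  then show ?thesis using continuous_on_subset by fastforce
qed

text \<open>
  Linearizing \<open>\<phi>\<close> at \<open>U\<close> and completing the square turns a step into an approximate proximal step for
  the guide alone, based at the explicit Euler point \<open>E\<close>.
\<close>
lemma step_comparison:
  assumes step: "MS_step \<tau> pot U V" and W: "W \<in> span B"
    and S: "convex S" "V \<in> S" "W \<in> S" "\<And>y. y \<in> S \<Longrightarrow> norm (grad \<phi> y - grad \<phi> U) \<le> \<epsilon>"
  defines "E \<equiv> U - \<tau> *\<^sub>R grad \<phi> U"
  shows "guide V + (norm (V - E))\<^sup>2 / (2 * \<tau>) \<le> guide W + (norm (W - E))\<^sup>2 / (2 * \<tau>) + \<epsilon> * norm (V - W)"
proof -
  have sq: "(norm (Y - U))\<^sup>2 / (2 * \<tau>) = (norm (Y - E))\<^sup>2 / (2 * \<tau>) - inner (grad \<phi> U) (Y - E) + \<tau> * (norm (grad \<phi> U))\<^sup>2 / 2" for Y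
  proof -
    have "Y - U = (Y - E) - \<tau> *\<^sub>R grad \<phi> U" by (simp add: E_def)
    then have "(norm (Y - U))\<^sup>2 = (norm ((Y - E) - \<tau> *\<^sub>R grad \<phi> U))\<^sup>2" by (rule arg_cong)
    also have "\<dots> = (norm (Y - E))\<^sup>2 - 2 * \<tau> * inner (grad \<phi> U) (Y - E) + \<tau>\<^sup>2 * (norm (grad \<phi> U))\<^sup>2"
      unfolding power2_norm_eq_inner inner_diff_left[of "Y - E"] inner_diff_right[of _ "Y - E"] inner_scaleR_left inner_scaleR_right
      by (simp add: inner_diff_left inner_diff_right inner_commute power2_eq_square algebra_simps)
    finally have "(norm (Y - U))\<^sup>2 = (norm (Y - E))\<^sup>2 - 2 * \<tau> * inner (grad \<phi> U) (Y - E) + \<tau>\<^sup>2 * (norm (grad \<phi> U))\<^sup>2" .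
    then show ?thesis using \<tau> by (simp add: field_simps power2_eq_square)
  qed
  have "(norm (V - U))\<^sup>2 / (2 * \<tau>) + pot V \<le> (norm (W - U))\<^sup>2 / (2 * \<tau>) + pot W"
    using step unfolding MS_step_def by simp
  moreover have "\<bar>\<phi> V - \<phi> W - inner (grad \<phi> U) (V - W)\<bar> \<le> \<epsilon> * norm (V - W)"
    by (rule linearization_error[OF C1 S(1,2,3)]) (rule S(4))
  moreover have "inner (grad \<phi> U) (V - W) = inner (grad \<phi> U) (V - E) - inner (grad \<phi> U) (W - E)"
    by (simp add: inner_diff_right)
  ultimately show ?thesis
    using sq[of V] sq[of W] pot_ge[of V] pot_on_span[OF W] by linarith
qed

lemma step_drift:
  assumes step: "MS_step \<tau> pot U V" and W: "W \<in> span B" and \<epsilon>: "\<epsilon> \<ge> 0"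
    and S: "convex S" "V \<in> S" "W \<in> S" "\<And>y. y \<in> S \<Longrightarrow> norm (grad \<phi> y - grad \<phi> U) \<le> \<epsilon>"
  defines "E \<equiv> U - \<tau> *\<^sub>R grad \<phi> U"
  shows "norm (V - E) \<le> norm (W - E) + 2 * \<tau> * (\<mu> + \<epsilon>)"
proof -
  let ?d = "norm (V - E)" and ?e = "norm (W - E)"
  have VW: "norm (V - W) \<le> ?d + ?e"
    using norm_triangle_ineq4[of "V - E" "W - E"] by simp
  have "?d\<^sup>2 / (2 * \<tau>) \<le> ?e\<^sup>2 / (2 * \<tau>) + (guide W - guide V) + \<epsilon> * norm (V - W)"
    using step_comparison[OF step W S] unfolding E_def by linarith
  also have "guide W - guide V \<le> \<mu> * norm (V - W)"
    using guide_Lipschitz[of W V] by (simp add: norm_minus_commute)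
  also have "?e\<^sup>2 / (2 * \<tau>) + \<mu> * norm (V - W) + \<epsilon> * norm (V - W) \<le> ?e\<^sup>2 / (2 * \<tau>) + (\<mu> + \<epsilon>) * (?d + ?e)"
    using mult_left_mono[OF VW, of "\<mu> + \<epsilon>"] \<mu> \<epsilon> by (simp add: algebra_simps)
  finally have "?d\<^sup>2 \<le> ?e\<^sup>2 + 2 * \<tau> * (\<mu> + \<epsilon>) * (?d + ?e)"
    using \<tau> by (simp add: field_simps)
  then have "(?d - ?e) * (?d + ?e) \<le> (2 * \<tau> * (\<mu> + \<epsilon>)) * (?d + ?e)"
    by (simp add: power2_eq_square algebra_simps)
  then have "?d - ?e \<le> 2 * \<tau> * (\<mu> + \<epsilon>) \<or> ?d + ?e = 0"
    by (metis add_nonneg_nonneg less_eq_real_def mult_right_le_imp_le norm_ge_zero)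
  then show ?thesis
  proof
    assume z: "?d + ?e = 0"
    have "?d \<le> ?d + ?e" by simp
    moreover have "0 \<le> 2 * \<tau> * (\<mu> + \<epsilon>)" using \<tau> \<mu> \<epsilon> by simp
    ultimately show ?thesis using z norm_ge_zero[of "W - E"] by linarith
  qed simp
qed

text \<open>
  On the left-hand side of the comparison the quadratic term absorbs the linearization error that is
  proportional to the unknown distance \<open>|V - E|\<close>.
\<close>
lemma step_guide:
  assumes step: "MS_step \<tau> pot U V" and W: "W \<in> span B" and \<epsilon>: "\<epsilon> \<ge> 0"
    and S: "convex S" "V \<in> S" "W \<in> S" "\<And>y. y \<in> S \<Longrightarrow> norm (grad \<phi> y - grad \<phi> U) \<le> \<epsilon>"
    and e: "norm (W - (U - \<tau> *\<^sub>R grad \<phi> U)) \<le> e"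
  shows "guide V \<le> guide W + e\<^sup>2 / (2 * \<tau>) + \<epsilon> * e + \<epsilon>\<^sup>2 * \<tau> / 2"
proof -
  define E where "E = U - \<tau> *\<^sub>R grad \<phi> U"
  let ?d = "norm (V - E)"
  have e': "norm (W - E) \<le> e" using e by (simp add: E_def)
  have "norm (V - W) \<le> ?d + norm (W - E)"
    using norm_triangle_ineq4[of "V - E" "W - E"] by simp
  then have VW: "norm (V - W) \<le> ?d + e" using e' by linarith
  have "guide V + ?d\<^sup>2 / (2 * \<tau>) \<le> guide W + (norm (W - E))\<^sup>2 / (2 * \<tau>) + \<epsilon> * norm (V - W)"
    using step_comparison[OF step W S] unfolding E_def by linarith
  also have "(norm (W - E))\<^sup>2 / (2 * \<tau>) \<le> e\<^sup>2 / (2 * \<tau>)"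
    using e' \<tau> by (intro divide_right_mono power_mono) auto
  also have "\<epsilon> * norm (V - W) \<le> \<epsilon> * ?d + \<epsilon> * e"
    using mult_left_mono[OF VW \<epsilon>] by (simp add: distrib_left)
  finally have "guide V \<le> guide W + e\<^sup>2 / (2 * \<tau>) + \<epsilon> * e + (\<epsilon> * ?d - ?d\<^sup>2 / (2 * \<tau>))" by simp
  moreover have "\<epsilon> * ?d - ?d\<^sup>2 / (2 * \<tau>) \<le> \<epsilon>\<^sup>2 * \<tau> / 2"
  proof -
    have "0 \<le> (?d - \<epsilon> * \<tau>)\<^sup>2 / (2 * \<tau>)" using \<tau> by simp
    also have "\<dots> = \<epsilon>\<^sup>2 * \<tau> / 2 - (\<epsilon> * ?d - ?d\<^sup>2 / (2 * \<tau>))"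
      using \<tau> by (simp add: power2_eq_square field_simps)
    finally show ?thesis by simp
  qed
  ultimately show ?thesis by linarith
qed

end

text \<open>
  The samples look like a trajectory: consecutive ones differ by an Euler step up to \<open>\<epsilon> \<tau>\<close>, and \<open>\<nabla>\<phi>\<close>
  oscillates by at most \<open>\<epsilon>\<close> in balls of radius \<open>\<rho>\<close> around them.  The last assumption keeps minimizers
  from leaving these balls; it holds for small \<open>\<tau>\<close> when \<open>\<phi>\<close> is bounded below by a quadratic.
\<close>
locale tube_scheme = perturbed_scheme +
  fixes \<epsilon> \<rho> L :: real
  assumes \<epsilon>: "\<epsilon> > 0" "16 * \<epsilon> \<le> \<mu>" and \<rho>: "\<rho> > 0" and L: "L \<ge> 0"
    and near: "\<And>k y. k \<le> M \<Longrightarrow> norm (y - x k) \<le> \<rho> \<Longrightarrow> norm (grad \<phi> y - grad \<phi> (x k)) \<le> \<epsilon> / 2"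
    and bound: "\<And>k. k \<le> M \<Longrightarrow> norm (grad \<phi> (x k)) \<le> L"
    and euler: "\<And>k. k < M \<Longrightarrow> norm (x (Suc k) - x k + \<tau> *\<^sub>R grad \<phi> (x k)) \<le> \<epsilon> / 2 * \<tau>"
    and \<kappa>_small: "\<kappa> * (real M * \<tau>) \<le> \<mu> * (\<rho> / 2)"
    and \<tau>_small: "(L + 2 * \<mu>) * \<tau> \<le> \<rho> / 2"
    and coercive: "\<And>k U V. k \<le> M \<Longrightarrow> norm (U - x k) \<le> \<rho> / 2 \<Longrightarrow> \<rho> / 2 < norm (V - U) \<Longrightarrow>
        \<phi> U + 3 * \<mu> * norm (V - U) < \<phi> V + (norm (V - U))\<^sup>2 / (2 * \<tau>)"
begin

text \<open>
  A nonpositive guide is what keeps \<open>U\<close> inside the tube: the distance to the sample \<open>x k\<close> is paid for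
  by the at most \<open>\<kappa> M \<tau>\<close> that the guide can offer.
\<close>
definition guided :: "'a \<Rightarrow> nat \<Rightarrow> bool" where
  "guided U k \<longleftrightarrow> k \<le> M \<and> U \<in> span B \<and> guide U \<le> 0 \<and>
     guide U = \<mu> * norm (U - x k) - \<kappa> * (real k * \<tau>)"

lemma guided_dist:
  assumes "guided U k"
  shows "norm (U - x k) \<le> \<rho> / 2"
proof -
  have k: "k \<le> M" and "\<mu> * norm (U - x k) \<le> \<kappa> * (real k * \<tau>)" using assms by (auto simp: guided_def)
  moreover have "\<kappa> * (real k * \<tau>) \<le> \<kappa> * (real M * \<tau>)"
    using k \<kappa> \<tau> by (intro mult_left_mono mult_right_mono) auto
  ultimately have "\<mu> * norm (U - x k) \<le> \<mu> * (\<rho> / 2)" using \<kappa>_small by linarith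
  then show ?thesis using \<mu> by simp
qed

lemma guided_grad:
  assumes "guided U k"
  shows "norm (grad \<phi> U - grad \<phi> (x k)) \<le> \<epsilon> / 2"
    and "norm (y - x k) \<le> \<rho> \<Longrightarrow> norm (grad \<phi> y - grad \<phi> U) \<le> \<epsilon>"
proof -
  have k: "k \<le> M" using assms by (simp add: guided_def)
  show *: "norm (grad \<phi> U - grad \<phi> (x k)) \<le> \<epsilon> / 2"
    using near[OF k, of U] guided_dist[OF assms] \<rho> by simp
  show "norm (grad \<phi> y - grad \<phi> U) \<le> \<epsilon>" if "norm (y - x k) \<le> \<rho>"
    using near[OF k that] * norm_triangle_ineq4[of "grad \<phi> y - grad \<phi> (x k)" "grad \<phi> U - grad \<phi> (x k)"]
    by simp
qed

lemma guided_grad_bound: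
  assumes "guided U k" shows "norm (grad \<phi> U) \<le> L + \<epsilon> / 2"
  using guided_grad(1)[OF assms] bound[of k] assms norm_triangle_ineq[of "grad \<phi> U - grad \<phi> (x k)" "grad \<phi> (x k)"]
  by (simp add: guided_def)

lemma guided_euler:
  assumes "guided U k" "k < M"
  shows "norm (x (Suc k) - x k + \<tau> *\<^sub>R grad \<phi> U) \<le> \<epsilon> * \<tau>"
proof -
  have d: "norm (\<tau> *\<^sub>R (grad \<phi> U - grad \<phi> (x k))) \<le> \<epsilon> / 2 * \<tau>"
    using guided_grad(1)[OF assms(1)] \<tau> by (simp add: mult.commute)
  have eq: "x (Suc k) - x k + \<tau> *\<^sub>R grad \<phi> U
      = (x (Suc k) - x k + \<tau> *\<^sub>R grad \<phi> (x k)) + \<tau> *\<^sub>R (grad \<phi> U - grad \<phi> (x k))"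
    by (simp add: algebra_simps)
  show ?thesis
    unfolding eq using norm_triangle_mono[OF euler[OF assms(2)] d] by (simp add: field_simps)
qed

lemma guided_increment:
  assumes s: "guided U k" and k: "k < M"
  shows "norm (x (Suc k) - x k) \<le> \<rho> / 2"
proof -
  have "norm (x (Suc k) - x k) \<le> norm (x (Suc k) - x k + \<tau> *\<^sub>R grad \<phi> U) + norm (\<tau> *\<^sub>R grad \<phi> U)"
    using norm_triangle_ineq4[of "x (Suc k) - x k + \<tau> *\<^sub>R grad \<phi> U" "\<tau> *\<^sub>R grad \<phi> U"] by simp
  also have "\<dots> \<le> \<epsilon> * \<tau> + \<tau> * (L + \<epsilon> / 2)"
    using guided_euler[OF s k] guided_grad_bound[OF s] \<tau> by (simp add: add_mono)
  also have "\<dots> \<le> (L + 2 * \<mu>) * \<tau>" using mult_right_mono[of "\<epsilon> + \<epsilon> / 2" "2 * \<mu>" \<tau>] \<epsilon> \<tau> by (simp add: algebra_simps)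
  finally show ?thesis using \<tau>_small by linarith
qed

text \<open>
  Here the coercivity of \<open>\<phi>\<close> enters; it makes a step a local problem in the ball of radius \<open>\<rho>/2\<close>.
\<close>
lemma far_is_worse:
  assumes "guided U k" "\<rho> / 2 < norm (V - U)"
  shows "pot U < 1 / (2 * \<tau>) * (norm (V - U))\<^sup>2 + pot V"
  using coercive[OF _ guided_dist[OF assms(1)] assms(2)] pot_diff_Lipschitz[of U V] assms(1)
  by (simp add: guided_def norm_minus_commute)

lemma step_near:
  assumes "guided U k" "MS_step \<tau> pot U V"
  shows "norm (V - U) \<le> \<rho> / 2"
proof (rule ccontr)
  assume "\<not> ?thesis"
  then have "pot U < 1 / (2 * \<tau>) * (norm (V - U))\<^sup>2 + pot V" using far_is_worse[OF assms(1)] by simp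
  moreover have "1 / (2 * \<tau>) * (norm (V - U))\<^sup>2 + pot V \<le> 1 / (2 * \<tau>) * (norm (U - U))\<^sup>2 + pot U"
    using assms(2) unfolding MS_step_def by blast
  ultimately show False by simp
qed

lemma step_in_ball:
  assumes "guided U k" "MS_step \<tau> pot U V"
  shows "V \<in> cball (x k) \<rho>"
  using step_near[OF assms] guided_dist[OF assms(1)] norm_triangle_ineq[of "V - U" "U - x k"]
  by (simp add: dist_norm norm_minus_commute)

text \<open>
  The condition under which \<open>-\<nabla>\<phi>\<close> is within \<open>2 \<epsilon>\<close> of the subspace: either the next sample gives the
  direction, or the arc ends at \<open>x M\<close> where the gradient is small and the zero vector will do.
\<close>
definition movable :: "nat \<Rightarrow> bool" where
  "movable k \<longleftrightarrow> k < M \<or> (k = M \<and> norm (grad \<phi> (x M)) \<le> \<epsilon>)"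

lemma tangent_direction:
  assumes s: "guided U k" and m: "movable k"
  obtains w where "w \<in> span B" "norm (w + grad \<phi> U) \<le> 2 * \<epsilon>"
proof (cases "k < M")
  case True
  let ?w = "(1 / \<tau>) *\<^sub>R (x (Suc k) - x k)"
  have "?w \<in> span B" using x_in[of k] x_in[of "Suc k"] True by (intro span_scale span_diff) auto
  moreover have "?w + grad \<phi> U = (1 / \<tau>) *\<^sub>R (x (Suc k) - x k + \<tau> *\<^sub>R grad \<phi> U)"
    using \<tau> by (simp add: algebra_simps)
  then have "norm (?w + grad \<phi> U) = norm (x (Suc k) - x k + \<tau> *\<^sub>R grad \<phi> U) / \<tau>"
    using \<tau> by simp
  then have "norm (?w + grad \<phi> U) \<le> \<epsilon>"
    using guided_euler[OF s True] \<tau> by (simp only: pos_divide_le_eq)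
  then have "norm (?w + grad \<phi> U) \<le> 2 * \<epsilon>" using \<epsilon>(1) by linarith
  ultimately show thesis using that by blast
next
  case False
  then have k: "k = M" "norm (grad \<phi> (x k)) \<le> \<epsilon>" using m by (auto simp: movable_def)
  then have "norm (0 + grad \<phi> U) \<le> 2 * \<epsilon>"
    using guided_grad(1)[OF s] \<epsilon>(1) norm_triangle_ineq[of "grad \<phi> U - grad \<phi> (x k)" "grad \<phi> (x k)"] by simp
  then show thesis using that span_zero by blast
qed

text \<open>
  Replacing \<open>V\<close> by its projection decreases the quadratic term by Pythagoras, increases \<open>\<phi>\<close> by at most
  \<open>3 \<epsilon>\<close> times the distance, since \<open>\<nabla>\<phi>\<close> is nearly tangent to the subspace, and the guide by at
  most \<open>\<mu>\<close> times the distance.  The penalty with slope \<open>2 \<mu>\<close> outweighs both.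
\<close>
lemma projecting_is_better:
  assumes s: "guided U k" and m: "movable k" and V: "norm (V - U) \<le> \<rho> / 2"
  shows "1 / (2 * \<tau>) * (norm (proj V - U))\<^sup>2 + pot (proj V) + (\<mu> - 3 * \<epsilon>) * norm (V - proj V)
      \<le> 1 / (2 * \<tau>) * (norm (V - U))\<^sup>2 + pot V"
proof -
  let ?n = "norm (V - proj V)" and ?g = "grad \<phi> U"
  have U: "U \<in> span B" using s by (simp add: guided_def)
  obtain w where w: "w \<in> span B" "norm (w + ?g) \<le> 2 * \<epsilon>" using tangent_direction[OF s m] .
  have "(norm (V - U))\<^sup>2 \<ge> (norm (proj V - U))\<^sup>2" using proj_pythagoras[OF U, of V] by simp
  then have sq: "1 / (2 * \<tau>) * (norm (proj V - U))\<^sup>2 \<le> 1 / (2 * \<tau>) * (norm (V - U))\<^sup>2"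
    using \<tau> by (intro mult_left_mono) auto
  have b: "guide (proj V) \<le> guide V + \<mu> * ?n"
    using guide_Lipschitz[of "proj V" V] by (simp add: norm_minus_commute)
  let ?S = "cball (x k) \<rho>"
  have "norm (V - x k) \<le> \<rho>" 
    using V guided_dist[OF s] norm_triangle_ineq[of "V - U" "U - x k"] by simp
  moreover have "norm (proj V - x k) \<le> norm (V - x k)"
    using norm_proj_le(2)[OF x_in] s by (simp add: guided_def)
  ultimately have VS: "V \<in> ?S" "proj V \<in> ?S" by (auto simp: dist_norm norm_minus_commute)
  have lin: "\<bar>\<phi> V - \<phi> (proj V) - inner ?g (V - proj V)\<bar> \<le> \<epsilon> * ?n"
    by (rule linearization_error[OF C1 _ VS]) (use guided_grad(2)[OF s] in \<open>auto simp: dist_norm norm_minus_commute\<close>)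
  have "inner ?g (V - proj V) = inner (w + ?g) (V - proj V)"
    using proj_orth[OF w(1), of V] by (simp add: inner_add_left inner_commute[of w])
  moreover have "\<bar>inner (w + ?g) (V - proj V)\<bar> \<le> 2 * \<epsilon> * ?n"
    using order_trans[OF Cauchy_Schwarz_ineq2 mult_right_mono[OF w(2) norm_ge_zero]] .
  ultimately have "\<phi> (proj V) \<le> \<phi> V + 3 * \<epsilon> * ?n" using lin by linarith
  then show ?thesis using sq b pot_on_span[OF proj_in, of V]
    unfolding pot_def[of V] by (simp add: algebra_simps)
qed

lemma step_in_span:
  assumes s: "guided U k" and m: "movable k" and st: "MS_step \<tau> pot U V"
  shows "V \<in> span B"
proof -
  have "1 / (2 * \<tau>) * (norm (V - U))\<^sup>2 + pot V \<le> 1 / (2 * \<tau>) * (norm (proj V - U))\<^sup>2 + pot (proj V)"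
    using st unfolding MS_step_def by blast
  with projecting_is_better[OF s m step_near[OF s st]]
  have "(\<mu> - 3 * \<epsilon>) * norm (V - proj V) \<le> 0" by linarith
  moreover have "\<mu> - 3 * \<epsilon> > 0" using \<epsilon> by linarith
  ultimately have "V = proj V" by (simp add: mult_le_0_iff)
  then show ?thesis using proj_in by metis
qed

text \<open>
  By the two preceding comparisons it suffices to minimize over the compact intersection of the
  subspace with a ball.
\<close>
lemma step_exists:
  assumes s: "guided U k" and m: "movable k"
  shows "\<exists>V. MS_step \<tau> pot U V"
proof -
  let ?F = "\<lambda>V. 1 / (2 * \<tau>) * (norm (V - U))\<^sup>2 + pot V"
  let ?C = "span B \<inter> cball U (\<rho> / 2)"
  have U: "U \<in> ?C" using s \<rho> by (simp add: guided_def)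
  have "continuous_on ?C ?F" by (intro continuous_intros continuous_on_pot)
  then obtain Y where Y: "Y \<in> ?C" "\<And>V. V \<in> ?C \<Longrightarrow> ?F Y \<le> ?F V"
    using continuous_attains_inf[OF compact_span_cball[OF finite_B]] U by (metis (no_types, lifting) empty_iff)
  have "?F Y \<le> ?F V" for V
  proof (cases "norm (V - U) \<le> \<rho> / 2")
    case True
    have "norm (proj V - U) \<le> norm (V - U)" using norm_proj_le(2) s by (simp add: guided_def)
    then have "proj V \<in> ?C" using True proj_in by (simp add: dist_norm norm_minus_commute)
    then have "?F Y \<le> ?F (proj V)" by (rule Y(2))
    moreover have "0 \<le> (\<mu> - 3 * \<epsilon>) * norm (V - proj V)" using \<epsilon> by simp
    ultimately show ?thesis using projecting_is_better[OF s m True] by linarith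
  next
    case False
    then have "?F U < ?F V" using far_is_worse[OF s, of V] by simp
    then show ?thesis using Y(2)[OF U] by linarith
  qed
  then show ?thesis unfolding MS_step_def by blast
qed

text \<open>
  The competitor \<open>U + (x (k + 1) - x k)\<close> lies in the subspace and within \<open>\<epsilon> \<tau>\<close> of the Euler point; the
  \<open>\<mu>\<close>-Lipschitz guide can displace the minimizer from it by no more than a multiple of \<open>\<mu> \<tau>\<close>.
\<close>
lemma step_Euler:
  assumes s: "guided U k" and k: "k < M" and st: "MS_step \<tau> pot U V"
  shows "norm (V - U + \<tau> *\<^sub>R grad \<phi> U) \<le> 4 * \<mu> * \<tau>"
proof -
  define W where "W = x (Suc k) + (U - x k)"
  let ?S = "cball (x k) \<rho>"
  have W: "W \<in> span B" unfolding W_def using s k x_in by (intro span_add span_diff) (auto simp: guided_def)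
  have "norm (W - x k) \<le> \<rho>"
    using guided_increment[OF s k] guided_dist[OF s] norm_triangle_ineq[of "x (Suc k) - x k" "U - x k"] unfolding W_def by (simp add: algebra_simps)
  then have WS: "W \<in> ?S" by (simp add: dist_norm norm_minus_commute)
  have VS: "V \<in> ?S" by (rule step_in_ball[OF s st])
  have "norm (V - (U - \<tau> *\<^sub>R grad \<phi> U)) \<le> norm (W - (U - \<tau> *\<^sub>R grad \<phi> U)) + 2 * \<tau> * (\<mu> + \<epsilon>)"
    by (rule step_drift[OF st W _ _ VS WS])
       (use \<epsilon> guided_grad(2)[OF s] in \<open>auto simp: dist_norm norm_minus_commute\<close>)
  also have "norm (W - (U - \<tau> *\<^sub>R grad \<phi> U)) \<le> \<epsilon> * \<tau>"
    using guided_euler[OF s k] unfolding W_def by (simp add: algebra_simps)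
  also have "\<epsilon> * \<tau> + 2 * \<tau> * (\<mu> + \<epsilon>) \<le> 4 * \<mu> * \<tau>"
    using mult_right_mono[of "3 * \<epsilon>" "2 * \<mu>" \<tau>] \<epsilon> \<tau> by (simp add: algebra_simps)
  finally show ?thesis by (simp add: algebra_simps)
qed

text \<open>
  The competitor advances by one sample and at the same time closes the fraction \<open>\<theta>\<close> of the distance
  to the curve.  Its guide is smaller by \<open>\<kappa> \<tau> + \<mu> \<theta> |U - x k|\<close>, while moving there costs about
  \<open>(\<theta> |U - x k|)\<^sup>2 / (2 \<tau>)\<close>, at most half of the second gain if \<open>\<theta> |U - x k| \<le> \<mu> \<tau>\<close>.
\<close>
lemma step_progress:
  assumes s: "guided U k" and k: "k < M" and st: "MS_step \<tau> pot U V" and \<eta>: "\<eta> \<ge> 0"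
    and \<theta>: "0 \<le> \<theta>" "\<theta> \<le> 1" "\<theta> * norm (U - x k) \<le> \<mu> * \<tau>"
    and S: "convex S" "V \<in> S" "x (Suc k) + (1 - \<theta>) *\<^sub>R (U - x k) \<in> S"
      "\<And>y. y \<in> S \<Longrightarrow> norm (grad \<phi> y - grad \<phi> U) \<le> \<eta>"
    and eul: "norm (x (Suc k) - x k + \<tau> *\<^sub>R grad \<phi> U) \<le> \<eta> * \<tau>"
  shows "guide V \<le> guide U - \<kappa> * \<tau> - \<mu> / 2 * (\<theta> * norm (U - x k)) + 2 * \<eta> * (\<theta> * norm (U - x k)) + 2 * \<eta>\<^sup>2 * \<tau>"
proof -
  define W where "W = x (Suc k) + (1 - \<theta>) *\<^sub>R (U - x k)"
  define d where "d = \<theta> * norm (U - x k)"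
  have W: "W \<in> span B" unfolding W_def using s k x_in
    by (intro span_add span_scale span_diff) (auto simp: guided_def)
  have "W - (U - \<tau> *\<^sub>R grad \<phi> U) = (x (Suc k) - x k + \<tau> *\<^sub>R grad \<phi> U) - \<theta> *\<^sub>R (U - x k)"
    by (simp add: W_def algebra_simps)
  then have "norm (W - (U - \<tau> *\<^sub>R grad \<phi> U)) = norm ((x (Suc k) - x k + \<tau> *\<^sub>R grad \<phi> U) - \<theta> *\<^sub>R (U - x k))"
    by (rule arg_cong)
  then have e: "norm (W - (U - \<tau> *\<^sub>R grad \<phi> U)) \<le> d + \<eta> * \<tau>"
    using eul norm_triangle_ineq4[of "x (Suc k) - x k + \<tau> *\<^sub>R grad \<phi> U" "\<theta> *\<^sub>R (U - x k)"] \<theta>(1)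
    by (simp add: d_def)
  have d: "0 \<le> d" "d \<le> \<mu> * \<tau>" using \<theta> by (auto simp: d_def)
  have "guide V \<le> guide W + (d + \<eta> * \<tau>)\<^sup>2 / (2 * \<tau>) + \<eta> * (d + \<eta> * \<tau>) + \<eta>\<^sup>2 * \<tau> / 2"
    by (rule step_guide[OF st W \<eta> S(1,2) _ S(4) e]) (use S(3) in \<open>simp_all add: W_def\<close>)
  also have "(d + \<eta> * \<tau>)\<^sup>2 / (2 * \<tau>) = d * d / (2 * \<tau>) + \<eta> * d + \<eta>\<^sup>2 * \<tau> / 2"
    using \<tau> by (simp add: power2_eq_square field_simps)
  also have "d * d / (2 * \<tau>) \<le> \<mu> / 2 * d"
    using mult_right_mono[OF d(2) d(1)] \<tau> by (simp add: field_simps)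
  also have "guide W \<le> \<mu> * norm (W - x (Suc k)) - \<kappa> * (real (Suc k) * \<tau>)"
    using guide_le[of "Suc k" W] k by simp
  also have "norm (W - x (Suc k)) = norm (U - x k) - d" using \<theta> by (simp add: W_def d_def left_diff_distrib)
  also have "\<mu> * (norm (U - x k) - d) - \<kappa> * (real (Suc k) * \<tau>) = guide U - \<kappa> * \<tau> - \<mu> * d"
    using s by (simp add: guided_def algebra_simps)
  finally show ?thesis unfolding d_def[symmetric] by (simp add: algebra_simps power2_eq_square)
qed

text \<open>
  Here \<open>\<theta>\<close> is chosen so that \<open>\<theta> |U - x k| = \<mu> \<tau>\<close>, the optimal move towards the curve.
\<close>
lemma step_guide_far:
  assumes s: "guided U k" and k: "k < M" and st: "MS_step \<tau> pot U V"
    and D: "\<mu> * \<tau> \<le> norm (U - x k)"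
  shows "guide V \<le> guide U - \<kappa> * \<tau> - \<mu>\<^sup>2 * \<tau> / 8"
proof -
  let ?D = "norm (U - x k)" and ?S = "cball (x k) \<rho>"
  define \<theta> where "\<theta> = \<mu> * \<tau> / ?D"
  have D0: "?D > 0" using D \<mu> \<tau> by (meson less_le_trans mult_pos_pos)
  have \<theta>: "0 \<le> \<theta>" "\<theta> \<le> 1" "\<theta> * ?D = \<mu> * \<tau>" using D D0 \<mu> \<tau> by (auto simp: \<theta>_def)
  have n1: "norm (x (Suc k) - x k) \<le> \<rho> / 2" by (rule guided_increment[OF s k])
  have "norm ((1 - \<theta>) *\<^sub>R (U - x k)) \<le> \<rho> / 2"
    using guided_dist[OF s] \<theta> mult_left_le_one_le[of ?D "1 - \<theta>"] by simp
  then have "norm (x (Suc k) + (1 - \<theta>) *\<^sub>R (U - x k) - x k) \<le> \<rho>"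
    using n1 norm_triangle_ineq[of "x (Suc k) - x k" "(1 - \<theta>) *\<^sub>R (U - x k)"] by (simp add: algebra_simps)
  then have WS: "x (Suc k) + (1 - \<theta>) *\<^sub>R (U - x k) \<in> ?S" by (simp add: dist_norm norm_minus_commute)
  have VS: "V \<in> ?S" by (rule step_in_ball[OF s st])
  have "guide V \<le> guide U - \<kappa> * \<tau> - \<mu> / 2 * (\<theta> * ?D) + 2 * \<epsilon> * (\<theta> * ?D) + 2 * \<epsilon>\<^sup>2 * \<tau>"
    by (rule step_progress[OF s k st _ \<theta>(1,2) _ _ VS WS])
       (use \<epsilon> \<theta> guided_grad(2)[OF s] guided_euler[OF s k] in \<open>auto simp: dist_norm norm_minus_commute\<close>)
  also have "\<dots> = guide U - \<kappa> * \<tau> - \<mu>\<^sup>2 * \<tau> / 2 + (2 * \<epsilon> * \<mu> + 2 * \<epsilon>\<^sup>2) * \<tau>"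
    by (simp add: \<theta>(3) power2_eq_square algebra_simps)
  also have "2 * \<epsilon> * \<mu> + 2 * \<epsilon>\<^sup>2 \<le> 3 * \<mu>\<^sup>2 / 8"
  proof -
    have "16 * (\<epsilon> * \<mu>) \<le> \<mu> * \<mu>" using mult_right_mono[OF \<epsilon>(2), of \<mu>] \<mu> by simp
    moreover have "\<epsilon> * \<epsilon> \<le> \<epsilon> * \<mu>" using \<epsilon> by simp
    moreover have "0 \<le> \<mu> * \<mu>" by simp
    ultimately show ?thesis unfolding power2_eq_square by linarith
  qed
  finally show ?thesis using \<tau> by (simp add: algebra_simps)
qed

text \<open>
  At the last sample there is nowhere to advance to, but if the gradient is small, then the same
  competitor without the advance makes the guide decrease when \<open>U\<close> is far from \<open>x M\<close>.  When \<open>U\<close> is close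
  to \<open>x M\<close>, the guide is already near its minimum \<open>-\<kappa> M \<tau>\<close> and stays there.
\<close>
lemma step_guide_end:
  assumes s: "guided U M" and m: "movable M" and st: "MS_step \<tau> pot U V"
  shows "guide V \<le> max (guide U) (2 * \<mu>\<^sup>2 * \<tau> - \<kappa> * (real M * \<tau>))"
proof -
  let ?D = "norm (U - x M)" and ?S = "cball (x M) \<rho>"
  define \<theta> where "\<theta> = (if \<mu> * \<tau> \<le> ?D then \<mu> * \<tau> / ?D else 1)"
  define d where "d = \<theta> * ?D"
  have \<theta>: "0 \<le> \<theta>" "\<theta> \<le> 1" "0 \<le> d" "d \<le> \<mu> * \<tau>" "d \<le> ?D"
    and d: "d = \<mu> * \<tau> \<or> (d = ?D \<and> ?D < \<mu> * \<tau>)"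
    using \<mu> \<tau> mult_pos_pos[OF \<mu> \<tau>] by (auto simp: \<theta>_def d_def divide_le_eq_1 simp del: mult_pos_pos)
  define W where "W = U - \<theta> *\<^sub>R (U - x M)"
  have W: "W \<in> span B" unfolding W_def using s x_in by (intro span_scale span_diff) (auto simp: guided_def)
  have gU: "norm (grad \<phi> U) \<le> 2 * \<epsilon>"
    using guided_grad(1)[OF s] m \<epsilon>(1) norm_triangle_ineq[of "grad \<phi> U - grad \<phi> (x M)" "grad \<phi> (x M)"]
    by (simp add: movable_def)
  have "norm (W - (U - \<tau> *\<^sub>R grad \<phi> U)) \<le> norm (\<tau> *\<^sub>R grad \<phi> U) + norm (\<theta> *\<^sub>R (U - x M))"
    using norm_triangle_ineq4[of "\<tau> *\<^sub>R grad \<phi> U" "\<theta> *\<^sub>R (U - x M)"] by (simp add: W_def)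
  also have "\<dots> \<le> d + 2 * \<epsilon> * \<tau>" using gU \<tau> \<theta> by (simp add: d_def mult.commute)
  finally have e: "norm (W - (U - \<tau> *\<^sub>R grad \<phi> U)) \<le> d + 2 * \<epsilon> * \<tau>" .
  have VS: "V \<in> ?S" by (rule step_in_ball[OF s st])
  have Wx: "norm (W - x M) = ?D - d"
  proof -
    have "W - x M = (1 - \<theta>) *\<^sub>R (U - x M)" by (simp add: W_def algebra_simps)
    then have "norm (W - x M) = norm ((1 - \<theta>) *\<^sub>R (U - x M))" by (rule arg_cong)
    then show ?thesis using \<theta> by (simp add: d_def left_diff_distrib)
  qed
  then have WS: "W \<in> ?S" using guided_dist[OF s] \<theta> \<rho> by (simp add: dist_norm norm_minus_commute)
  have "guide V \<le> guide W + (d + 2 * \<epsilon> * \<tau>)\<^sup>2 / (2 * \<tau>) + \<epsilon> * (d + 2 * \<epsilon> * \<tau>) + \<epsilon>\<^sup>2 * \<tau> / 2"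
    by (rule step_guide[OF st W _ _ VS WS _ e])
       (use \<epsilon> guided_grad(2)[OF s] in \<open>auto simp: dist_norm norm_minus_commute\<close>)
  also have "(d + 2 * \<epsilon> * \<tau>)\<^sup>2 / (2 * \<tau>) = d * d / (2 * \<tau>) + 2 * \<epsilon> * d + 2 * \<epsilon>\<^sup>2 * \<tau>"
    using \<tau> by (simp add: power2_eq_square field_simps)
  also have "d * d / (2 * \<tau>) \<le> \<mu> / 2 * d"
    using mult_right_mono[OF \<theta>(4,3)] \<tau> by (simp add: field_simps)
  also have "guide W \<le> \<mu> * (?D - d) - \<kappa> * (real M * \<tau>)"
    using guide_le[of M W] Wx by simp
  also have "\<mu> * (?D - d) - \<kappa> * (real M * \<tau>) = guide U - \<mu> * d"
    using s by (simp add: guided_def algebra_simps)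
  finally have "guide V \<le> guide U - \<mu> / 2 * d + 3 * \<epsilon> * d + 9 / 2 * (\<epsilon>\<^sup>2 * \<tau>)"
    by (simp add: algebra_simps power2_eq_square)
  moreover have "0 \<le> \<epsilon>\<^sup>2 * \<tau>" using \<tau> by simp
  ultimately have main: "guide V \<le> guide U - \<mu> / 2 * d + 3 * \<epsilon> * d + 5 * (\<epsilon>\<^sup>2 * \<tau>)" by linarith
  have "3 * \<epsilon> * d \<le> 3 / 16 * \<mu> * d" using \<epsilon> \<theta>(3) by (intro mult_right_mono) auto
  with main have main: "guide V \<le> guide U - \<mu> / 4 * d + 5 * (\<epsilon>\<^sup>2 * \<tau>)"
    using mult_nonneg_nonneg[OF less_imp_le[OF \<mu>] \<theta>(3)] by (simp add: algebra_simps)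
  have "256 * \<epsilon>\<^sup>2 \<le> \<mu>\<^sup>2" using mult_mono[OF \<epsilon>(2) \<epsilon>(2)] \<epsilon>(1) \<mu> by (simp add: power2_eq_square)
  then have sq: "256 * (\<epsilon>\<^sup>2 * \<tau>) \<le> \<mu>\<^sup>2 * \<tau>" using mult_right_mono[of "256 * \<epsilon>\<^sup>2" "\<mu>\<^sup>2" \<tau>] \<tau> by simp
  have l0: "0 \<le> \<mu>\<^sup>2 * \<tau>" using \<tau> by simp
  from d show ?thesis
  proof
    assume "d = \<mu> * \<tau>"
    then have "\<mu> / 4 * d = \<mu>\<^sup>2 * \<tau> / 4" by (simp add: power2_eq_square)
    then show ?thesis using main sq l0 by linarith
  next
    assume a: "d = ?D \<and> ?D < \<mu> * \<tau>"
    then have "\<mu> * ?D \<le> \<mu>\<^sup>2 * \<tau>" using \<mu> by (simp add: power2_eq_square)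
    then have "guide U \<le> \<mu>\<^sup>2 * \<tau> - \<kappa> * (real M * \<tau>)" using s by (simp add: guided_def)
    moreover have "0 \<le> \<mu> / 4 * d" using \<mu> \<theta> by simp
    ultimately show ?thesis using main sq l0 by linarith
  qed
qed

end

text \<open>
  A second modulus, for the steps that start within \<open>\<mu> \<tau>\<close> of the curve.  Everything that
  such a step involves happens within \<open>(L + 8 \<mu>) \<tau>\<close> of a sample.
\<close>
locale fine_scheme = tube_scheme +
  fixes \<epsilon>' \<rho>' :: real
  assumes \<epsilon>': "\<epsilon>' > 0" "16 * \<epsilon>' \<le> \<mu>"
    and near': "\<And>k y. k \<le> M \<Longrightarrow> norm (y - x k) \<le> \<rho>' \<Longrightarrow> norm (grad \<phi> y - grad \<phi> (x k)) \<le> \<epsilon>' / 2"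
    and euler': "\<And>k. k < M \<Longrightarrow> norm (x (Suc k) - x k + \<tau> *\<^sub>R grad \<phi> (x k)) \<le> \<epsilon>' / 2 * \<tau>"
    and \<tau>_small': "(L + 8 * \<mu>) * \<tau> \<le> \<rho>'"
begin

lemma step_guide_close:
  assumes s: "guided U k" and k: "k < M" and st: "MS_step \<tau> pot U V"
    and D: "norm (U - x k) < \<mu> * \<tau>"
  shows "guide V \<le> guide U - \<kappa> * \<tau> + 2 * \<epsilon>'\<^sup>2 * \<tau>"
proof -
  let ?D = "norm (U - x k)" and ?S = "cball (x k) \<rho>'"
  have kM: "k \<le> M" using k by simp
  have L\<tau>: "0 \<le> L * \<tau>" "0 \<le> \<mu> * \<tau>" "\<epsilon> * \<tau> \<le> \<mu> * \<tau>" "\<epsilon>' * \<tau> \<le> \<mu> * \<tau>"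
    using L \<mu> \<tau> \<epsilon> \<epsilon>' by (auto intro!: mult_right_mono)
  have U: "?D \<le> \<rho>'" using D \<tau>_small' L\<tau> by (simp add: algebra_simps)
  have gU: "norm (grad \<phi> U - grad \<phi> (x k)) \<le> \<epsilon>' / 2" by (rule near'[OF kM U])
  have gS: "norm (grad \<phi> y - grad \<phi> U) \<le> \<epsilon>'" if "y \<in> ?S" for y
    using near'[OF kM, of y] that gU norm_triangle_ineq4[of "grad \<phi> y - grad \<phi> (x k)" "grad \<phi> U - grad \<phi> (x k)"]
    by (simp add: dist_norm norm_minus_commute)
  have eul: "norm (x (Suc k) - x k + \<tau> *\<^sub>R grad \<phi> U) \<le> \<epsilon>' * \<tau>"
  proof -
    have d: "norm (\<tau> *\<^sub>R (grad \<phi> U - grad \<phi> (x k))) \<le> \<epsilon>' / 2 * \<tau>"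
      using gU \<tau> by (simp add: mult.commute)
    have eq: "x (Suc k) - x k + \<tau> *\<^sub>R grad \<phi> U
        = (x (Suc k) - x k + \<tau> *\<^sub>R grad \<phi> (x k)) + \<tau> *\<^sub>R (grad \<phi> U - grad \<phi> (x k))"
      by (simp add: algebra_simps)
    show ?thesis
      unfolding eq using norm_triangle_mono[OF euler'[OF k] d] by (simp add: field_simps)
  qed
  have gUn: "norm (\<tau> *\<^sub>R grad \<phi> U) \<le> L * \<tau> + \<mu> * \<tau>"
  proof -
    have "\<tau> * norm (grad \<phi> U) \<le> \<tau> * (L + \<epsilon> / 2)" using guided_grad_bound[OF s] \<tau> by simp
    moreover have "\<tau> * (L + \<epsilon> / 2) = L * \<tau> + \<epsilon> * \<tau> / 2" by (simp add: algebra_simps)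
    moreover have "0 \<le> \<epsilon> * \<tau>" using \<epsilon> \<tau> by simp
    moreover have "norm (\<tau> *\<^sub>R grad \<phi> U) = \<tau> * norm (grad \<phi> U)" using \<tau> by simp
    ultimately show ?thesis using L\<tau> by linarith
  qed
  have "norm (x (Suc k) - x k) \<le> \<rho>'"
    using norm_triangle_ineq4[of "x (Suc k) - x k + \<tau> *\<^sub>R grad \<phi> U" "\<tau> *\<^sub>R grad \<phi> U"] eul gUn L\<tau> \<tau>_small'
    by (simp add: algebra_simps)
  then have WS: "x (Suc k) + (1 - 1) *\<^sub>R (U - x k) \<in> ?S" by (simp add: dist_norm norm_minus_commute)
  have "norm (V - U) \<le> norm (V - U + \<tau> *\<^sub>R grad \<phi> U) + norm (\<tau> *\<^sub>R grad \<phi> U)"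
    using norm_triangle_ineq4[of "V - U + \<tau> *\<^sub>R grad \<phi> U" "\<tau> *\<^sub>R grad \<phi> U"] by simp
  then have "norm (V - x k) \<le> \<rho>'"
    using step_Euler[OF s k st] gUn D norm_triangle_ineq[of "V - U" "U - x k"] \<tau>_small' L\<tau>
    by (simp add: algebra_simps)
  then have VS: "V \<in> ?S" by (simp add: dist_norm norm_minus_commute)
  have "guide V \<le> guide U - \<kappa> * \<tau> - \<mu> / 2 * (1 * ?D) + 2 * \<epsilon>' * (1 * ?D) + 2 * \<epsilon>'\<^sup>2 * \<tau>"
    by (rule step_progress[OF s k st _ _ _ _ _ VS WS gS eul]) (use \<epsilon>' D in auto)
  moreover have "2 * \<epsilon>' * ?D \<le> \<mu> / 2 * ?D" using \<epsilon>' by (intro mult_right_mono) auto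
  ultimately show ?thesis by simp
qed

end

section \<open>Chains of steps along the curve\<close>

definition chain :: "real \<Rightarrow> ('a::real_normed_vector \<Rightarrow> real) \<Rightarrow> (nat \<Rightarrow> 'a) \<Rightarrow> nat \<Rightarrow> bool" where
  "chain \<tau> \<psi> U m \<longleftrightarrow> (\<forall>n<m. MS_step \<tau> \<psi> (U n) (U (Suc n)))"

text \<open>
  \<open>Q n\<close> is the curve time that the chain has covered after \<open>n\<close> steps: on the interval from \<open>Q (n - 1)\<close>
  to \<open>Q n\<close>, or from \<open>0\<close> to \<open>Q 0\<close> at the beginning, the curve stays near \<open>U n\<close>.  These intervals have
  no upper bound on their length, which expresses that the chain may run ahead of the curve.
\<close>
definition follows :: "('a::real_inner \<Rightarrow> real) \<Rightarrow> (real \<Rightarrow> 'a) \<Rightarrow> real \<Rightarrow> real \<Rightarrow>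
    (nat \<Rightarrow> 'a) \<Rightarrow> nat \<Rightarrow> (nat \<Rightarrow> real) \<Rightarrow> bool" where
  "follows \<phi> u \<delta> \<tau> U N Q \<longleftrightarrow> 0 \<le> Q 0 \<and>
     (\<forall>n<N. Q n + (1 - \<delta>) * \<tau> \<le> Q (Suc n) \<and>
        norm (U (Suc n) - U n + \<tau> *\<^sub>R grad \<phi> (U n)) \<le> \<delta> * \<tau>) \<and>
     (\<forall>n\<le>N. \<forall>s. 0 \<le> s \<and> s \<le> Q n \<and> (n = 0 \<or> Q (n - 1) \<le> s) \<longrightarrow> norm (U n - u s) \<le> \<delta>)"

text \<open>
  Continuation for ever needs an invariant set, since the existence of the next step may depend on the
  choices of minimizers made before.
\<close>
definition never_stuck :: "real \<Rightarrow> ('a::real_normed_vector \<Rightarrow> real) \<Rightarrow> 'a \<Rightarrow> bool" where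
  "never_stuck \<tau> \<psi> u0 \<longleftrightarrow> (\<exists>G. u0 \<in> G \<and>
     (\<forall>U\<in>G. (\<exists>V. MS_step \<tau> \<psi> U V) \<and> (\<forall>V. MS_step \<tau> \<psi> U V \<longrightarrow> V \<in> G)))"

text \<open>
  A chain follows the curve up to step \<open>N\<close>.  Either it has not met the end of the arc yet and can be
  continued, or it met the end at step \<open>N\<close>; in the second case its later fate is known when the end
  is a critical point.
\<close>
definition tracks :: "('a::real_inner \<Rightarrow> real) \<Rightarrow> (real \<Rightarrow> 'a) \<Rightarrow> real \<Rightarrow> real \<Rightarrow> real \<Rightarrow>
    ('a \<Rightarrow> real) \<Rightarrow> bool" where
  "tracks \<phi> u T \<delta> \<tau> \<psi> \<longleftrightarrow> (\<forall>U m. U 0 = u 0 \<and> chain \<tau> \<psi> U m \<longrightarrow>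
     (\<exists>N\<le>m. \<exists>Q. follows \<phi> u \<delta> \<tau> U N Q \<and>
        (N = m \<and> (\<exists>V. MS_step \<tau> \<psi> (U m) V) \<or>
         T - \<delta> \<le> Q N \<and> (grad \<phi> (u T) = 0 \<longrightarrow> norm (U m - u T) \<le> \<delta> \<and> (\<exists>V. MS_step \<tau> \<psi> (U m) V)))))"

text \<open>
  The samples now come from a curve \<open>u\<close>.  The number \<open>\<beta>\<close> quantifies that \<open>u\<close> hardly moves while it
  dissipates little energy, and the remaining assumptions say that \<open>\<kappa>\<close> and then \<open>\<tau>\<close> are small enough.
\<close>
locale reference_curve =
  fine_scheme \<phi> B "\<lambda>k. u (real k * \<tau>)" M \<tau> \<mu> \<kappa> \<epsilon> \<rho> L \<epsilon>' \<rho>'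
  for \<phi> :: "'a::{real_inner,banach} \<Rightarrow> real" and B :: "'a set" and u :: "real \<Rightarrow> 'a"
    and M :: nat and \<tau> \<mu> \<kappa> \<epsilon> \<rho> L \<epsilon>' \<rho>' :: real +
  fixes T \<delta> \<beta> :: real
  assumes \<delta>: "4 * \<mu> \<le> \<delta>" "\<delta> < 1"
    and T: "real M * \<tau> \<le> T" "T \<le> real M * \<tau> + \<tau>" "\<tau> \<le> \<delta>"
    and u_Lipschitz: "\<And>s t. 0 \<le> s \<Longrightarrow> s \<le> t \<Longrightarrow> t \<le> T \<Longrightarrow> norm (u t - u s) \<le> L * (t - s)"
    and energy_antimono: "\<And>s t. 0 \<le> s \<Longrightarrow> s \<le> t \<Longrightarrow> \<phi> (u t) \<le> \<phi> (u s)"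
    and energy_gap: "\<And>s t. 0 \<le> s \<Longrightarrow> s \<le> t \<Longrightarrow> t \<le> T \<Longrightarrow> \<phi> (u s) - \<phi> (u t) \<le> \<beta> \<Longrightarrow> norm (u t - u s) \<le> \<delta> / 4"
    and energy_near: "\<And>t y. 0 \<le> t \<Longrightarrow> t \<le> T \<Longrightarrow> norm (y - u t) \<le> \<rho> \<Longrightarrow> \<bar>\<phi> y - \<phi> (u t)\<bar> \<le> (L + \<epsilon>) * norm (y - u t)"
    and end_grad: "norm (grad \<phi> (u T)) \<le> \<epsilon> / 2 \<Longrightarrow> norm (grad \<phi> (u (real M * \<tau>))) \<le> \<epsilon>"
    and \<epsilon>'_small: "2 * \<epsilon>'\<^sup>2 \<le> \<kappa> * \<delta>"
    and end_small: "2 * \<mu>\<^sup>2 * \<tau> \<le> \<kappa> * (real M * \<tau>)" "L * \<tau> \<le> \<delta> / 4"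
    and tube_small: "\<kappa> * T / \<mu> \<le> \<delta> / 4"
    and energy_small: "\<kappa> * T + 2 * ((L + \<epsilon>) * (\<kappa> * T / \<mu>)) \<le> \<beta>"
    and hop_small: "\<mu> * \<tau> + L * (\<mu>\<^sup>2 * \<tau> / \<kappa>) + (L + 5 * \<mu>) * (\<tau> + 8 * \<kappa> * T / \<mu>\<^sup>2) + \<kappa> * T / \<mu> \<le> \<rho>"
      "(L + \<epsilon>) * (\<mu> * \<tau> + L * (\<mu>\<^sup>2 * \<tau> / \<kappa>) + (L + 5 * \<mu>) * (\<tau> + 8 * \<kappa> * T / \<mu>\<^sup>2) + \<kappa> * T / \<mu>) \<le> \<beta>"
begin

abbreviation x :: "nat \<Rightarrow> 'a" where "x k \<equiv> u (real k * \<tau>)"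

definition target :: "'a \<Rightarrow> nat" where
  "target U = (SOME k. k \<le> M \<and> guide U = \<mu> * norm (U - x k) - \<kappa> * (real k * \<tau>))"

text \<open>
  The guide in units of curve time.
\<close>
definition clock :: "'a \<Rightarrow> real" where
  "clock U = - guide U / \<kappa>"

lemma target: "target U \<le> M" "guide U = \<mu> * norm (U - x (target U)) - \<kappa> * (real (target U) * \<tau>)"
proof -
  have "\<exists>k. k \<le> M \<and> guide U = \<mu> * norm (U - x k) - \<kappa> * (real k * \<tau>)"
    using guide_attained[of U] by blast
  from someI_ex[OF this]
  show "target U \<le> M" "guide U = \<mu> * norm (U - x (target U)) - \<kappa> * (real (target U) * \<tau>)"
    unfolding target_def by auto
qed

lemma guided_target: "U \<in> span B \<Longrightarrow> guide U \<le> 0 \<Longrightarrow> guided U (target U)"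
  using target by (simp add: guided_def)

lemma time_target: "0 \<le> real (target U) * \<tau>" "real (target U) * \<tau> \<le> real M * \<tau>" "real (target U) * \<tau> \<le> T"
proof -
  show *: "real (target U) * \<tau> \<le> real M * \<tau>" using target(1) \<tau> by (intro mult_right_mono) auto
  show "0 \<le> real (target U) * \<tau>" using \<tau> by simp
  show "real (target U) * \<tau> \<le> T" using * T by simp
qed

lemma dist_target:
  assumes "guide U \<le> 0"
  shows "norm (U - x (target U)) \<le> \<kappa> * T / \<mu>"
proof -
  have "\<mu> * norm (U - x (target U)) \<le> \<kappa> * (real (target U) * \<tau>)" using assms target(2)[of U] by simp
  also have "\<dots> \<le> \<kappa> * T" using time_target \<kappa> by (intro mult_left_mono) auto
  finally show ?thesis using \<mu> by (simp add: field_simps)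
qed

lemma clock_le_target: "clock U \<le> real (target U) * \<tau>"
proof -
  have "- guide U \<le> (real (target U) * \<tau>) * \<kappa>"
    using target(2)[of U] mult_nonneg_nonneg[OF less_imp_le[OF \<mu>] norm_ge_zero[of "U - x (target U)"]]
    by (simp only: mult.commute[of \<kappa>])
  then show ?thesis unfolding clock_def pos_divide_le_eq[OF \<kappa>] .
qed

lemma clock_add_le:
  assumes "guide V \<le> guide U - \<kappa> * c"
  shows "clock U + c \<le> clock V"
proof -
  have "clock U + c = (- guide U + \<kappa> * c) / \<kappa>" using \<kappa> by (simp add: clock_def add_divide_distrib diff_divide_distrib)
  also have "\<dots> \<le> - guide V / \<kappa>" using assms \<kappa> by (intro divide_right_mono) auto
  finally show ?thesis by (simp add: clock_def)
qed

lemma start_guided: "u 0 \<in> span B" "guide (u 0) \<le> 0"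
  using x_in[of 0] guide_le[of 0 "u 0"] by auto

lemma step_clock:
  assumes s: "guided U k" and k: "k < M" and st: "MS_step \<tau> pot U V"
  shows "clock U + (1 - \<delta>) * \<tau> \<le> clock V"
    and "\<mu> * \<tau> \<le> norm (U - x k) \<Longrightarrow> clock U + \<mu>\<^sup>2 * \<tau> / (8 * \<kappa>) \<le> clock V"
proof -
  show far: "clock U + \<mu>\<^sup>2 * \<tau> / (8 * \<kappa>) \<le> clock V" if "\<mu> * \<tau> \<le> norm (U - x k)"
  proof -
    have "guide V \<le> guide U - \<mu>\<^sup>2 * \<tau> / 8"
      using step_guide_far[OF s k st that] mult_pos_pos[OF \<kappa> \<tau>] by linarith
    also have "\<mu>\<^sup>2 * \<tau> / 8 = \<kappa> * (\<mu>\<^sup>2 * \<tau> / (8 * \<kappa>))" using \<kappa> by simp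
    finally show ?thesis by (rule clock_add_le)
  qed
  have "guide V \<le> guide U - \<kappa> * ((1 - \<delta>) * \<tau>)"
  proof (cases "\<mu> * \<tau> \<le> norm (U - x k)")
    case True
    have "0 \<le> \<mu>\<^sup>2 * \<tau> / 8" "0 \<le> \<kappa> * \<delta> * \<tau>" using \<tau> \<kappa> \<delta> \<mu> by auto
    then show ?thesis using step_guide_far[OF s k st True] by (simp add: algebra_simps)
  next
    case False
    have "2 * \<epsilon>'\<^sup>2 * \<tau> \<le> \<kappa> * \<delta> * \<tau>" using \<epsilon>'_small \<tau> by (intro mult_right_mono) auto
    then show ?thesis using step_guide_close[OF s k st] False by (simp add: algebra_simps)
  qed
  then show "clock U + (1 - \<delta>) * \<tau> \<le> clock V" by (rule clock_add_le)
qed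

lemma step_stays:
  assumes U: "U \<in> span B" "guide U \<le> 0" and m: "movable (target U)" and st: "MS_step \<tau> pot U V"
  shows "V \<in> span B" "guide V \<le> 0"
proof -
  have s: "guided U (target U)" using guided_target[OF U] .
  show "V \<in> span B" by (rule step_in_span[OF s m st])
  show "guide V \<le> 0"
  proof (cases "target U < M")
    case True
    have "clock U \<le> clock V"
      using step_clock(1)[OF s True st] mult_nonneg_nonneg[of "1 - \<delta>" \<tau>] \<delta> \<tau> by linarith
    then have "guide V \<le> guide U" using \<kappa> by (simp add: clock_def divide_le_cancel)
    then show ?thesis using U by linarith
  next
    case False
    then have k: "target U = M" using target(1)[of U] by simp
    show ?thesis using step_guide_end[OF s[unfolded k] m[unfolded k] st] U(2) end_small(1) by linarith
  qed
qed

lemma step_energy: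
  assumes "U \<in> span B" "V \<in> span B" "MS_step \<tau> pot U V"
  shows "\<phi> V + guide V \<le> \<phi> U + guide U"
proof -
  have "1 / (2 * \<tau>) * (norm (V - U))\<^sup>2 + pot V \<le> 1 / (2 * \<tau>) * (norm (U - U))\<^sup>2 + pot U"
    using assms(3) unfolding MS_step_def by blast
  moreover have "0 \<le> 1 / (2 * \<tau>) * (norm (V - U))\<^sup>2" using \<tau> by simp
  ultimately show ?thesis using pot_on_span assms by simp
qed

lemma movable_target: "target U < M \<or> movable M \<Longrightarrow> movable (target U)"
  using target(1)[of U] by (auto simp: movable_def)

context
  fixes U :: "nat \<Rightarrow> 'a" and m :: nat
  assumes start: "U 0 = u 0" and ch: "chain \<tau> pot U m"
begin

lemma chain_step: "n < m \<Longrightarrow> MS_step \<tau> pot (U n) (U (Suc n))"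
  using ch by (simp add: chain_def)

lemma chain_stays:
  assumes "n \<le> m" "\<And>j. j < n \<Longrightarrow> movable (target (U j))"
  shows "U n \<in> span B \<and> guide (U n) \<le> 0"
  using assms
proof (induction n)
  case 0
  then show ?case using start start_guided by simp
next
  case (Suc n)
  then show ?case using step_stays[OF _ _ Suc.prems(2)[of n] chain_step[of n]] by simp
qed

lemma chain_guided:
  assumes "n \<le> m" "\<And>j. j < n \<Longrightarrow> target (U j) < M"
  shows "guided (U n) (target (U n))"
  using chain_stays[of n] assms guided_target movable_target by blast

lemma clock_nonneg:
  assumes "n \<le> m" "\<And>j. j < n \<Longrightarrow> target (U j) < M"
  shows "0 \<le> clock (U n)"
  using chain_guided[OF assms] \<kappa> by (simp add: clock_def guided_def)

lemma clock_mono: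
  assumes "i \<le> n" "n \<le> m" "\<And>j. j < n \<Longrightarrow> target (U j) < M"
  shows "clock (U i) \<le> clock (U n)"
  using assms
proof (induction n)
  case (Suc n)
  show ?case
  proof (cases "i = Suc n")
    case False
    have "clock (U n) + (1 - \<delta>) * \<tau> \<le> clock (U (Suc n))"
      using Suc.prems by (intro step_clock(1)[OF chain_guided _ chain_step]) auto
    moreover have "0 \<le> (1 - \<delta>) * \<tau>" using \<delta> \<tau> by simp
    moreover have "clock (U i) \<le> clock (U n)" using Suc False by auto
    ultimately show ?thesis by linarith
  qed simp
qed simp

lemma chain_speed:
  assumes "i \<le> n" "n \<le> m" "\<And>j. j < n \<Longrightarrow> target (U j) < M"
  shows "norm (U n - U i) \<le> real (n - i) * ((L + 5 * \<mu>) * \<tau>)"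
  using assms
proof (induction n)
  case (Suc n)
  show ?case
  proof (cases "i = Suc n")
    case False
    have s: "guided (U n) (target (U n))" using Suc.prems by (intro chain_guided) auto
    have k: "target (U n) < M" using Suc.prems by auto
    have "norm (U (Suc n) - U n) \<le> norm (U (Suc n) - U n + \<tau> *\<^sub>R grad \<phi> (U n)) + norm (\<tau> *\<^sub>R grad \<phi> (U n))"
      using norm_triangle_ineq4[of "U (Suc n) - U n + \<tau> *\<^sub>R grad \<phi> (U n)" "\<tau> *\<^sub>R grad \<phi> (U n)"] by simp
    also have "\<dots> \<le> 4 * \<mu> * \<tau> + (L + \<epsilon> / 2) * \<tau>"
    proof (rule add_mono)
      show "norm (U (Suc n) - U n + \<tau> *\<^sub>R grad \<phi> (U n)) \<le> 4 * \<mu> * \<tau>"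
        using step_Euler[OF s k chain_step[of n]] Suc.prems by simp
      show "norm (\<tau> *\<^sub>R grad \<phi> (U n)) \<le> (L + \<epsilon> / 2) * \<tau>"
        using mult_right_mono[OF guided_grad_bound[OF s], of \<tau>] \<tau> by (simp add: mult.commute[of \<tau>])
    qed
    also have "\<dots> \<le> (L + 5 * \<mu>) * \<tau>"
      using mult_right_mono[of "\<epsilon> / 2" \<mu> \<tau>] \<epsilon> \<tau> by (simp add: algebra_simps)
    finally have "norm (U (Suc n) - U n) \<le> (L + 5 * \<mu>) * \<tau>" .
    moreover have "norm (U n - U i) \<le> real (n - i) * ((L + 5 * \<mu>) * \<tau>)" using Suc False by auto
    moreover have "real (Suc n - i) = real (n - i) + 1" using Suc.prems(1) False by simp
    ultimately show ?thesis
      using norm_triangle_ineq[of "U (Suc n) - U n" "U n - U i"] by (simp add: algebra_simps)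
  qed simp
qed simp

text \<open>
  Going back from step \<open>n\<close>, let \<open>i\<close> be the last step at which the chain was within \<open>\<mu> \<tau>\<close> of
  its sample, or \<open>0\<close>.  Every later step is far from the curve and advances the clock by \<open>\<mu>\<^sup>2 \<tau> / (8 \<kappa>)\<close>; as the
  clock never exceeds \<open>T\<close>, there are few of them.  At \<open>i\<close> itself clock and sample time agree up
  to \<open>\<mu>\<^sup>2 \<tau> / \<kappa>\<close>.
\<close>
lemma last_contact:
  assumes "n < m" "\<And>j. j \<le> n \<Longrightarrow> target (U j) < M"
  shows "\<exists>i\<le>n. \<exists>a. 0 \<le> a \<and> a \<le> T \<and> a \<le> clock (U i) + \<mu>\<^sup>2 * \<tau> / \<kappa> \<and> norm (U i - u a) \<le> \<mu> * \<tau> \<and>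
     real (n - i) * (\<mu>\<^sup>2 * \<tau> / (8 * \<kappa>)) \<le> clock (U (Suc n)) - clock (U i)"
  using assms
proof (induction n)
  case 0
  have "clock (U 0) \<le> clock (U (Suc 0))" using 0 by (intro clock_mono) auto
  moreover have "0 \<le> clock (U 0)" using 0 by (intro clock_nonneg) auto
  moreover have "0 \<le> T" using time_target by (meson order_trans)
  ultimately show ?case using start \<mu> \<tau> \<kappa> by (intro exI[of _ 0]) auto
next
  case (Suc n)
  let ?k = "target (U (Suc n))"
  have s: "guided (U (Suc n)) ?k" using Suc.prems by (intro chain_guided) auto
  have k: "?k < M" using Suc.prems by auto
  show ?case
  proof (cases "\<mu> * \<tau> \<le> norm (U (Suc n) - x ?k)")
    case True
    obtain i a where ia: "i \<le> n" "0 \<le> a" "a \<le> T" "a \<le> clock (U i) + \<mu>\<^sup>2 * \<tau> / \<kappa>" "norm (U i - u a) \<le> \<mu> * \<tau>"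
      "real (n - i) * (\<mu>\<^sup>2 * \<tau> / (8 * \<kappa>)) \<le> clock (U (Suc n)) - clock (U i)"
      using Suc by (metis Suc_lessD le_SucI)
    have "clock (U (Suc n)) + \<mu>\<^sup>2 * \<tau> / (8 * \<kappa>) \<le> clock (U (Suc (Suc n)))"
      using step_clock(2)[OF s k chain_step True] Suc.prems by simp
    moreover have "real (Suc n - i) = real (n - i) + 1" using ia(1) by simp
    ultimately have "real (Suc n - i) * (\<mu>\<^sup>2 * \<tau> / (8 * \<kappa>)) \<le> clock (U (Suc (Suc n))) - clock (U i)"
      using ia(6) by (simp only: distrib_right mult_1)
    then show ?thesis using ia by (meson le_SucI)
  next
    case False
    have "\<kappa> * (real ?k * \<tau>) \<le> \<kappa> * clock (U (Suc n)) + \<mu>\<^sup>2 * \<tau>"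
      using target(2)[of "U (Suc n)"] False mult_left_mono[of "norm (U (Suc n) - x ?k)" "\<mu> * \<tau>" \<mu>] \<mu> \<kappa>
      by (simp add: clock_def power2_eq_square)
    then have "real ?k * \<tau> \<le> clock (U (Suc n)) + \<mu>\<^sup>2 * \<tau> / \<kappa>" using \<kappa> by (simp add: field_simps)
    moreover have "clock (U (Suc n)) \<le> clock (U (Suc (Suc n)))"
      using Suc.prems by (intro clock_mono) auto
    ultimately show ?thesis using False time_target[of "U (Suc n)"]
      by (intro exI[of _ "Suc n"] conjI exI[of _ "real ?k * \<tau>"]) auto
  qed
qed

text \<open>
  The chain jumps from near \<open>u a\<close> with \<open>a \<le> s\<close>, its last contact, to near \<open>u c\<close> with \<open>s \<le> c\<close>, its present
  sample, in so short a time that \<open>u a\<close> and \<open>u c\<close> are close.  Then their energies are close as well, so \<open>u\<close>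
  hardly moves between \<open>s\<close> and \<open>c\<close>.  This is how loops of \<open>u\<close> that the guide makes the
  chain skip are seen to be negligible.
\<close>
lemma chain_near_curve:
  assumes n: "n \<le> m" "\<And>j. j < n \<Longrightarrow> target (U j) < M"
    and s: "0 \<le> s" "s \<le> real (target (U n)) * \<tau>" "n = 0 \<or> clock (U (n - 1)) \<le> s"
  shows "norm (U n - u s) \<le> \<delta>"
proof -
  define h where "h = \<mu> * \<tau> + L * (\<mu>\<^sup>2 * \<tau> / \<kappa>) + (L + 5 * \<mu>) * (\<tau> + 8 * \<kappa> * T / \<mu>\<^sup>2)"
  let ?c = "real (target (U n)) * \<tau>"
  have T0: "0 \<le> T" using time_target by (meson order_trans)
  have serv: "guided (U n) (target (U n))" by (rule chain_guided[OF n])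
  have D: "norm (U n - u ?c) \<le> \<kappa> * T / \<mu>" using dist_target serv by (simp add: guided_def)
  have "\<exists>a. 0 \<le> a \<and> a \<le> s \<and> norm (U n - u a) \<le> h"
  proof (cases n)
    case 0
    have "0 \<le> h" using \<mu> \<tau> \<kappa> L T0 unfolding h_def by (intro add_nonneg_nonneg mult_nonneg_nonneg divide_nonneg_nonneg) auto
    then show ?thesis using 0 start s by (intro exI[of _ 0]) auto
  next
    case (Suc p)
    obtain i a where ia: "i \<le> p" "0 \<le> a" "a \<le> T" "a \<le> clock (U i) + \<mu>\<^sup>2 * \<tau> / \<kappa>" "norm (U i - u a) \<le> \<mu> * \<tau>"
      "real (p - i) * (\<mu>\<^sup>2 * \<tau> / (8 * \<kappa>)) \<le> clock (U (Suc p)) - clock (U i)"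
      using last_contact[of p] n Suc by (metis Suc_le_lessD less_Suc_eq_le)
    have "clock (U i) \<le> clock (U p)" using ia(1) n Suc by (intro clock_mono) auto
    also have "clock (U p) \<le> s" using s(3) Suc by simp
    finally have as: "a \<le> s + \<mu>\<^sup>2 * \<tau> / \<kappa>" using ia(4) by simp
    define a' where "a' = min a s"
    have "norm (u a - u a') \<le> L * (a - a')"
      using u_Lipschitz[of a' a] ia s by (simp add: a'_def min_def)
    also have "\<dots> \<le> L * (\<mu>\<^sup>2 * \<tau> / \<kappa>)"
      using as L \<mu> \<tau> \<kappa> by (intro mult_left_mono) (auto simp: a'_def min_def)
    finally have aa': "norm (u a - u a') \<le> L * (\<mu>\<^sup>2 * \<tau> / \<kappa>)" .
    have "clock (U (Suc p)) \<le> T" using clock_le_target[of "U (Suc p)"] time_target[of "U (Suc p)"] by linarith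
    moreover have "0 \<le> clock (U i)" using ia(1) n Suc by (intro clock_nonneg) auto
    ultimately have "real (p - i) * (\<mu>\<^sup>2 * \<tau> / (8 * \<kappa>)) \<le> T" using ia(6) by linarith
    then have "real (p - i) * \<tau> \<le> 8 * \<kappa> * T / \<mu>\<^sup>2" using \<mu> \<kappa> by (simp add: field_simps)
    then have t: "real (Suc p - i) * \<tau> \<le> \<tau> + 8 * \<kappa> * T / \<mu>\<^sup>2" using ia(1) by (simp add: Suc_diff_le algebra_simps)
    have "norm (U (Suc p) - U i) \<le> real (Suc p - i) * ((L + 5 * \<mu>) * \<tau>)"
      using ia(1) n Suc by (intro chain_speed) auto
    also have "\<dots> = (L + 5 * \<mu>) * (real (Suc p - i) * \<tau>)" by simp
    also have "\<dots> \<le> (L + 5 * \<mu>) * (\<tau> + 8 * \<kappa> * T / \<mu>\<^sup>2)" using t L \<mu> by (intro mult_left_mono) auto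
    finally have "norm (U n - U i) \<le> (L + 5 * \<mu>) * (\<tau> + 8 * \<kappa> * T / \<mu>\<^sup>2)" using Suc by simp
    then have "norm (U n - u a') \<le> h"
      using aa' ia(5) norm_triangle_ineq[of "U n - U i" "U i - u a'"] norm_triangle_ineq[of "U i - u a" "u a - u a'"]
      by (simp add: h_def)
    then show ?thesis using ia(2) s(1) by (intro exI[of _ a']) (auto simp: a'_def)
  qed
  then obtain a where a: "0 \<le> a" "a \<le> s" "norm (U n - u a) \<le> h" by blast
  have ac: "norm (u a - u ?c) \<le> h + \<kappa> * T / \<mu>"
    using norm_triangle_ineq4[of "U n - u ?c" "U n - u a"] D a(3) by simp
  have cT: "?c \<le> T" "0 \<le> ?c" using time_target by auto
  have "\<phi> (u s) - \<phi> (u ?c) \<le> \<phi> (u a) - \<phi> (u ?c)" using energy_antimono[of a s] a by simp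
  also have "\<dots> \<le> (L + \<epsilon>) * norm (u a - u ?c)"
    using energy_near[of ?c "u a"] ac hop_small(1) cT by (simp add: h_def)
  also have "\<dots> \<le> (L + \<epsilon>) * (h + \<kappa> * T / \<mu>)" using ac L \<epsilon> by (intro mult_left_mono) auto
  also have "\<dots> \<le> \<beta>" using hop_small(2) by (simp add: h_def)
  finally have "norm (u ?c - u s) \<le> \<delta> / 4" using energy_gap[of s ?c] s cT by simp
  then show ?thesis
    using D tube_small norm_triangle_ineq[of "U n - u ?c" "u ?c - u s"] \<delta> \<mu> by (simp del: divide_le_eq_numeral1 le_divide_eq_numeral1)
qed

text \<open>
  The energy along a chain cannot increase by more than the total \<open>\<kappa> T\<close> that the guide offers.  After a
  visit to the end of the arc, where the energy is lowest, the chain therefore only sees samples of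
  almost the same energy, and these are near the end.
\<close>
lemma chain_near_end:
  assumes mv: "movable M" and e: "e \<le> n" "n \<le> m" and k: "target (U e) = M"
  shows "norm (U n - u T) \<le> \<delta>"
proof -
  have st: "U j \<in> span B \<and> guide (U j) \<le> 0" if "j \<le> m" for j
    using chain_stays[of j] that movable_target mv by blast
  have "\<phi> (U n) + guide (U n) \<le> \<phi> (U e) + guide (U e)" using e
  proof (induction n)
    case (Suc n)
    show ?case
    proof (cases "e = Suc n")
      case False
      have "\<phi> (U (Suc n)) + guide (U (Suc n)) \<le> \<phi> (U n) + guide (U n)"
        using Suc.prems st by (intro step_energy chain_step) auto
      then show ?thesis using Suc False by auto
    qed simp
  qed simp
  moreover have "- (\<kappa> * T) \<le> guide (U n)"
    using guide_ge[of "U n"] mult_left_mono[OF T(1) less_imp_le[OF \<kappa>]] by linarith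
  ultimately have en: "\<phi> (U n) \<le> \<phi> (U e) + \<kappa> * T" using st[of e] e by simp
  let ?c = "real (target (U n)) * \<tau>" and ?d = "real M * \<tau>"
  have h\<rho>: "\<kappa> * T / \<mu> \<le> \<rho>"
  proof -
    have "0 \<le> T" using time_target by (meson order_trans)
    then have "0 \<le> \<mu> * \<tau> + L * (\<mu>\<^sup>2 * \<tau> / \<kappa>) + (L + 5 * \<mu>) * (\<tau> + 8 * \<kappa> * T / \<mu>\<^sup>2)"
      using \<mu> \<tau> \<kappa> L by (intro add_nonneg_nonneg mult_nonneg_nonneg divide_nonneg_nonneg) auto
    then show ?thesis using hop_small(1) by linarith
  qed
  have Dn: "norm (U n - u ?c) \<le> \<kappa> * T / \<mu>" using dist_target st e by simp
  have De: "norm (U e - u ?d) \<le> \<kappa> * T / \<mu>" using dist_target[of "U e"] st e k by simp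
  have L\<epsilon>: "0 \<le> L + \<epsilon>" using L \<epsilon> by simp
  have "\<bar>\<phi> (U n) - \<phi> (u ?c)\<bar> \<le> (L + \<epsilon>) * norm (U n - u ?c)"
    using Dn h\<rho> time_target by (intro energy_near) auto
  then have c: "\<phi> (u ?c) \<le> \<phi> (U n) + (L + \<epsilon>) * (\<kappa> * T / \<mu>)"
    using mult_left_mono[OF Dn L\<epsilon>] by linarith
  have "\<bar>\<phi> (U e) - \<phi> (u ?d)\<bar> \<le> (L + \<epsilon>) * norm (U e - u ?d)"
    using De h\<rho> \<tau> T by (intro energy_near) auto
  then have d: "\<phi> (U e) \<le> \<phi> (u ?d) + (L + \<epsilon>) * (\<kappa> * T / \<mu>)"
    using mult_left_mono[OF De L\<epsilon>] by linarith
  have "p - q \<le> \<beta>" if "p \<le> a + X" "b \<le> q + X" "a \<le> b + K" "K + 2 * X \<le> \<beta>" for p q a b X K :: real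
    using that by linarith
  from this[OF c d en energy_small] have "\<phi> (u ?c) - \<phi> (u ?d) \<le> \<beta>" .
  then have "norm (u ?d - u ?c) \<le> \<delta> / 4" using time_target T by (intro energy_gap) auto
  moreover have "norm (u T - u ?d) \<le> \<delta> / 4"
  proof -
    have "norm (u T - u ?d) \<le> L * (T - ?d)" using T \<tau> by (intro u_Lipschitz) auto
    also have "\<dots> \<le> L * \<tau>" using T L by (intro mult_left_mono) auto
    finally show ?thesis using end_small(2) by simp
  qed
  ultimately show ?thesis
    using order_trans[OF Dn tube_small] \<delta> \<mu> norm_triangle_ineq4[of "U n - u ?c" "u ?d - u ?c"]
      norm_triangle_ineq4[of "U n - u ?d" "u T - u ?d"] by simp
qed

lemma chain_tracks:
  "\<exists>N\<le>m. \<exists>Q. follows \<phi> u \<delta> \<tau> U N Q \<and>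
        (N = m \<and> (\<exists>V. MS_step \<tau> pot (U m) V) \<or>
         T - \<delta> \<le> Q N \<and> (grad \<phi> (u T) = 0 \<longrightarrow> norm (U m - u T) \<le> \<delta> \<and> (\<exists>V. MS_step \<tau> pot (U m) V)))"
proof -
  \<comment> \<open>When the target is the last sample, the whole remaining arc is credited to \<open>Q\<close>: the chain is near its end then.\<close>
  define N where "N = (if \<exists>n\<le>m. target (U n) = M then LEAST n. target (U n) = M else m)"
  define Q where "Q n = (if target (U n) = M then real M * \<tau> else clock (U n))" for n
  have Nm: "N \<le> m" unfolding N_def by (auto intro: Least_le order_trans)
  have before: "target (U n) < M" if "n < N" for n
  proof -
    have "target (U n) \<noteq> M" using that not_less_Least[of n "\<lambda>n. target (U n) = M"] unfolding N_def
      by (auto split: if_splits)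
    then show ?thesis using target(1)[of "U n"] by simp
  qed
  have at_N: "target (U N) = M \<or> N = m \<and> target (U m) < M"
  proof (cases "\<exists>n\<le>m. target (U n) = M")
    case True
    then show ?thesis using LeastI[of "\<lambda>n. target (U n) = M"] unfolding N_def by auto
  next
    case False
    then show ?thesis using target(1)[of "U m"] unfolding N_def by (auto simp: le_less)
  qed
  have clock_Q: "clock (U n) \<le> Q n" "Q n \<le> real (target (U n)) * \<tau>" for n
    using clock_le_target[of "U n"] by (auto simp: Q_def)
  have Q_before: "Q n = clock (U n)" if "n < N" for n using before[OF that] by (simp add: Q_def)
  have "follows \<phi> u \<delta> \<tau> U N Q"
    unfolding follows_def
  proof (intro conjI allI impI)
    show "0 \<le> Q 0" using clock_Q(1)[of 0] clock_nonneg[of 0] by simp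
  next
    fix n assume n: "n < N"
    have s: "guided (U n) (target (U n))" using before n Nm by (intro chain_guided) auto
    have st: "MS_step \<tau> pot (U n) (U (Suc n))" using n Nm by (intro chain_step) simp
    show "Q n + (1 - \<delta>) * \<tau> \<le> Q (Suc n)"
      using step_clock(1)[OF s before[OF n] st] clock_Q(1)[of "Suc n"] Q_before[OF n] by linarith
    have "norm (U (Suc n) - U n + \<tau> *\<^sub>R grad \<phi> (U n)) \<le> 4 * \<mu> * \<tau>" by (rule step_Euler[OF s before[OF n] st])
    also have "\<dots> \<le> \<delta> * \<tau>" using \<delta> \<tau> by (intro mult_right_mono) auto
    finally show "norm (U (Suc n) - U n + \<tau> *\<^sub>R grad \<phi> (U n)) \<le> \<delta> * \<tau>" .
  next
    fix n s assume n: "n \<le> N" and s: "0 \<le> s \<and> s \<le> Q n \<and> (n = 0 \<or> Q (n - 1) \<le> s)"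
    have "n = 0 \<or> clock (U (n - 1)) \<le> s" using s clock_Q(1)[of "n - 1"] by linarith
    then show "norm (U n - u s) \<le> \<delta>"
      using s clock_Q(2)[of n] n Nm before by (intro chain_near_curve) auto
  qed
  moreover have "N = m \<and> (\<exists>V. MS_step \<tau> pot (U m) V) \<or>
         T - \<delta> \<le> Q N \<and> (grad \<phi> (u T) = 0 \<longrightarrow> norm (U m - u T) \<le> \<delta> \<and> (\<exists>V. MS_step \<tau> pot (U m) V))"
    using at_N
  proof
    assume k: "target (U N) = M"
    have "norm (U m - u T) \<le> \<delta> \<and> (\<exists>V. MS_step \<tau> pot (U m) V)" if "grad \<phi> (u T) = 0"
    proof -
      have mv: "movable M" using end_grad that \<epsilon> by (simp add: movable_def)
      have "U m \<in> span B \<and> guide (U m) \<le> 0" using chain_stays[of m] movable_target mv by blast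
      then have "\<exists>V. MS_step \<tau> pot (U m) V" using step_exists[OF guided_target movable_target] mv by blast
      then show ?thesis using chain_near_end[OF mv Nm _ k] by simp
    qed
    moreover have "T - \<delta> \<le> Q N" using k T by (simp add: Q_def)
    ultimately show ?thesis by blast
  next
    assume N: "N = m \<and> target (U m) < M"
    then have "guided (U m) (target (U m))" using before by (intro chain_guided) auto
    then show ?thesis using step_exists movable_target N by blast
  qed
  ultimately show ?thesis using Nm by blast
qed

end

theorem pot_tracks: "tracks \<phi> u T \<delta> \<tau> pot"
  unfolding tracks_def using chain_tracks by blast

end

section \<open>Choice of the parameters\<close>

context perturbed_scheme begin

lemma step_exists_finite_dimensional:
  assumes UNIV: "span B = UNIV" and lower: "\<And>v. 1 / (2 * \<tau>\<^sub>s) * (norm v)\<^sup>2 + \<phi> v \<ge> - \<phi>\<^sub>s"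
    and \<tau>\<^sub>s: "\<tau>\<^sub>s > 0" "2 * \<tau> < \<tau>\<^sub>s"
  shows "\<exists>V. MS_step \<tau> pot U V"
proof -
  let ?F = "\<lambda>V. 1 / (2 * \<tau>) * (norm (V - U))\<^sup>2 + pot V"
  define \<alpha> where "\<alpha> = 1 / (2 * \<tau>) - 1 / \<tau>\<^sub>s"
  define C where "C = \<bar>\<phi> U + \<phi>\<^sub>s + (norm U)\<^sup>2 / \<tau>\<^sub>s\<bar>"
  \<comment> \<open>Beyond this radius the quadratic term \<open>\<alpha> d\<^sup>2\<close> dominates \<open>3 \<mu> d + C\<close>.\<close>
  define R where "R = 1 + (3 * \<mu> + C) / \<alpha>"
  have \<alpha>: "\<alpha> > 0" using \<tau>\<^sub>s \<tau> by (simp add: \<alpha>_def field_simps)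
  have R1: "1 \<le> R" using \<alpha> \<mu> by (simp add: R_def C_def)
  have far: "?F U < ?F V" if "R < norm (V - U)" for V
  proof -
    let ?d = "norm (V - U)"
    have V: "\<phi> V \<ge> - \<phi>\<^sub>s - (norm U)\<^sup>2 / \<tau>\<^sub>s - ?d\<^sup>2 / \<tau>\<^sub>s"
      by (rule quadratic_lower_bound[where \<phi> = \<phi>, OF lower \<tau>\<^sub>s(1)])
    have "pot U - \<phi> U \<le> pot V - \<phi> V + 3 * \<mu> * ?d"
      using pot_diff_Lipschitz[of U V] by (simp add: norm_minus_commute)
    then have "?F V - ?F U \<ge> \<alpha> * ?d\<^sup>2 - 3 * \<mu> * ?d - C"
      using V by (simp add: \<alpha>_def C_def left_diff_distrib)
    moreover have "\<alpha> * ?d\<^sup>2 > 3 * \<mu> * ?d + C"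
    proof -
      have "3 * \<mu> + C < \<alpha> * ?d" using that \<alpha> by (simp add: R_def field_simps)
      then have "(3 * \<mu> + C) * ?d < \<alpha> * ?d * ?d" using that R1 by (intro mult_strict_right_mono) auto
      moreover have "C * 1 \<le> C * ?d" using that R1 by (intro mult_left_mono) (auto simp: C_def)
      ultimately show ?thesis by (simp add: power2_eq_square algebra_simps)
    qed
    ultimately show ?thesis by linarith
  qed
  let ?C = "cball U R"
  have "compact ?C" using compact_span_cball[OF finite_B, of U R] UNIV by simp
  moreover have "continuous_on ?C ?F" by (intro continuous_intros continuous_on_pot)
  moreover have U: "U \<in> ?C" using R1 by simp
  ultimately obtain Y where Y: "Y \<in> ?C" "\<And>V. V \<in> ?C \<Longrightarrow> ?F Y \<le> ?F V"
    using continuous_attains_inf[of ?C ?F] by (metis (no_types, lifting) empty_iff)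
  have "?F Y \<le> ?F V" for V
  proof (cases "R < norm (V - U)")
    case True
    then show ?thesis using far[OF True] Y(2)[OF U] by linarith
  next
    case False
    then show ?thesis by (intro Y(2)) (simp add: dist_norm norm_minus_commute)
  qed
  then show ?thesis unfolding MS_step_def by blast
qed

lemma Lip_pot: "3 * \<mu> \<le> \<delta> \<Longrightarrow> Lip (\<lambda>v. pot v - \<phi> v) \<le> ennreal \<delta>"
  unfolding Lip_def
proof (intro SUP_least, clarify)
  fix v w :: 'a assume \<delta>: "3 * \<mu> \<le> \<delta>" and "v \<noteq> w"
  then have "norm (w - v) > 0" by simp
  moreover have "(pot w - \<phi> w) - (pot v - \<phi> v) \<le> \<delta> * norm (w - v)"
    using pot_diff_Lipschitz[of w v] mult_right_mono[OF \<delta> norm_ge_zero[of "w - v"]] by linarith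
  ultimately show "ennreal ((pot w - \<phi> w - (pot v - \<phi> v)) / norm (w - v)) \<le> ennreal \<delta>"
    by (intro ennreal_leI) (simp add: pos_divide_le_eq)
qed

end

context reference_curve begin

lemma end_invariant:
  assumes "norm (grad \<phi> (u T)) \<le> \<epsilon> / 2"
  shows "never_stuck \<tau> pot (u 0)"
proof -
  have "movable (target U)" for U using end_grad[OF assms] movable_target by (simp add: movable_def)
  then show ?thesis
    unfolding never_stuck_def
    using start_guided step_stays step_exists guided_target
    by (intro exI[of _ "{U \<in> span B. guide U \<le> 0}"]) blast
qed

end

lemma eventually_mult_le_at_right_0:
  fixes c d :: real assumes "d > 0" shows "\<forall>\<^sub>F \<tau> in at_right 0. c * \<tau> \<le> d"
proof -
  have "((\<lambda>\<tau>. c * \<tau>) \<longlongrightarrow> c * 0) (at_right 0)" by (intro tendsto_intros)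
  then have "\<forall>\<^sub>F \<tau> in at_right 0. c * \<tau> < d" using assms by (intro order_tendstoD) auto
  then show ?thesis by (rule eventually_mono) simp
qed

lemma eventually_pos_at_right_0: "\<forall>\<^sub>F \<tau> in at_right (0::real). \<tau> > 0"
  by (simp add: eventually_at_right_less)

text \<open>
  The parameters are chosen one after the other, each small in terms of the previous ones.  The numerical
  values are \<open>\<mu> = \<delta>/4\<close>, so that the perturbation is \<open>\<delta>\<close>-Lipschitz and Euler steps are accurate up to
  \<open>4 \<mu> = \<delta>\<close>, and \<open>\<epsilon> = \<mu>/16 = \<delta>/64\<close>; the gradient at \<open>u T\<close> counts as small below \<open>\<epsilon>/2\<close>.
\<close>
theorem tracking_potential:
  fixes \<phi> :: "'a::{real_inner,banach} \<Rightarrow> real"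
  assumes C1: "C1 \<phi>" and lower: "\<And>v. 1 / (2 * \<tau>\<^sub>s) * (norm v)\<^sup>2 + \<phi> v \<ge> - \<phi>\<^sub>s"
    and \<tau>\<^sub>s: "\<tau>\<^sub>s > 0" and u: "u \<in> GF \<phi>" and \<delta>: "0 < \<delta>" "\<delta> < 1" and T: "T > 0"
    and B0: "finite (B0 :: 'a set)"
  shows "\<forall>\<^sub>F \<tau> in at_right 0. \<exists>\<psi>. Lip (\<lambda>v. \<psi> v - \<phi> v) \<le> ennreal \<delta> \<and> tracks \<phi> u T \<delta> \<tau> \<psi> \<and>
    (norm (grad \<phi> (u T)) \<le> \<delta> / 128 \<or> span B0 = UNIV \<longrightarrow> never_stuck \<tau> \<psi> (u 0))"
proof -
  define \<mu> where "\<mu> = \<delta> / 4"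
  define \<epsilon> where "\<epsilon> = \<delta> / 64"
  have \<mu>: "\<mu> > 0" and \<epsilon>: "\<epsilon> > 0" using \<delta> by (auto simp: \<mu>_def \<epsilon>_def)
  have cu: "continuous_on {0..T} u" using GF_continuous[OF u] continuous_on_subset by fastforce
  have comp: "compact (u ` {0..T})" by (intro compact_continuous_image cu) auto
  have cg: "continuous_on UNIV (grad \<phi>)" by (rule C1_continuous_grad[OF C1])
  obtain L where L: "L > 0" "\<And>t. 0 \<le> t \<Longrightarrow> t \<le> T \<Longrightarrow> norm (grad \<phi> (u t)) \<le> L"
  proof -
    have "compact (grad \<phi> ` u ` {0..T})"
      by (intro compact_continuous_image comp continuous_on_subset[OF cg]) auto
    then have "bounded (grad \<phi> ` u ` {0..T})" by (rule compact_imp_bounded)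
    then obtain b where "b > 0" "\<forall>x\<in>grad \<phi> ` u ` {0..T}. norm x \<le> b"
      unfolding bounded_pos by auto
    then show thesis using that[of b] by auto
  qed
  have uL: "norm (u t - u s) \<le> L * (t - s)" if "0 \<le> s" "s \<le> t" "t \<le> T" for s t
    using GF_linearization[OF u that(1,2), of 0 L] L(2) that by (simp add: mult.commute)
  have near: "\<exists>\<rho>>0. \<forall>t y. 0 \<le> t \<and> t \<le> T \<and> norm (y - u t) \<le> \<rho> \<longrightarrow> norm (grad \<phi> y - grad \<phi> (u t)) \<le> e / 2" if "e > 0" for e
  proof -
    have "e / 2 > 0" using that by simp
    then obtain \<rho> where "\<rho> > 0" "\<forall>x\<in>u ` {0..T}. \<forall>y. dist y x \<le> \<rho> \<longrightarrow> norm (grad \<phi> y - grad \<phi> x) \<le> e / 2"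
      using uniform_continuity_near_compact[OF comp cg] by blast
    then show ?thesis by (intro exI[of _ \<rho>]) (auto simp: dist_norm)
  qed
  obtain \<rho> where \<rho>: "\<rho> > 0" "\<And>t y. 0 \<le> t \<Longrightarrow> t \<le> T \<Longrightarrow> norm (y - u t) \<le> \<rho> \<Longrightarrow> norm (grad \<phi> y - grad \<phi> (u t)) \<le> \<epsilon> / 2"
    using near[OF \<epsilon>] by blast
  have energy_near: "\<bar>\<phi> y - \<phi> (u t)\<bar> \<le> (L + \<epsilon>) * norm (y - u t)" if t: "0 \<le> t" "t \<le> T" and y: "norm (y - u t) \<le> \<rho>" for t y
  proof -
    have "\<bar>\<phi> y - \<phi> (u t) - inner 0 (y - u t)\<bar> \<le> (L + \<epsilon>) * norm (y - u t)"
    proof (rule linearization_error[OF C1, of "cball (u t) \<rho>"])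
      fix z assume "z \<in> cball (u t) \<rho>"
      then have "norm (grad \<phi> z - grad \<phi> (u t)) \<le> \<epsilon> / 2" by (intro \<rho>(2) t) (simp add: dist_norm norm_minus_commute)
      then show "norm (grad \<phi> z - 0) \<le> L + \<epsilon>"
        using L(2)[OF t] norm_triangle_ineq[of "grad \<phi> z - grad \<phi> (u t)" "grad \<phi> (u t)"] \<epsilon> by simp
    qed (use y \<rho> in \<open>auto simp: dist_norm norm_minus_commute\<close>)
    then show ?thesis by simp
  qed
  \<comment> \<open>With \<open>c = 4 T / \<delta>\<close> both terms of the energy estimate become at most \<open>\<delta>/8\<close>.\<close>
  define \<beta> where "\<beta> = \<delta>\<^sup>2 / (16 * T)"
  have \<beta>: "\<beta> > 0" using \<delta> T by (simp add: \<beta>_def)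
  have energy_gap: "norm (u t - u s) \<le> \<delta> / 4"
    if st: "0 \<le> s" "s \<le> t" "t \<le> T" and d: "\<phi> (u s) - \<phi> (u t) \<le> \<beta>" for s t
  proof -
    let ?c = "4 * T / \<delta>"
    have c: "?c > 0" using T \<delta> by simp
    have "norm (u t - u s) \<le> ?c / 2 * (\<phi> (u s) - \<phi> (u t)) + (t - s) / (2 * ?c)"
      by (rule GF_energy_estimate[OF C1 u st(1,2) c])
    also have "\<dots> \<le> ?c / 2 * \<beta> + T / (2 * ?c)"
      using d st c by (intro add_mono mult_left_mono divide_right_mono) auto
    also have "\<dots> = \<delta> / 4" using T \<delta> by (simp add: \<beta>_def field_simps power2_eq_square)
    finally show ?thesis .
  qed
  have "\<forall>\<^sub>F \<kappa> in at_right 0. \<kappa> > 0 \<and> T * \<kappa> \<le> \<mu> * (\<rho> / 2) \<and> (T / \<mu>) * \<kappa> \<le> \<delta> / 4 \<and>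
      (T + 2 * ((L + \<epsilon>) * (T / \<mu>))) * \<kappa> \<le> \<beta> \<and>
      ((L + 5 * \<mu>) * (8 * T / \<mu>\<^sup>2) + T / \<mu>) * \<kappa> \<le> \<rho> / 2 \<and>
      (L + \<epsilon>) * ((L + 5 * \<mu>) * (8 * T / \<mu>\<^sup>2) + T / \<mu>) * \<kappa> \<le> \<beta> / 2"
    using \<mu> \<rho>(1) \<delta> \<beta> by (intro eventually_conj eventually_pos_at_right_0 eventually_mult_le_at_right_0) auto
  then obtain \<kappa> where \<kappa>: "\<kappa> > 0" "T * \<kappa> \<le> \<mu> * (\<rho> / 2)" "(T / \<mu>) * \<kappa> \<le> \<delta> / 4"
      "(T + 2 * ((L + \<epsilon>) * (T / \<mu>))) * \<kappa> \<le> \<beta>"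
      "((L + 5 * \<mu>) * (8 * T / \<mu>\<^sup>2) + T / \<mu>) * \<kappa> \<le> \<rho> / 2"
      "(L + \<epsilon>) * ((L + 5 * \<mu>) * (8 * T / \<mu>\<^sup>2) + T / \<mu>) * \<kappa> \<le> \<beta> / 2"
    using eventually_happens'[OF trivial_limit_at_right_real] by blast
  define \<epsilon>' where "\<epsilon>' = min (\<mu> / 16) (\<kappa> * \<delta> / 2)"
  have \<epsilon>': "\<epsilon>' > 0" "16 * \<epsilon>' \<le> \<mu>" "2 * \<epsilon>'\<^sup>2 \<le> \<kappa> * \<delta>"
  proof -
    show "\<epsilon>' > 0" "16 * \<epsilon>' \<le> \<mu>" using \<mu> \<kappa>(1) \<delta> by (auto simp: \<epsilon>'_def)
    moreover have "\<epsilon>' \<le> 1" using \<delta> by (simp add: \<epsilon>'_def \<mu>_def min_le_iff_disj)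
    ultimately have "\<epsilon>' * \<epsilon>' \<le> \<epsilon>' * 1" by (intro mult_left_mono) auto
    also have "\<epsilon>' * 1 \<le> \<kappa> * \<delta> / 2" by (simp add: \<epsilon>'_def)
    finally show "2 * \<epsilon>'\<^sup>2 \<le> \<kappa> * \<delta>" by (simp add: power2_eq_square)
  qed
  obtain \<rho>' where \<rho>': "\<rho>' > 0" "\<And>t y. 0 \<le> t \<Longrightarrow> t \<le> T \<Longrightarrow> norm (y - u t) \<le> \<rho>' \<Longrightarrow> norm (grad \<phi> y - grad \<phi> (u t)) \<le> \<epsilon>' / 2"
    using near[OF \<epsilon>'(1)] by blast
  define R where "R = \<rho> / 2"
  have R: "R > 0" using \<rho> by (simp add: R_def)
  define C where "C = \<bar>\<phi> (u 0) + (L + \<epsilon>) * \<rho> + \<phi>\<^sub>s + (norm (u 0) + L * T + \<rho>)\<^sup>2 / \<tau>\<^sub>s\<bar>"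
  have "\<forall>\<^sub>F \<tau> in at_right 0. \<tau> > 0 \<and> 1 * \<tau> \<le> \<delta> \<and> 1 * \<tau> \<le> T / 2 \<and> 3 * \<tau> \<le> \<tau>\<^sub>s \<and>
      (L + 2 * \<mu>) * \<tau> \<le> \<rho> / 2 \<and> (L + 8 * \<mu>) * \<tau> \<le> \<rho>' \<and> L * \<tau> \<le> \<delta> / 4 \<and>
      2 * \<mu>\<^sup>2 * \<tau> \<le> \<kappa> * T / 2 \<and> (4 * (C / R\<^sup>2 + 3 * \<mu> / R + 1 / \<tau>\<^sub>s)) * \<tau> \<le> 1 \<and>
      (\<mu> + L * (\<mu>\<^sup>2 / \<kappa>) + (L + 5 * \<mu>)) * \<tau> \<le> \<rho> / 2 \<and>
      (L + \<epsilon>) * (\<mu> + L * (\<mu>\<^sup>2 / \<kappa>) + (L + 5 * \<mu>)) * \<tau> \<le> \<beta> / 2"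
    using \<delta> T \<tau>\<^sub>s \<rho>(1) \<rho>'(1) \<kappa>(1) \<beta>
    by (intro eventually_conj eventually_pos_at_right_0 eventually_mult_le_at_right_0) auto
  then show ?thesis
  proof (rule eventually_mono, elim conjE)
    fix \<tau> :: real
    assume \<tau>: "\<tau> > 0" and \<tau>\<delta>: "1 * \<tau> \<le> \<delta>" and \<tau>T: "1 * \<tau> \<le> T / 2" and \<tau>\<tau>\<^sub>s: "3 * \<tau> \<le> \<tau>\<^sub>s"
      and \<tau>\<rho>: "(L + 2 * \<mu>) * \<tau> \<le> \<rho> / 2" and \<tau>\<rho>': "(L + 8 * \<mu>) * \<tau> \<le> \<rho>'" and \<tau>L: "L * \<tau> \<le> \<delta> / 4"
      and \<tau>\<kappa>: "2 * \<mu>\<^sup>2 * \<tau> \<le> \<kappa> * T / 2"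
      and \<tau>C: "(4 * (C / R\<^sup>2 + 3 * \<mu> / R + 1 / \<tau>\<^sub>s)) * \<tau> \<le> 1"
      and hop1: "(\<mu> + L * (\<mu>\<^sup>2 / \<kappa>) + (L + 5 * \<mu>)) * \<tau> \<le> \<rho> / 2"
      and hop2: "(L + \<epsilon>) * (\<mu> + L * (\<mu>\<^sup>2 / \<kappa>) + (L + 5 * \<mu>)) * \<tau> \<le> \<beta> / 2"
    define M where "M = nat \<lfloor>T / \<tau>\<rfloor>"
    define B where "B = B0 \<union> (\<lambda>k. u (real k * \<tau>)) ` {..M}"
    have realM: "real M = of_int \<lfloor>T / \<tau>\<rfloor>" using T \<tau> by (simp add: M_def)
    have "real M \<le> T / \<tau>" "T / \<tau> < real M + 1" unfolding realM by linarith+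
    then have M: "real M * \<tau> \<le> T" "T \<le> real M * \<tau> + \<tau>" using \<tau> by (auto simp: field_simps)
    have kT: "0 \<le> real k * \<tau>" "real k * \<tau> \<le> T" if "k \<le> M" for k
    proof -
      have "real k * \<tau> \<le> real M * \<tau>" using that \<tau> by (intro mult_right_mono) auto
      then show "real k * \<tau> \<le> T" using M by linarith
      show "0 \<le> real k * \<tau>" using \<tau> by simp
    qed
    have L\<tau>: "L * \<tau> \<le> \<rho>" "L * \<tau> \<le> \<rho>'"
    proof -
      have "0 \<le> \<mu> * \<tau>" using \<mu> \<tau> by simp
      then show "L * \<tau> \<le> \<rho>" "L * \<tau> \<le> \<rho>'" using \<tau>\<rho> \<tau>\<rho>' \<rho>(1) by (auto simp: algebra_simps)
    qed
    have euler: "norm (u (real (Suc k) * \<tau>) - u (real k * \<tau>) + \<tau> *\<^sub>R grad \<phi> (u (real k * \<tau>))) \<le> e / 2 * \<tau>"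
      if k: "k < M" and e: "\<And>t y. 0 \<le> t \<Longrightarrow> t \<le> T \<Longrightarrow> norm (y - u t) \<le> r \<Longrightarrow> norm (grad \<phi> y - grad \<phi> (u t)) \<le> e / 2"
        and r: "L * \<tau> \<le> r" for k e r
    proof -
      have a: "0 \<le> real k * \<tau>" "real k * \<tau> \<le> real (Suc k) * \<tau>" "real (Suc k) * \<tau> \<le> T"
        using kT[of "Suc k"] k \<tau> by (auto simp: mult_right_mono)
      have "norm (grad \<phi> (u q) - grad \<phi> (u (real k * \<tau>))) \<le> e / 2"
        if q: "real k * \<tau> \<le> q" "q \<le> real (Suc k) * \<tau>" for q
      proof (rule e)
        have "norm (u q - u (real k * \<tau>)) \<le> L * (q - real k * \<tau>)" using a q by (intro uL) auto
        also have "\<dots> \<le> L * \<tau>" using q L(1) by (intro mult_left_mono) (auto simp: algebra_simps)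
        finally show "norm (u q - u (real k * \<tau>)) \<le> r" using r by simp
      qed (use a in auto)
      from GF_linearization[OF u a(1,2) this]
      have "norm (u (real (Suc k) * \<tau>) - u (real k * \<tau>) + (real (Suc k) * \<tau> - real k * \<tau>) *\<^sub>R grad \<phi> (u (real k * \<tau>)))
          \<le> (real (Suc k) * \<tau> - real k * \<tau>) * (e / 2)" .
      moreover have "real (Suc k) * \<tau> - real k * \<tau> = \<tau>" by (simp add: algebra_simps)
      ultimately show ?thesis by (simp add: mult.commute)
    qed
    note \<delta>_range = \<delta>
    interpret reference_curve \<phi> B u M \<tau> \<mu> \<kappa> \<epsilon> \<rho> L \<epsilon>' \<rho>' T \<delta> \<beta>
    proof
      show "C1 \<phi>" "\<tau> > 0" "\<mu> > 0" "\<kappa> > 0" "\<epsilon> > 0" "\<rho> > 0" "\<epsilon>' > 0" "16 * \<epsilon>' \<le> \<mu>" "\<delta> < 1" "2 * \<epsilon>'\<^sup>2 \<le> \<kappa> * \<delta>"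
        "real M * \<tau> \<le> T" "T \<le> real M * \<tau> + \<tau>" "L * \<tau> \<le> \<delta> / 4" "(L + 2 * \<mu>) * \<tau> \<le> \<rho> / 2" "(L + 8 * \<mu>) * \<tau> \<le> \<rho>'"
        by fact+
      show "finite B" using B0 by (simp add: B_def)
      show "u (real k * \<tau>) \<in> span B" if "k \<le> M" for k using that by (intro span_base) (auto simp: B_def)
      show "16 * \<epsilon> \<le> \<mu>" by (simp add: \<epsilon>_def \<mu>_def)
      show "0 \<le> L" using L by simp
      show "norm (grad \<phi> y - grad \<phi> (u (real k * \<tau>))) \<le> \<epsilon> / 2" if "k \<le> M" "norm (y - u (real k * \<tau>)) \<le> \<rho>" for k y
        using kT[OF that(1)] that(2) by (intro \<rho>(2))
      show "norm (grad \<phi> y - grad \<phi> (u (real k * \<tau>))) \<le> \<epsilon>' / 2" if "k \<le> M" "norm (y - u (real k * \<tau>)) \<le> \<rho>'" for k y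
        using kT[OF that(1)] that(2) by (intro \<rho>'(2))
      show "norm (grad \<phi> (u (real k * \<tau>))) \<le> L" if "k \<le> M" for k using kT[OF that] by (rule L(2))
      show "norm (u (real (Suc k) * \<tau>) - u (real k * \<tau>) + \<tau> *\<^sub>R grad \<phi> (u (real k * \<tau>))) \<le> \<epsilon> / 2 * \<tau>" if "k < M" for k
        by (rule euler[OF that \<rho>(2) L\<tau>(1)])
      show "norm (u (real (Suc k) * \<tau>) - u (real k * \<tau>) + \<tau> *\<^sub>R grad \<phi> (u (real k * \<tau>))) \<le> \<epsilon>' / 2 * \<tau>" if "k < M" for k
        by (rule euler[OF that \<rho>'(2) L\<tau>(2)])
      show "\<kappa> * (real M * \<tau>) \<le> \<mu> * (\<rho> / 2)"
        using mult_left_mono[OF M(1) less_imp_le[OF \<kappa>(1)]] \<kappa>(2) by (simp only: mult.commute[of T \<kappa>])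
      show "4 * \<mu> \<le> \<delta>" by (simp add: \<mu>_def)
      show "\<tau> \<le> \<delta>" using \<tau>\<delta> by simp
      show "norm (u t - u s) \<le> L * (t - s)" if "0 \<le> s" "s \<le> t" "t \<le> T" for s t by (rule uL[OF that])
      show "\<phi> (u t) \<le> \<phi> (u s)" if "0 \<le> s" "s \<le> t" for s t by (rule GF_energy_antimono[OF C1 u that])
      show "norm (u t - u s) \<le> \<delta> / 4" if "0 \<le> s" "s \<le> t" "t \<le> T" "\<phi> (u s) - \<phi> (u t) \<le> \<beta>" for s t
        by (rule energy_gap[OF that])
      show "\<bar>\<phi> y - \<phi> (u t)\<bar> \<le> (L + \<epsilon>) * norm (y - u t)" if "0 \<le> t" "t \<le> T" "norm (y - u t) \<le> \<rho>" for t y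
        by (rule energy_near[OF that])
      show "2 * \<mu>\<^sup>2 * \<tau> \<le> \<kappa> * (real M * \<tau>)"
      proof -
        have "T / 2 \<le> real M * \<tau>" using M \<tau>T by linarith
        then have "\<kappa> * (T / 2) \<le> \<kappa> * (real M * \<tau>)" using \<kappa>(1) by simp
        then show ?thesis using \<tau>\<kappa> by simp
      qed
      show "\<kappa> * T / \<mu> \<le> \<delta> / 4" using \<kappa>(3) by (simp add: mult.commute)
      show "\<kappa> * T + 2 * ((L + \<epsilon>) * (\<kappa> * T / \<mu>)) \<le> \<beta>" using \<kappa>(4) by (simp add: algebra_simps)
      have hop: "\<mu> * \<tau> + L * (\<mu>\<^sup>2 * \<tau> / \<kappa>) + (L + 5 * \<mu>) * (\<tau> + 8 * \<kappa> * T / \<mu>\<^sup>2) + \<kappa> * T / \<mu>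
         = (\<mu> + L * (\<mu>\<^sup>2 / \<kappa>) + (L + 5 * \<mu>)) * \<tau> + ((L + 5 * \<mu>) * (8 * T / \<mu>\<^sup>2) + T / \<mu>) * \<kappa>"
        by (simp add: algebra_simps)
      show "\<mu> * \<tau> + L * (\<mu>\<^sup>2 * \<tau> / \<kappa>) + (L + 5 * \<mu>) * (\<tau> + 8 * \<kappa> * T / \<mu>\<^sup>2) + \<kappa> * T / \<mu> \<le> \<rho>"
        unfolding hop using hop1 \<kappa>(5) by linarith
      show "(L + \<epsilon>) * (\<mu> * \<tau> + L * (\<mu>\<^sup>2 * \<tau> / \<kappa>) + (L + 5 * \<mu>) * (\<tau> + 8 * \<kappa> * T / \<mu>\<^sup>2) + \<kappa> * T / \<mu>) \<le> \<beta>"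
        unfolding hop distrib_left[of "L + \<epsilon>" "(\<mu> + L * (\<mu>\<^sup>2 / \<kappa>) + (L + 5 * \<mu>)) * \<tau>"] mult.assoc[symmetric]
        using hop2 \<kappa>(6) by linarith
      show "norm (grad \<phi> (u (real M * \<tau>))) \<le> \<epsilon>" if "norm (grad \<phi> (u T)) \<le> \<epsilon> / 2"
      proof -
        have "norm (u T - u (real M * \<tau>)) \<le> L * (T - real M * \<tau>)" using M \<tau> by (intro uL) auto
        also have "\<dots> \<le> L * \<tau>" using M L(1) by (intro mult_left_mono) auto
        finally have "norm (u (real M * \<tau>) - u T) \<le> \<rho>" using L\<tau> by (simp add: norm_minus_commute)
        then have "norm (grad \<phi> (u (real M * \<tau>)) - grad \<phi> (u T)) \<le> \<epsilon> / 2" using T by (intro \<rho>(2)) auto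
        then show ?thesis
          using that norm_triangle_ineq[of "grad \<phi> (u (real M * \<tau>)) - grad \<phi> (u T)" "grad \<phi> (u T)"] by simp
      qed
      show "\<phi> U + 3 * \<mu> * norm (V - U) < \<phi> V + (norm (V - U))\<^sup>2 / (2 * \<tau>)"
        if k: "k \<le> M" and U: "norm (U - u (real k * \<tau>)) \<le> \<rho> / 2" and V: "\<rho> / 2 < norm (V - U)" for k U V
      proof -
        let ?d = "norm (V - U)" and ?t = "real k * \<tau>"
        have d: "R < ?d" using V by (simp add: R_def)
        have U\<rho>: "norm (U - u ?t) \<le> \<rho>" using U \<rho>(1) by simp
        have "\<phi> U \<le> \<phi> (u ?t) + (L + \<epsilon>) * norm (U - u ?t)" using energy_near[OF kT[OF k] U\<rho>] by simp
        also have "\<phi> (u ?t) \<le> \<phi> (u 0)" using kT[OF k] by (intro GF_energy_antimono[OF C1 u]) auto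
        also have "(L + \<epsilon>) * norm (U - u ?t) \<le> (L + \<epsilon>) * \<rho>" using U\<rho> L \<epsilon> by (intro mult_left_mono) auto
        finally have \<phi>U: "\<phi> U \<le> \<phi> (u 0) + (L + \<epsilon>) * \<rho>" by simp
        have "norm (u ?t - u 0) \<le> L * (?t - 0)" using kT[OF k] by (intro uL) auto
        also have "\<dots> \<le> L * T" using kT[OF k] L by simp
        finally have "norm (u ?t) \<le> norm (u 0) + L * T" using norm_triangle_ineq2[of "u ?t" "u 0"] by simp
        then have "norm U \<le> norm (u 0) + L * T + \<rho>" using U\<rho> norm_triangle_ineq2[of U "u ?t"] by simp
        then have nU: "(norm U)\<^sup>2 / \<tau>\<^sub>s \<le> (norm (u 0) + L * T + \<rho>)\<^sup>2 / \<tau>\<^sub>s"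
          using \<tau>\<^sub>s by (intro divide_right_mono power_mono) auto
        have "\<phi> V \<ge> - \<phi>\<^sub>s - (norm U)\<^sup>2 / \<tau>\<^sub>s - ?d\<^sup>2 / \<tau>\<^sub>s"
          by (rule quadratic_lower_bound[where \<phi> = \<phi>, OF lower \<tau>\<^sub>s])
        then have "\<phi> U - \<phi> V \<le> C + ?d\<^sup>2 / \<tau>\<^sub>s" using \<phi>U nU by (simp add: C_def)
        moreover have "C \<le> C / R\<^sup>2 * ?d\<^sup>2"
        proof -
          have "R\<^sup>2 \<le> ?d\<^sup>2" using d R by (intro power_mono) auto
          then have "C * R\<^sup>2 \<le> C * ?d\<^sup>2" by (intro mult_left_mono) (auto simp: C_def)
          then show ?thesis using R by (simp add: field_simps)
        qed
        moreover have "3 * \<mu> * ?d \<le> 3 * \<mu> / R * ?d\<^sup>2"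
        proof -
          have "3 * \<mu> * ?d * R \<le> 3 * \<mu> * ?d * ?d" using d \<mu> by (intro mult_left_mono) auto
          then show ?thesis using R by (simp add: field_simps power2_eq_square)
        qed
        ultimately have "\<phi> U + 3 * \<mu> * ?d - \<phi> V \<le> (C / R\<^sup>2 + 3 * \<mu> / R + 1 / \<tau>\<^sub>s) * ?d\<^sup>2"
          by (simp add: distrib_right)
        also have "\<dots> \<le> 1 / (4 * \<tau>) * ?d\<^sup>2"
          using \<tau>C \<tau> by (intro mult_right_mono) (auto simp: field_simps)
        also have "\<dots> < ?d\<^sup>2 / (2 * \<tau>)"
        proof -
          have "0 < ?d" using d R by linarith
          then have "0 < ?d\<^sup>2 / (4 * \<tau>)" using \<tau> by (intro divide_pos_pos zero_less_power) auto
          then show ?thesis by (simp add: field_simps)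
        qed
        finally show ?thesis by simp
      qed
    qed
    have "Lip (\<lambda>v. pot v - \<phi> v) \<le> ennreal \<delta>" using \<delta>_range by (intro Lip_pot) (simp add: \<mu>_def)
    moreover have "tracks \<phi> u T \<delta> \<tau> pot" by (rule pot_tracks)
    moreover have "never_stuck \<tau> pot (u 0)"
      if "norm (grad \<phi> (u T)) \<le> \<delta> / 128 \<or> span B0 = UNIV"
      using that
    proof
      assume "norm (grad \<phi> (u T)) \<le> \<delta> / 128"
      then show ?thesis by (intro end_invariant) (simp add: \<epsilon>_def)
    next
      assume "span B0 = UNIV"
      then have "span B = UNIV" using span_mono[of B0 B] by (auto simp: B_def)
      then have "\<exists>V. MS_step \<tau> pot U V" for U
        using step_exists_finite_dimensional[OF _ lower \<tau>\<^sub>s] \<tau>\<tau>\<^sub>s \<tau> by simp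
      then show ?thesis unfolding never_stuck_def by (intro exI[of _ UNIV]) auto
    qed
    ultimately show "\<exists>\<psi>. Lip (\<lambda>v. \<psi> v - \<phi> v) \<le> ennreal \<delta> \<and> tracks \<phi> u T \<delta> \<tau> \<psi> \<and>
      (norm (grad \<phi> (u T)) \<le> \<delta> / 128 \<or> span B0 = UNIV \<longrightarrow> never_stuck \<tau> \<psi> (u 0))"
      by (intro exI[of _ pot]) blast
  qed
qed

section \<open>Limits of chains\<close>

text \<open>
  The estimate for \<open>u\<close> says that \<open>u\<close> solves the gradient flow equation with respect to the new time \<open>Z\<close>.
  It forces \<open>u\<close> to be constant where \<open>Z\<close> is, so \<open>u = v \<circ> Z\<close> defines a curve \<open>v\<close>, and the same
  estimate in terms of \<open>v\<close> is its differentiability with derivative \<open>-\<nabla>\<phi>(v)\<close>.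
\<close>
lemma reparametrized_gradient_flow:
  fixes \<phi> :: "'a::{real_inner,banach} \<Rightarrow> real"
  assumes C1: "C1 \<phi>" and u: "u \<in> GF \<phi>"
    and Z0: "Z 0 = (0::real)" and Z: "\<And>s t. 0 \<le> s \<Longrightarrow> s \<le> t \<Longrightarrow> 0 \<le> Z t - Z s \<and> Z t - Z s \<le> t - s"
    and unbdd: "\<And>X. \<exists>s\<ge>0. X \<le> Z s"
    and linearized_all: "\<And>s t \<omega>. 0 \<le> s \<Longrightarrow> s \<le> t \<Longrightarrow> (\<And>r. s \<le> r \<Longrightarrow> r \<le> t \<Longrightarrow> norm (grad \<phi> (u r) - grad \<phi> (u s)) \<le> \<omega>) \<Longrightarrow>
        norm (u t - u s + (Z t - Z s) *\<^sub>R grad \<phi> (u s)) \<le> (Z t - Z s) * \<omega>"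
  shows "\<exists>v\<in>GF \<phi>. (\<forall>t\<ge>0. u t = v (Z t)) \<and> curve_range v \<subseteq> curve_range u"
proof -
  have cg: "continuous_on UNIV (grad \<phi>)" by (rule C1_continuous_grad[OF C1])
  have bdd: "\<exists>K\<ge>0. \<forall>r. 0 \<le> r \<and> r \<le> t \<longrightarrow> norm (grad \<phi> (u r)) \<le> K" for t
  proof -
    have "continuous_on {0..t} u" using GF_continuous[OF u] continuous_on_subset by fastforce
    then have "compact (grad \<phi> ` u ` {0..t})"
      by (intro compact_continuous_image continuous_on_subset[OF cg]) auto
    then have "bounded (grad \<phi> ` u ` {0..t})" by (rule compact_imp_bounded)
    then obtain K where "K > 0" "\<forall>x\<in>grad \<phi> ` u ` {0..t}. norm x \<le> K" unfolding bounded_pos by auto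
    then show ?thesis by (intro exI[of _ K]) auto
  qed
  have Z_cont: "continuous_on {0..t} Z" for t
  proof (rule lipschitz_on_continuous_on)
    show "1-lipschitz_on {0..t} Z"
    proof (rule lipschitz_onI)
      fix r s assume "r \<in> {0..t}" "s \<in> {0..t}"
      then show "dist (Z r) (Z s) \<le> 1 * dist r s"
        using Z[of r s] Z[of s r] by (cases "r \<le> s") (auto simp: dist_real_def)
    qed simp
  qed
  have onto: "\<exists>r. 0 \<le> r \<and> r \<le> s \<and> Z r = w" if "0 \<le> w" "w \<le> Z s" "0 \<le> s" for w s
    using IVT'[of Z 0 w s] that Z0 Z_cont by auto
  define S where "S w = (SOME s. 0 \<le> s \<and> Z s = w)" for w
  have S: "0 \<le> S w" "Z (S w) = w" if "0 \<le> w" for w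
  proof -
    obtain s where "s \<ge> 0" "w \<le> Z s" using unbdd by blast
    then have "\<exists>s. 0 \<le> s \<and> Z s = w" using onto[OF that] by blast
    from someI_ex[OF this] show "0 \<le> S w" "Z (S w) = w" by (auto simp: S_def)
  qed
  define v where "v w = u (S w)" for w
  have same: "u s = u t" if st: "0 \<le> s" "s \<le> t" "Z s = Z t" for s t
  proof -
    obtain K where K: "K \<ge> 0" "\<And>r. 0 \<le> r \<Longrightarrow> r \<le> t \<Longrightarrow> norm (grad \<phi> (u r)) \<le> K" using bdd[of t] by blast
    have "norm (u t - u s + (Z t - Z s) *\<^sub>R grad \<phi> (u s)) \<le> (Z t - Z s) * (2 * K)"
    proof (rule linearized_all[OF st(1,2)])
      fix r assume "s \<le> r" "r \<le> t"
      then show "norm (grad \<phi> (u r) - grad \<phi> (u s)) \<le> 2 * K"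
        using K(2)[of r] K(2)[of s] st norm_triangle_ineq4[of "grad \<phi> (u r)" "grad \<phi> (u s)"] by simp
    qed
    then show ?thesis using st(3) by simp
  qed
  have vZ: "v (Z t) = u t" if "0 \<le> t" for t
  proof -
    have "0 \<le> Z t" using Z[of 0 t] Z0 that by simp
    then show ?thesis unfolding v_def using same[of "S (Z t)" t] same[of t "S (Z t)"] S[of "Z t"] that
      by (cases "S (Z t) \<le> t") auto
  qed
  have vlin: "norm (v y - v x + (y - x) *\<^sub>R grad \<phi> (v x)) \<le> (y - x) * \<omega>"
    if xy: "0 \<le> x" "x \<le> y" and \<omega>: "\<And>w. x \<le> w \<Longrightarrow> w \<le> y \<Longrightarrow> norm (grad \<phi> (v w) - grad \<phi> (v x)) \<le> \<omega>" for x y \<omega>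
  proof (cases "S x \<le> S y")
    case True
    have "norm (u (S y) - u (S x) + (Z (S y) - Z (S x)) *\<^sub>R grad \<phi> (u (S x))) \<le> (Z (S y) - Z (S x)) * \<omega>"
    proof (rule linearized_all[OF S(1)[OF xy(1)] True])
      fix r assume r: "S x \<le> r" "r \<le> S y"
      have r0: "0 \<le> r" using r S(1)[OF xy(1)] by simp
      have "x \<le> Z r" "Z r \<le> y"
        using Z[of "S x" r] Z[of r "S y"] r r0 S[of x] S[of y] xy by auto
      then have "norm (grad \<phi> (v (Z r)) - grad \<phi> (v x)) \<le> \<omega>" by (rule \<omega>)
      then show "norm (grad \<phi> (u r) - grad \<phi> (u (S x))) \<le> \<omega>" using vZ[OF r0] by (simp add: v_def)
    qed
    then show ?thesis using S(2)[of x] S(2)[of y] xy by (simp add: v_def)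
  next
    case False
    then have "Z (S y) \<le> Z (S x)" using Z[of "S y" "S x"] S(1)[of y] xy by simp
    then have "x = y" using S(2)[of x] S(2)[of y] xy by simp
    then show ?thesis by simp
  qed
  have vbdd: "\<exists>K\<ge>0. \<forall>w. 0 \<le> w \<and> w \<le> X \<longrightarrow> norm (grad \<phi> (v w)) \<le> K" for X
  proof -
    obtain s where s: "s \<ge> 0" "X \<le> Z s" using unbdd by blast
    obtain K where K: "K \<ge> 0" "\<And>r. 0 \<le> r \<Longrightarrow> r \<le> s \<Longrightarrow> norm (grad \<phi> (u r)) \<le> K" using bdd[of s] by blast
    have "norm (grad \<phi> (v w)) \<le> K" if w: "0 \<le> w" "w \<le> X" for w
    proof -
      obtain r where "0 \<le> r" "r \<le> s" "Z r = w" using onto[of w s] s w by auto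
      then show ?thesis using K(2)[of r] vZ[of r] by auto
    qed
    then show ?thesis using K(1) by blast
  qed
  have vcont: "continuous_on {0..} v"
    unfolding continuous_on_iff
  proof (intro ballI allI impI)
    fix x e :: real assume x: "x \<in> {0..}" and e: "e > 0"
    obtain K where K: "K \<ge> 0" "\<And>w. 0 \<le> w \<Longrightarrow> w \<le> x + 1 \<Longrightarrow> norm (grad \<phi> (v w)) \<le> K" using vbdd[of "x + 1"] by blast
    have lip: "norm (v b - v a) \<le> (b - a) * (3 * K)" if ab: "0 \<le> a" "a \<le> b" "b \<le> x + 1" for a b
    proof -
      have "norm (v b - v a + (b - a) *\<^sub>R grad \<phi> (v a)) \<le> (b - a) * (2 * K)"
      proof (rule vlin[OF ab(1,2)])
        fix w assume "a \<le> w" "w \<le> b"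
        then show "norm (grad \<phi> (v w) - grad \<phi> (v a)) \<le> 2 * K"
          using K(2)[of w] K(2)[of a] ab norm_triangle_ineq4[of "grad \<phi> (v w)" "grad \<phi> (v a)"] by simp
      qed
      moreover have "norm ((b - a) *\<^sub>R grad \<phi> (v a)) \<le> (b - a) * K"
        using K(2)[of a] ab by (simp add: mult_left_mono)
      ultimately show ?thesis
        using norm_triangle_ineq4[of "v b - v a + (b - a) *\<^sub>R grad \<phi> (v a)" "(b - a) *\<^sub>R grad \<phi> (v a)"]
        by (simp add: algebra_simps)
    qed
    define d where "d = min 1 (e / (3 * K + 1))"
    have d: "d > 0" "d \<le> 1" using e K(1) by (auto simp: d_def)
    have "d \<le> e / (3 * K + 1)" by (simp add: d_def)
    then have de: "d * (3 * K + 1) \<le> e" using K(1) by (simp add: pos_le_divide_eq)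
    show "\<exists>d>0. \<forall>y\<in>{0..}. dist y x < d \<longrightarrow> dist (v y) (v x) < e"
    proof (intro exI[of _ d] conjI ballI impI)
      fix y assume y: "y \<in> {0..}" "dist y x < d"
      have "norm (v y - v x) \<le> dist y x * (3 * K)"
        using lip[of x y] lip[of y x] x y d(2) by (cases "x \<le> y") (auto simp: dist_real_def norm_minus_commute)
      also have "\<dots> \<le> dist y x * (3 * K + 1)" by (simp add: algebra_simps)
      also have "\<dots> < d * (3 * K + 1)" using y(2) K(1) by (intro mult_strict_right_mono) auto
      finally show "dist (v y) (v x) < e" using de by (simp add: dist_norm)
    qed (rule d(1))
  qed
  have gvcont: "continuous_on {0..} (\<lambda>w. grad \<phi> (v w))"
    using continuous_on_compose2[OF cg vcont] by simp
  have "v \<in> GF \<phi>"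
    unfolding GF_def
  proof (intro CollectI exI[of _ "\<lambda>w. - grad \<phi> (v w)"] conjI allI impI refl)
    show "continuous_on {0..} (\<lambda>w. - grad \<phi> (v w))" using gvcont by (intro continuous_intros)
    fix x :: real assume x: "0 \<le> x"
    show "(v has_vector_derivative - grad \<phi> (v x)) (at x within {0..})"
      unfolding has_vector_derivative_def has_derivative_within_alt
    proof (intro conjI allI impI bounded_linear_scaleR_left)
      fix e :: real assume e: "e > 0"
      then obtain d where d: "d > 0" "\<And>w. w \<ge> 0 \<Longrightarrow> dist w x < d \<Longrightarrow> dist (grad \<phi> (v w)) (grad \<phi> (v x)) < e / 3"
        using gvcont x unfolding continuous_on_iff by (metis atLeast_iff divide_pos_pos zero_less_numeral)
      show "\<exists>d>0. \<forall>y\<in>{0..}. norm (y - x) < d \<longrightarrow>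
          norm (v y - v x - (y - x) *\<^sub>R - grad \<phi> (v x)) \<le> e * norm (y - x)"
      proof (intro exI[of _ d] conjI ballI impI)
        fix y assume y: "y \<in> {0..}" "norm (y - x) < d"
        show "norm (v y - v x - (y - x) *\<^sub>R - grad \<phi> (v x)) \<le> e * norm (y - x)"
        proof (cases "x \<le> y")
          case True
          have "norm (v y - v x + (y - x) *\<^sub>R grad \<phi> (v x)) \<le> (y - x) * e"
          proof (rule vlin[OF x True])
            fix w assume "x \<le> w" "w \<le> y"
            then show "norm (grad \<phi> (v w) - grad \<phi> (v x)) \<le> e"
              using d(2)[of w] x y e by (simp add: dist_norm)
          qed
          then show ?thesis using True by (simp add: mult.commute)
        next
          case False
          then have yx: "y \<le> x" by simp
          have gy: "norm (grad \<phi> (v y) - grad \<phi> (v x)) \<le> e / 3" using d(2)[of y] y by (simp add: dist_norm)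
          have "norm (v x - v y + (x - y) *\<^sub>R grad \<phi> (v y)) \<le> (x - y) * (2 * e / 3)"
          proof (rule vlin)
            fix w assume "y \<le> w" "w \<le> x"
            then have "norm (grad \<phi> (v w) - grad \<phi> (v x)) \<le> e / 3"
              using d(2)[of w] y by (simp add: dist_norm)
            then show "norm (grad \<phi> (v w) - grad \<phi> (v y)) \<le> 2 * e / 3"
              using gy norm_triangle_ineq4[of "grad \<phi> (v w) - grad \<phi> (v x)" "grad \<phi> (v y) - grad \<phi> (v x)"] by simp
          qed (use y yx in auto)
          moreover have "norm ((x - y) *\<^sub>R (grad \<phi> (v y) - grad \<phi> (v x))) \<le> (x - y) * (e / 3)"
            using gy yx by (simp add: mult_left_mono del: times_divide_eq_right)
          ultimately have "norm ((v x - v y + (x - y) *\<^sub>R grad \<phi> (v y)) - (x - y) *\<^sub>R (grad \<phi> (v y) - grad \<phi> (v x)))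
              \<le> (x - y) * (2 * e / 3) + (x - y) * (e / 3)"
            by (intro norm_triangle_le_diff add_mono)
          also have "\<dots> = e * norm (y - x)" using yx by (simp add: field_simps)
          also have "(v x - v y + (x - y) *\<^sub>R grad \<phi> (v y)) - (x - y) *\<^sub>R (grad \<phi> (v y) - grad \<phi> (v x))
              = - (v y - v x - (y - x) *\<^sub>R - grad \<phi> (v x))" by (simp add: algebra_simps)
          finally show ?thesis by (simp only: norm_minus_cancel)
        qed
      qed (rule d(1))
    qed
  qed
  moreover have "curve_range v \<subseteq> curve_range u" using S by (auto simp: curve_range_def v_def)
  ultimately show ?thesis using vZ by (intro bexI[of _ v]) auto
qed

text \<open>
  A Lipschitz version of the time \<open>\<tau> min {n. s \<le> Q n}\<close> at which the chain has covered the curve up to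
  \<open>s\<close>; it differs from that time by at most \<open>\<tau>\<close>.  Being equi-Lipschitz, these functions are accessible to
  the theorem of Arzela and Ascoli.
\<close>
definition passage :: "real \<Rightarrow> real \<Rightarrow> nat \<Rightarrow> (nat \<Rightarrow> real) \<Rightarrow> real \<Rightarrow> real" where
  "passage \<delta> \<tau> N Q s = Min ((\<lambda>n. real n * \<tau> + max 0 (s - Q n) / (1 - \<delta>)) ` {..N})"

lemma passage_le: "n \<le> N \<Longrightarrow> passage \<delta> \<tau> N Q s \<le> real n * \<tau> + max 0 (s - Q n) / (1 - \<delta>)"
  unfolding passage_def by (intro Min_le) auto

lemma passage_attained: "\<exists>n\<le>N. passage \<delta> \<tau> N Q s = real n * \<tau> + max 0 (s - Q n) / (1 - \<delta>)"
proof -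
  have "passage \<delta> \<tau> N Q s \<in> (\<lambda>n. real n * \<tau> + max 0 (s - Q n) / (1 - \<delta>)) ` {..N}"
    unfolding passage_def by (intro Min_in) auto
  then show ?thesis by auto
qed

lemma passage_mono:
  assumes "\<delta> < 1" "s \<le> t" shows "passage \<delta> \<tau> N Q s \<le> passage \<delta> \<tau> N Q t"
proof -
  obtain n where n: "n \<le> N" "passage \<delta> \<tau> N Q t = real n * \<tau> + max 0 (t - Q n) / (1 - \<delta>)"
    using passage_attained by blast
  have "max 0 (s - Q n) / (1 - \<delta>) \<le> max 0 (t - Q n) / (1 - \<delta>)"
    using assms by (intro divide_right_mono) auto
  then show ?thesis using passage_le[OF n(1), of \<delta> \<tau> Q s] n(2) by linarith
qed

lemma passage_Lipschitz:
  assumes "\<delta> < 1" "s \<le> t" shows "passage \<delta> \<tau> N Q t \<le> passage \<delta> \<tau> N Q s + (t - s) / (1 - \<delta>)"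
proof -
  obtain n where n: "n \<le> N" "passage \<delta> \<tau> N Q s = real n * \<tau> + max 0 (s - Q n) / (1 - \<delta>)"
    using passage_attained by blast
  have "max 0 (t - Q n) / (1 - \<delta>) \<le> (max 0 (s - Q n) + (t - s)) / (1 - \<delta>)"
    using assms by (intro divide_right_mono) auto
  then show ?thesis using passage_le[OF n(1), of \<delta> \<tau> Q t] n(2) by (simp add: add_divide_distrib)
qed

lemma passage_0:
  assumes "\<delta> < 1" "\<tau> > 0" "0 \<le> Q 0" shows "passage \<delta> \<tau> N Q 0 = 0"
proof (rule antisym)
  show "passage \<delta> \<tau> N Q 0 \<le> 0" using passage_le[of 0 N \<delta> \<tau> Q 0] assms by simp
  obtain n where n: "n \<le> N" "passage \<delta> \<tau> N Q 0 = real n * \<tau> + max 0 (0 - Q n) / (1 - \<delta>)"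
    using passage_attained by blast
  have "0 \<le> real n * \<tau>" "0 \<le> max 0 (0 - Q n) / (1 - \<delta>)" using assms by auto
  then show "0 \<le> passage \<delta> \<tau> N Q 0" using n(2) by linarith
qed

lemma follows_growth:
  assumes f: "follows \<phi> u \<delta> \<tau> U N Q" and ij: "i \<le> j" "j \<le> N"
  shows "Q i + real (j - i) * ((1 - \<delta>) * \<tau>) \<le> Q j"
  using ij
proof (induction j)
  case (Suc j)
  show ?case
  proof (cases "i = Suc j")
    case False
    have "Q j + (1 - \<delta>) * \<tau> \<le> Q (Suc j)" using f Suc.prems by (simp add: follows_def)
    moreover have "Q i + real (j - i) * ((1 - \<delta>) * \<tau>) \<le> Q j" using Suc False by auto
    moreover have "real (Suc j - i) = real (j - i) + 1" using Suc.prems(1) False by simp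
    ultimately show ?thesis by (simp only: distrib_right mult_1)
  qed simp
qed simp

lemma follows_index:
  assumes f: "follows \<phi> u \<delta> \<tau> U N Q" and \<delta>: "\<delta> < 1" and \<tau>: "\<tau> > 0" and s: "0 \<le> s" "s \<le> Q N"
  defines "n \<equiv> LEAST n. s \<le> Q n"
  shows "n \<le> N" "s \<le> Q n" "norm (U n - u s) \<le> \<delta>" "real n * \<tau> - \<tau> \<le> passage \<delta> \<tau> N Q s" "passage \<delta> \<tau> N Q s \<le> real n * \<tau>"
proof -
  show nN: "n \<le> N" unfolding n_def using s(2) by (rule Least_le)
  show sn: "s \<le> Q n" unfolding n_def using s(2) by (rule LeastI)
  have prev: "n = 0 \<or> Q (n - 1) \<le> s"
    using not_less_Least[of "n - 1" "\<lambda>n. s \<le> Q n"] unfolding n_def[symmetric] by (cases n) auto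
  show "norm (U n - u s) \<le> \<delta>" using f nN sn prev s(1) unfolding follows_def by blast
  show "passage \<delta> \<tau> N Q s \<le> real n * \<tau>" using passage_le[OF nN, of \<delta> \<tau> Q s] sn by simp
  obtain i where i: "i \<le> N" "passage \<delta> \<tau> N Q s = real i * \<tau> + max 0 (s - Q i) / (1 - \<delta>)"
    using passage_attained by blast
  show "real n * \<tau> - \<tau> \<le> passage \<delta> \<tau> N Q s"
  proof (cases "n \<le> i")
    case True
    then have "real n * \<tau> \<le> real i * \<tau>" using \<tau> by (intro mult_right_mono) auto
    moreover have "0 \<le> max 0 (s - Q i) / (1 - \<delta>)" using \<delta> by simp
    ultimately show ?thesis using i(2) \<tau> by linarith
  next
    case False
    then have "Q i + real (n - 1 - i) * ((1 - \<delta>) * \<tau>) \<le> Q (n - 1)"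
      using nN by (intro follows_growth[OF f]) auto
    moreover have "Q (n - 1) \<le> s" using prev False by auto
    ultimately have "real (n - 1 - i) * ((1 - \<delta>) * \<tau>) \<le> s - Q i" by linarith
    also have "\<dots> \<le> max 0 (s - Q i)" by simp
    finally have "real (n - 1 - i) * \<tau> * (1 - \<delta>) \<le> max 0 (s - Q i)" by (simp add: mult.assoc mult.left_commute mult.commute[of \<tau>])
    then have "real (n - 1 - i) * \<tau> \<le> max 0 (s - Q i) / (1 - \<delta>)" using \<delta> by (simp add: pos_le_divide_eq)
    moreover have "real (n - 1 - i) = real n - 1 - real i" using False by simp
    ultimately show ?thesis using i(2) by (simp add: algebra_simps)
  qed
qed

lemma follows_index_mono:
  fixes Q :: "nat \<Rightarrow> real"
  assumes "s \<le> t" "t \<le> Q N" shows "(LEAST n. s \<le> Q n) \<le> (LEAST n. t \<le> Q n)"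
  by (rule Least_le) (use assms LeastI[of "\<lambda>n. t \<le> Q n" N] in auto)

text \<open>
  Summing the Euler steps between the moments when the chain passes \<open>s\<close> and \<open>t\<close>.  In between it is always
  near the piece of the curve from \<open>s\<close> to \<open>t\<close>, so that the oscillation of \<open>\<nabla>\<phi>\<close> on this piece controls
  the error.
\<close>
lemma follows_linearization:
  assumes f: "follows \<phi> u \<delta> \<tau> U N Q" and \<delta>: "\<delta> < 1" and \<tau>: "\<tau> > 0"
    and s: "0 \<le> s" and st: "s \<le> t" and t: "t \<le> Q N"
    and \<omega>: "\<And>r. s \<le> r \<Longrightarrow> r \<le> t \<Longrightarrow> norm (grad \<phi> (u r) - grad \<phi> (u s)) \<le> \<omega>"
    and e: "\<And>r y. s \<le> r \<Longrightarrow> r \<le> t \<Longrightarrow> norm (y - u r) \<le> \<delta> \<Longrightarrow> norm (grad \<phi> y - grad \<phi> (u r)) \<le> e"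
  defines "h \<equiv> real (LEAST n. t \<le> Q n) * \<tau> - real (LEAST n. s \<le> Q n) * \<tau>"
  shows "norm (u t - u s + h *\<^sub>R grad \<phi> (u s)) \<le> 2 * \<delta> + h * (\<delta> + e + \<omega>)"
proof -
  let ?i = "LEAST n. s \<le> Q n" and ?j = "LEAST n. t \<le> Q n" and ?g = "grad \<phi> (u s)"
  have sN: "s \<le> Q N" and t0: "0 \<le> t" using s st t by auto
  note I = follows_index[OF f \<delta> \<tau> s sN] and J = follows_index[OF f \<delta> \<tau> t0 t]
  have ij: "?i \<le> ?j" by (rule follows_index_mono[where Q = Q and N = N, OF st t])
  have main: "norm (U j - U ?i + (real (j - ?i) * \<tau>) *\<^sub>R ?g) \<le> real (j - ?i) * \<tau> * (\<delta> + e + \<omega>)" if "?i \<le> j" "j \<le> ?j" for j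
    using that
  proof (induction j)
    case (Suc j)
    show ?case
    proof (cases "?i = Suc j")
      case False
      then have j: "?i \<le> j" "j < ?j" using Suc.prems by auto
      have "\<not> t \<le> Q j" using not_less_Least[OF j(2)] .
      then have Qj: "Q j \<le> t" by simp
      have "Q ?i + real (j - ?i) * ((1 - \<delta>) * \<tau>) \<le> Q j"
        using j J(1) by (intro follows_growth[OF f]) auto
      moreover have "0 \<le> real (j - ?i) * ((1 - \<delta>) * \<tau>)" using \<delta> \<tau> by simp
      ultimately have "Q ?i \<le> Q j" by linarith
      then have sQ: "s \<le> Q j" using I(2) by simp
      have jN: "j < N" using j J(1) by simp
      have prev: "j = 0 \<or> Q (j - 1) \<le> Q j"
      proof (cases j)
        case (Suc p)
        have "Q p + (1 - \<delta>) * \<tau> \<le> Q (Suc p)" using f jN Suc by (simp add: follows_def)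
        moreover have "0 \<le> (1 - \<delta>) * \<tau>" using \<delta> \<tau> by simp
        ultimately show ?thesis using Suc by simp
      qed simp
      have "\<forall>n\<le>N. \<forall>s. 0 \<le> s \<and> s \<le> Q n \<and> (n = 0 \<or> Q (n - 1) \<le> s) \<longrightarrow> norm (U n - u s) \<le> \<delta>"
        using f unfolding follows_def by (elim conjE)
      from this[rule_format, of j "Q j"] have "norm (U j - u (Q j)) \<le> \<delta>"
        using jN prev order_trans[OF s sQ] by simp
      then have "norm (grad \<phi> (U j) - grad \<phi> (u (Q j))) \<le> e" by (rule e[OF sQ Qj])
      moreover have "norm (grad \<phi> (u (Q j)) - ?g) \<le> \<omega>" by (rule \<omega>[OF sQ Qj])
      ultimately have "norm (grad \<phi> (U j) - ?g) \<le> e + \<omega>"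
        using norm_triangle_ineq[of "grad \<phi> (U j) - grad \<phi> (u (Q j))" "grad \<phi> (u (Q j)) - ?g"] by simp
      then have a: "norm (\<tau> *\<^sub>R (grad \<phi> (U j) - ?g)) \<le> \<tau> * (e + \<omega>)" using \<tau> by simp
      have b: "norm (U (Suc j) - U j + \<tau> *\<^sub>R grad \<phi> (U j)) \<le> \<delta> * \<tau>" using f jN by (simp add: follows_def)
      have c: "norm (U j - U ?i + (real (j - ?i) * \<tau>) *\<^sub>R ?g) \<le> real (j - ?i) * \<tau> * (\<delta> + e + \<omega>)"
        using Suc.IH j by simp
      have r: "real (Suc j - ?i) = real (j - ?i) + 1" using j by simp
      have eq: "U (Suc j) - U ?i + (real (Suc j - ?i) * \<tau>) *\<^sub>R ?g =
        (U j - U ?i + (real (j - ?i) * \<tau>) *\<^sub>R ?g) + ((U (Suc j) - U j + \<tau> *\<^sub>R grad \<phi> (U j)) - \<tau> *\<^sub>R (grad \<phi> (U j) - ?g))"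
        unfolding r by (simp add: algebra_simps)
      have "norm (U (Suc j) - U ?i + (real (Suc j - ?i) * \<tau>) *\<^sub>R ?g) \<le>
        real (j - ?i) * \<tau> * (\<delta> + e + \<omega>) + (\<delta> * \<tau> + \<tau> * (e + \<omega>))"
        unfolding eq by (intro norm_triangle_mono norm_triangle_le_diff add_mono a b c)
      also have "\<dots> = real (Suc j - ?i) * \<tau> * (\<delta> + e + \<omega>)" unfolding r by (simp add: algebra_simps)
      finally show ?thesis .
    qed simp
  qed simp
  have h: "h = real (?j - ?i) * \<tau>" using ij by (simp add: h_def of_nat_diff algebra_simps)
  have eq: "u t - u s + h *\<^sub>R ?g = (U ?j - U ?i + h *\<^sub>R ?g) + ((U ?i - u s) - (U ?j - u t))" by simp
  have "norm (u t - u s + h *\<^sub>R ?g) \<le> h * (\<delta> + e + \<omega>) + (\<delta> + \<delta>)"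
    unfolding eq
    by (intro norm_triangle_mono norm_triangle_le_diff add_mono I(3) J(3)) (use main[OF ij order_refl] h in simp)
  then show ?thesis by simp
qed

text \<open>
  Along a curve that repeats itself the decreasing energy must be constant.
\<close>
lemma GF_periodic_constant:
  fixes \<phi> :: "'a::{real_inner,banach} \<Rightarrow> real"
  assumes C1: "C1 \<phi>" and u: "u \<in> GF \<phi>" and c: "c > 0" and a: "a \<ge> 0"
    and per: "\<And>s. s \<ge> a + c \<Longrightarrow> u s = u (s - c)"
  shows "\<And>s. s \<ge> a \<Longrightarrow> u s = u a" "grad \<phi> (u a) = 0"
proof -
  have ua: "u (a + real n * c) = u a" for n
  proof (induction n)
    case (Suc n)
    have "u (a + real (Suc n) * c) = u (a + real (Suc n) * c - c)"
      using c by (intro per) (simp add: algebra_simps)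
    also have "a + real (Suc n) * c - c = a + real n * c" by (simp add: algebra_simps)
    finally show ?case using Suc by simp
  qed simp
  show const: "u s = u a" if "s \<ge> a" for s
  proof -
    obtain n where "s - a < real n * c" using reals_Archimedean3[OF c] by blast
    then have "\<phi> (u (a + real n * c)) \<le> \<phi> (u s)" using that a by (intro GF_energy_antimono[OF C1 u]) auto
    then show ?thesis using that a ua[of n] by (intro GF_constant_if_energy_constant[OF C1 u]) auto
  qed
  have "norm (u (a + 1) - u a + ((a + 1) - a) *\<^sub>R grad \<phi> (u a)) \<le> ((a + 1) - a) * 0"
  proof (rule GF_linearization[OF u a])
    fix r assume "a \<le> r"
    then have "u r = u a" by (rule const)
    then show "norm (grad \<phi> (u r) - grad \<phi> (u a)) \<le> 0" by simp
  qed simp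
  then show "grad \<phi> (u a) = 0" using const[of "a + 1"] by simp
qed

text \<open>
  A subsequence of the passage times converges to a 1-Lipschitz function on the part \<open>[0, \<sigma>]\<close> of the
  curve that the chains cover; \<open>Z\<close> is its value at \<open>\<sigma>\<close>.  Continued with slope 1 beyond \<open>\<sigma>\<close>, where \<open>u\<close> itself
  takes over from the chains, it satisfies \<open>reparametrized_gradient_flow\<close>, and minimality
  identifies the limit with \<open>u\<close>.  The conclusion is about \<open>\<sigma>\<close> only: either no time was gained up to \<open>\<sigma>\<close>,
  or \<open>u\<close> is periodic, hence constant, from \<open>Z\<close> on.
\<close>
lemma limit_of_followers:
  fixes \<phi> :: "'a::{real_inner,banach} \<Rightarrow> real"
  assumes C1: "C1 \<phi>" and umin: "u \<in> GF_min \<phi>" and S: "S > 0"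
    and fol: "\<And>i::nat. follows \<phi> u (\<delta> i) (\<tau> i) (U i) (N i) (Q i)"
    and \<tau>: "\<And>i. \<tau> i > 0" "\<tau> \<longlonglongrightarrow> 0" and \<delta>: "\<And>i. \<delta> i \<le> 1 / 2" "\<delta> \<longlonglongrightarrow> 0"
  obtains k Z \<sigma> where "strict_mono (k :: nat \<Rightarrow> nat)" "0 \<le> \<sigma>" "\<sigma> \<le> S"
    "(\<lambda>i. min (Q (k i) (N (k i))) S) \<longlonglongrightarrow> \<sigma>"
    "\<And>s. (\<And>i. 0 \<le> s i \<and> s i \<le> S) \<Longrightarrow> s \<longlonglongrightarrow> \<sigma> \<Longrightarrow> (\<lambda>i. passage (\<delta> (k i)) (\<tau> (k i)) (N (k i)) (Q (k i)) (s i)) \<longlonglongrightarrow> Z"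
    "0 \<le> Z" "Z \<le> \<sigma>" "u \<sigma> = u Z"
    "Z < \<sigma> \<Longrightarrow> (\<forall>s\<ge>Z. u s = u Z) \<and> grad \<phi> (u Z) = 0"
proof -
  have u: "u \<in> GF \<phi>" using umin by (simp add: GF_min_def)
  have cg: "continuous_on UNIV (grad \<phi>)" by (rule C1_continuous_grad[OF C1])
  have \<delta>1: "\<delta> i < 1" for i using \<delta>(1)[of i] by simp
  define P where "P i = passage (\<delta> i) (\<tau> i) (N i) (Q i)" for i
  define E where "E i = min (Q i (N i)) S" for i
  have Q0: "0 \<le> Q i 0" for i using fol[of i] by (simp add: follows_def)
  have QN: "0 \<le> Q i (N i)" for i
  proof -
    have "Q i 0 + real (N i - 0) * ((1 - \<delta> i) * \<tau> i) \<le> Q i (N i)" by (rule follows_growth[OF fol]) auto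
    moreover have "0 \<le> real (N i - 0) * ((1 - \<delta> i) * \<tau> i)" using \<delta>1[of i] \<tau>(1)[of i] by simp
    ultimately show ?thesis using Q0[of i] by linarith
  qed
  have E: "E i \<in> {0..S}" for i using QN[of i] S by (auto simp: E_def)
  then have "\<exists>l\<in>{0..S}. \<exists>r. strict_mono (r :: nat \<Rightarrow> nat) \<and> (E \<circ> r) \<longlonglongrightarrow> l"
    using iffD1[OF compact_def compact_Icc, rule_format, of E] by simp
  then obtain \<sigma> k1 where k1: "\<sigma> \<in> {0..S}" "strict_mono (k1 :: nat \<Rightarrow> nat)" "(E \<circ> k1) \<longlonglongrightarrow> \<sigma>"
    by (elim bexE exE conjE)
  have P_mono: "P i s \<le> P i t" if "s \<le> t" for i s t
    unfolding P_def by (rule passage_mono[OF \<delta>1 that])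
  have P_lip: "P i t \<le> P i s + (t - s) / (1 - \<delta> i)" if "s \<le> t" for i s t
    unfolding P_def by (rule passage_Lipschitz[OF \<delta>1 that])
  have P0: "P i 0 = 0" for i unfolding P_def using passage_0[of "\<delta> i" "\<tau> i" "Q i"] \<delta>1 \<tau>(1) Q0 by simp
  have P_lip2: "\<bar>P i s - P i t\<bar> \<le> 2 * \<bar>s - t\<bar>" for i s t
  proof -
    have "P i t - P i s \<le> 2 * (t - s)" if "s \<le> t" for s t
    proof -
      have "(t - s) * 1 \<le> (t - s) * (2 * (1 - \<delta> i))" using that \<delta>(1)[of i] by (intro mult_left_mono) auto
      then have "(t - s) / (1 - \<delta> i) \<le> 2 * (t - s)" using \<delta>1[of i]
        by (subst pos_divide_le_eq) (simp_all add: algebra_simps)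
      then show ?thesis using P_lip[OF that, of i] by linarith
    qed
    from this[of s t] this[of t s] show ?thesis
      using P_mono[of s t i] P_mono[of t s i] by (cases "s \<le> t") auto
  qed
  have "\<exists>Z k2. continuous_on {0..S} Z \<and> strict_mono (k2 :: nat \<Rightarrow> nat) \<and>
    (\<forall>e>0. \<exists>M. \<forall>n x. n \<ge> M \<and> x \<in> {0..S} \<longrightarrow> norm (P (k1 (k2 n)) x - Z x) < e)"
  proof (rule Arzela_Ascoli[of "{0..S}" "\<lambda>i. P (k1 i)" "2 * S"])
    show "norm (P (k1 i) s) \<le> 2 * S" if "s \<in> {0..S}" for i s
      using P_lip2[of "k1 i" s 0] P0[of "k1 i"] that by auto
    show "\<exists>d>0. \<forall>n y. y \<in> {0..S} \<and> norm (x - y) < d \<longrightarrow> norm (P (k1 n) x - P (k1 n) y) < e"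
      if "x \<in> {0..S}" "0 < e" for x e
    proof (intro exI[of _ "e / 2"] conjI allI impI)
      fix n y assume "y \<in> {0..S} \<and> norm (x - y) < e / 2"
      then show "norm (P (k1 n) x - P (k1 n) y) < e" using P_lip2[of "k1 n" x y] by simp
    qed (use that in simp)
  qed (auto simp del: real_norm_def)
  then obtain Z k2 where Zc: "continuous_on {0..S} Z" and k2: "strict_mono (k2 :: nat \<Rightarrow> nat)"
    and Zlim: "\<And>e. 0 < e \<Longrightarrow> \<exists>M. \<forall>n x. n \<ge> M \<and> x \<in> {0..S} \<longrightarrow> norm (P (k1 (k2 n)) x - Z x) < e"
    by auto
  define k where "k = k1 \<circ> k2"
  have k: "strict_mono k" unfolding k_def using k1(2) k2 strict_mono_o by blast
  have Ek: "(\<lambda>i. E (k i)) \<longlonglongrightarrow> \<sigma>"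
    using LIMSEQ_subseq_LIMSEQ[OF k1(3) k2] by (simp add: k_def o_def)
  have \<tau>k: "(\<lambda>i. \<tau> (k i)) \<longlonglongrightarrow> 0" using LIMSEQ_subseq_LIMSEQ[OF \<tau>(2) k] by (simp add: o_def)
  have \<delta>k: "(\<lambda>i. \<delta> (k i)) \<longlonglongrightarrow> 0" using LIMSEQ_subseq_LIMSEQ[OF \<delta>(2) k] by (simp add: o_def)
  have PZ: "(\<lambda>i. P (k i) (s i)) \<longlonglongrightarrow> Z t" if s: "\<And>i. 0 \<le> s i \<and> s i \<le> S" "s \<longlonglongrightarrow> t" for s t
  proof -
    have t: "t \<in> {0..S}" using s LIMSEQ_le_const[OF s(2)] LIMSEQ_le_const2[OF s(2)] by auto
    have "(\<lambda>i. P (k i) (s i) - Z (s i)) \<longlonglongrightarrow> 0"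
    proof (rule LIMSEQ_I)
      fix e :: real assume "e > 0"
      from Zlim[OF this] obtain M where "\<forall>n x. n \<ge> M \<and> x \<in> {0..S} \<longrightarrow> norm (P (k1 (k2 n)) x - Z x) < e" by blast
      then show "\<exists>M. \<forall>i\<ge>M. norm (P (k i) (s i) - Z (s i) - 0) < e" using s(1) by (auto simp: k_def)
    qed
    moreover have "(\<lambda>i. Z (s i)) \<longlonglongrightarrow> Z t"
      using continuous_on_tendsto_compose[OF Zc s(2) t] s(1) by auto
    ultimately have "(\<lambda>i. (P (k i) (s i) - Z (s i)) + Z (s i)) \<longlonglongrightarrow> 0 + Z t" by (rule tendsto_add)
    then show ?thesis by simp
  qed
  have PZ': "(\<lambda>i. P (k i) s) \<longlonglongrightarrow> Z s" if "0 \<le> s" "s \<le> S" for s using PZ[of "\<lambda>_. s" s] that by simp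
  have Z0: "Z 0 = 0" using PZ'[of 0] P0 S LIMSEQ_unique[OF PZ'[of 0], of 0] by simp
  have Zmono: "Z s \<le> Z t" if "0 \<le> s" "s \<le> t" "t \<le> S" for s t
    using that by (intro LIMSEQ_le[OF PZ' PZ']) (auto intro: P_mono)
  have Zlip: "Z t \<le> Z s + (t - s)" if "0 \<le> s" "s \<le> t" "t \<le> S" for s t
  proof -
    have "(\<lambda>i. P (k i) s + (t - s) / (1 - \<delta> (k i))) \<longlonglongrightarrow> Z s + (t - s) / (1 - 0)"
      using that by (intro tendsto_intros PZ' \<delta>k) auto
    then have "Z t \<le> Z s + (t - s) / (1 - 0)"
      using that by (intro LIMSEQ_le[OF PZ'[of t]]) (auto intro: P_lip)
    then show ?thesis by simp
  qed
  have linearized: "norm (u t - u s + (Z t - Z s) *\<^sub>R grad \<phi> (u s)) \<le> (Z t - Z s) * \<omega>"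
    if st: "0 \<le> s" "s < \<sigma>" "s \<le> t" "t \<le> \<sigma>"
      and \<omega>: "\<And>r. s \<le> r \<Longrightarrow> r \<le> t \<Longrightarrow> norm (grad \<phi> (u r) - grad \<phi> (u s)) \<le> \<omega>" for s t \<omega>
  proof (rule field_le_epsilon)
    fix e' :: real assume e': "e' > 0"
    have Zst: "0 \<le> Z t - Z s" using Zmono[of s t] st k1(1) by simp
    define e where "e = e' / (Z t - Z s + 1)"
    have e: "e > 0" using e' Zst by (simp add: e_def)
    have cu: "continuous_on {0..S} u" using GF_continuous[OF u] continuous_on_subset by fastforce
    have comp: "compact (u ` {0..S})" by (intro compact_continuous_image cu) auto
    obtain \<rho> where \<rho>: "\<rho> > 0" "\<forall>x\<in>u ` {0..S}. \<forall>y. dist y x \<le> \<rho> \<longrightarrow> norm (grad \<phi> y - grad \<phi> x) \<le> e"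
      using uniform_continuity_near_compact[OF comp cg e] by blast
    \<comment> \<open>For \<open>t = \<sigma>\<close> the chains need not cover the curve up to \<open>t\<close>, only up to times that converge to it.\<close>
    define ti where "ti i = max s (min t (E (k i)))" for i
    have ti: "s \<le> ti i" "ti i \<le> t" for i using st by (auto simp: ti_def)
    have "ti \<longlonglongrightarrow> max s (min t \<sigma>)" unfolding ti_def by (intro tendsto_intros Ek)
    then have ti_lim: "ti \<longlonglongrightarrow> t" using st by (simp add: max_def min_def)
    let ?n = "\<lambda>i r. real (LEAST n. r \<le> Q (k i) n) * \<tau> (k i)"
    have "\<forall>\<^sub>F i in sequentially. E (k i) > s" using order_tendstoD(1)[OF Ek st(2)] .
    moreover have "\<forall>\<^sub>F i in sequentially. \<delta> (k i) < \<rho>" using order_tendstoD(2)[OF \<delta>k \<rho>(1)] .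
    ultimately have ev: "\<forall>\<^sub>F i in sequentially. \<bar>?n i s - P (k i) s\<bar> \<le> \<tau> (k i) \<and> \<bar>?n i (ti i) - P (k i) (ti i)\<bar> \<le> \<tau> (k i) \<and>
      norm (u (ti i) - u s + (?n i (ti i) - ?n i s) *\<^sub>R grad \<phi> (u s)) \<le> 2 * \<delta> (k i) + (?n i (ti i) - ?n i s) * (\<delta> (k i) + e + \<omega>)"
    proof eventually_elim
      case (elim i)
      have sQ: "s \<le> Q (k i) (N (k i))" and tQ: "ti i \<le> Q (k i) (N (k i))" using elim st by (auto simp: ti_def E_def)
      have t0: "0 \<le> ti i" using ti(1)[of i] st by simp
      have "norm (u (ti i) - u s + (?n i (ti i) - ?n i s) *\<^sub>R grad \<phi> (u s)) \<le> 2 * \<delta> (k i) + (?n i (ti i) - ?n i s) * (\<delta> (k i) + e + \<omega>)"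
      proof (rule follows_linearization[OF fol \<delta>1 \<tau>(1) st(1) ti(1) tQ])
        show "norm (grad \<phi> (u r) - grad \<phi> (u s)) \<le> \<omega>" if "s \<le> r" "r \<le> ti i" for r
          using that ti(2)[of i] by (intro \<omega>) auto
        show "norm (grad \<phi> y - grad \<phi> (u r)) \<le> e" if "s \<le> r" "r \<le> ti i" "norm (y - u r) \<le> \<delta> (k i)" for r y
        proof -
          have "r \<in> {0..S}" using that ti(2)[of i] st k1(1) by auto
          moreover have "dist y (u r) \<le> \<rho>" using that elim by (simp add: dist_norm)
          ultimately show ?thesis using \<rho>(2) by blast
        qed
      qed
      then show ?case
        using follows_index(4,5)[OF fol[of "k i"] \<delta>1 \<tau>(1) st(1) sQ] follows_index(4,5)[OF fol[of "k i"] \<delta>1 \<tau>(1) t0 tQ]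
        unfolding P_def by auto
    qed
    have sS: "s \<le> S" "t \<le> S" "0 \<le> t" using st k1(1) by auto
    have ns: "(\<lambda>i. ?n i s) \<longlonglongrightarrow> Z s"
    proof (rule Lim_transform[OF PZ'[OF st(1) sS(1)]])
      show "(\<lambda>i. ?n i s - P (k i) s) \<longlonglongrightarrow> 0"
        by (rule Lim_null_comparison[OF _ \<tau>k]) (use ev in \<open>auto elim: eventually_mono\<close>)
    qed
    have tiS: "0 \<le> ti i \<and> ti i \<le> S" for i using ti[of i] sS st by linarith
    have nt: "(\<lambda>i. ?n i (ti i)) \<longlonglongrightarrow> Z t"
    proof (rule Lim_transform[OF PZ[OF tiS ti_lim]])
      show "(\<lambda>i. ?n i (ti i) - P (k i) (ti i)) \<longlonglongrightarrow> 0"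
        by (rule Lim_null_comparison[OF _ \<tau>k]) (use ev in \<open>auto elim: eventually_mono\<close>)
    qed
    have uti: "(\<lambda>i. u (ti i)) \<longlonglongrightarrow> u t"
      using continuous_on_tendsto_compose[OF cu ti_lim] sS tiS by auto
    have "norm (u t - u s + (Z t - Z s) *\<^sub>R grad \<phi> (u s)) \<le> 2 * 0 + (Z t - Z s) * (0 + e + \<omega>)"
    proof (rule tendsto_le[OF sequentially_bot])
      show "(\<lambda>i. 2 * \<delta> (k i) + (?n i (ti i) - ?n i s) * (\<delta> (k i) + e + \<omega>)) \<longlonglongrightarrow> 2 * 0 + (Z t - Z s) * (0 + e + \<omega>)"
        by (intro tendsto_intros ns nt \<delta>k)
      show "(\<lambda>i. norm (u (ti i) - u s + (?n i (ti i) - ?n i s) *\<^sub>R grad \<phi> (u s))) \<longlonglongrightarrow> norm (u t - u s + (Z t - Z s) *\<^sub>R grad \<phi> (u s))"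
        by (intro tendsto_intros ns nt uti)
    qed (use ev in \<open>auto elim: eventually_mono\<close>)
    also have "\<dots> = (Z t - Z s) * \<omega> + (Z t - Z s) * e" by (simp add: algebra_simps)
    also have "(Z t - Z s) * e \<le> e'" using Zst e' by (simp add: e_def field_simps)
    finally show "norm (u t - u s + (Z t - Z s) *\<^sub>R grad \<phi> (u s)) \<le> (Z t - Z s) * \<omega> + e'" by simp
  qed
  define Y where "Y s = (if s \<le> \<sigma> then Z s else Z \<sigma> + (s - \<sigma>))" for s
  have \<sigma>: "0 \<le> \<sigma>" "\<sigma> \<le> S" using k1(1) by auto
  have Z\<sigma>: "0 \<le> Z \<sigma>" "Z \<sigma> \<le> \<sigma>" using Zmono[of 0 \<sigma>] Zlip[of 0 \<sigma>] Z0 \<sigma> by auto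
  have Y: "0 \<le> Y t - Y s \<and> Y t - Y s \<le> t - s" if "0 \<le> s" "s \<le> t" for s t
  proof -
    consider "t \<le> \<sigma>" | "s \<le> \<sigma>" "\<sigma> < t" | "\<sigma> < s" by linarith
    then show ?thesis
    proof cases
      case 1
      then show ?thesis using Zmono[of s t] Zlip[of s t] that \<sigma> by (simp add: Y_def)
    next
      case 2
      then show ?thesis using Zmono[of s \<sigma>] Zlip[of s \<sigma>] that \<sigma> by (simp add: Y_def)
    next
      case 3
      then show ?thesis using that by (simp add: Y_def)
    qed
  qed
  have linearized_all: "norm (u t - u s + (Y t - Y s) *\<^sub>R grad \<phi> (u s)) \<le> (Y t - Y s) * \<omega>"
    if st: "0 \<le> s" "s \<le> t" and \<omega>: "\<And>r. s \<le> r \<Longrightarrow> r \<le> t \<Longrightarrow> norm (grad \<phi> (u r) - grad \<phi> (u s)) \<le> \<omega>" for s t \<omega>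
  proof -
    consider "t \<le> \<sigma>" "s < \<sigma>" | "s < \<sigma>" "\<sigma> < t" | "\<sigma> \<le> s" by linarith
    then show ?thesis
    proof cases
      case 1
      then show ?thesis using linearized[OF st(1) 1(2) st(2) 1(1) \<omega>] st by (simp add: Y_def)
    next
      case 2
      have a: "norm (u \<sigma> - u s + (Z \<sigma> - Z s) *\<^sub>R grad \<phi> (u s)) \<le> (Z \<sigma> - Z s) * \<omega>"
        using 2 by (intro linearized st \<omega>) auto
      have b: "norm (u t - u \<sigma> + (t - \<sigma>) *\<^sub>R grad \<phi> (u s)) \<le> (t - \<sigma>) * \<omega>"
        using 2 st by (intro GF_linearization[OF u \<sigma>(1)] \<omega>) auto
      have eq: "u t - u s + (Y t - Y s) *\<^sub>R grad \<phi> (u s) =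
         (u \<sigma> - u s + (Z \<sigma> - Z s) *\<^sub>R grad \<phi> (u s)) + (u t - u \<sigma> + (t - \<sigma>) *\<^sub>R grad \<phi> (u s))"
        using 2 by (simp add: Y_def algebra_simps)
      have "(Z \<sigma> - Z s) * \<omega> + (t - \<sigma>) * \<omega> = (Y t - Y s) * \<omega>" using 2 by (simp add: Y_def algebra_simps)
      then show ?thesis unfolding eq using norm_triangle_mono[OF a b] by simp
    next
      case 3
      have "Y t - Y s = t - s"
      proof (cases "t \<le> \<sigma>")
        case True
        then have "s = t" using 3 st by simp
        then show ?thesis by simp
      next
        case False
        then show ?thesis using 3 by (cases "s = \<sigma>") (auto simp: Y_def)
      qed
      then show ?thesis using GF_linearization[OF u st \<omega>] by simp
    qed
  qed
  have Y0: "Y 0 = 0" using Z0 \<sigma> by (simp add: Y_def)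
  have unbdd: "\<exists>s\<ge>0. X \<le> Y s" for X
    using \<sigma> Z\<sigma> by (intro exI[of _ "\<sigma> + \<bar>X\<bar> + 1"]) (auto simp: Y_def)
  have "\<exists>v\<in>GF \<phi>. (\<forall>t\<ge>0. u t = v (Y t)) \<and> curve_range v \<subseteq> curve_range u"
    by (rule reparametrized_gradient_flow[OF C1 u Y0 Y unbdd linearized_all])
  then obtain v where v: "v \<in> GF \<phi>" "\<forall>t\<ge>0. u t = v (Y t)" "curve_range v \<subseteq> curve_range u"
    by blast
  have Ypos: "0 \<le> Y t" if "0 \<le> t" for t using Y[of 0 t] Y0 that by simp
  have "u \<succ> v"
    unfolding dominates_def
  proof (intro conjI exI[of _ Y] allI impI)
    show "curve_range v \<subseteq> closure (curve_range u)" using v(3) closure_subset by blast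
  qed (use Y Y0 v(2) Ypos in auto)
  then have uv: "u t = v t" if "0 \<le> t" for t using umin v(1) that by (auto simp: GF_min_def)
  have uY: "u t = u (Y t)" if "0 \<le> t" for t using v(2) uv[OF Ypos[OF that]] that by simp
  show thesis
  proof (rule that[of k \<sigma> "Z \<sigma>"])
    show "strict_mono k" "0 \<le> \<sigma>" "\<sigma> \<le> S" "0 \<le> Z \<sigma>" "Z \<sigma> \<le> \<sigma>" by fact+
    show "(\<lambda>i. min (Q (k i) (N (k i))) S) \<longlonglongrightarrow> \<sigma>" using Ek by (simp add: E_def)
    show "(\<lambda>i. passage (\<delta> (k i)) (\<tau> (k i)) (N (k i)) (Q (k i)) (s i)) \<longlonglongrightarrow> Z \<sigma>"
      if "\<And>i. 0 \<le> s i \<and> s i \<le> S" "s \<longlonglongrightarrow> \<sigma>" for s using PZ[OF that] by (simp add: P_def)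
    show "u \<sigma> = u (Z \<sigma>)" using uY[OF \<sigma>(1)] by (simp add: Y_def)
    assume c: "Z \<sigma> < \<sigma>"
    have per: "u s = u (s - (\<sigma> - Z \<sigma>))" if "s \<ge> Z \<sigma> + (\<sigma> - Z \<sigma>)" for s
    proof -
      have "Y s = s - (\<sigma> - Z \<sigma>)" using that by (auto simp: Y_def)
      then show ?thesis using uY[of s] that \<sigma> by simp
    qed
    have c0: "\<sigma> - Z \<sigma> > 0" using c by simp
    show "(\<forall>s\<ge>Z \<sigma>. u s = u (Z \<sigma>)) \<and> grad \<phi> (u (Z \<sigma>)) = 0"
    proof (intro conjI allI impI)
      show "u s = u (Z \<sigma>)" if "Z \<sigma> \<le> s" for s
        by (rule GF_periodic_constant(1)[OF C1 u c0 Z\<sigma>(1)]) (fact per, fact that)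
      show "grad \<phi> (u (Z \<sigma>)) = 0"
        by (rule GF_periodic_constant(2)[OF C1 u c0 Z\<sigma>(1)]) (fact per)
    qed
  qed
qed

lemma follows_end:
  assumes f: "follows \<phi> u \<delta> \<tau> U N Q" and \<delta>: "\<delta> < 1" and \<tau>: "\<tau> > 0"
  shows "(LEAST n. Q N \<le> Q n) = N" "0 \<le> Q N"
proof -
  have pos: "0 < (1 - \<delta>) * \<tau>" using \<delta> \<tau> by simp
  have "N \<le> n" if "Q N \<le> Q n" for n
  proof (rule ccontr)
    assume "\<not> N \<le> n"
    then have n: "n \<le> N" "0 < real (N - n)" by auto
    have "Q n + real (N - n) * ((1 - \<delta>) * \<tau>) \<le> Q N" by (rule follows_growth[OF f n(1)]) simp
    then show False using that mult_pos_pos[OF n(2) pos] by linarith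
  qed
  then show "(LEAST n. Q N \<le> Q n) = N" by (intro Least_equality) auto
  have "Q 0 + real (N - 0) * ((1 - \<delta>) * \<tau>) \<le> Q N" by (rule follows_growth[OF f]) auto
  moreover have "0 \<le> real (N - 0) * ((1 - \<delta>) * \<tau>)" using \<delta> \<tau> by simp
  ultimately show "0 \<le> Q N" using f by (simp add: follows_def)
qed

lemma chain_prefix: "chain \<tau> \<psi> U m \<Longrightarrow> n \<le> m \<Longrightarrow> chain \<tau> \<psi> U n"
  by (simp add: chain_def)

section \<open>From chains to strong approximability\<close>

text \<open>
  From a sequence of counterexamples pass to the limit with \<open>S = T0 + 1\<close>.  If the chains stop before
  they have covered the curve up to \<open>S\<close>, then they have not met the end of the arc, so they can be
  continued, and the time at which they stop converges to \<open>Z\<close>, where \<open>u\<close> has the right value.  Otherwise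
  they covered the curve up to \<open>S\<close> within the time \<open>T0 < S\<close>; then \<open>u\<close> is constant from \<open>Z\<close> on, its
  value there is critical, and every alternative leaves the chains near it.
\<close>
theorem uniform_tracking:
  fixes \<phi> :: "'a::{real_inner,banach} \<Rightarrow> real"
  assumes C1: "C1 \<phi>" and umin: "u \<in> GF_min \<phi>" and T: "\<And>j. real j \<le> T j"
    and track: "\<And>J. \<forall>\<^sub>F \<tau> in at_right 0. \<exists>j\<ge>J. tracks \<phi> u (T j) (1 / (real j + 2)) \<tau> (\<Phi> \<tau>)"
    and T0: "T0 \<ge> 0" and \<eta>: "\<eta> > 0"
  shows "\<forall>\<^sub>F \<tau> in at_right 0. \<forall>U m. U 0 = u 0 \<and> chain \<tau> (\<Phi> \<tau>) U m \<and> real m * \<tau> \<le> T0 \<longrightarrow>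
      norm (U m - u (real m * \<tau>)) \<le> \<eta> \<and> (\<exists>V. MS_step \<tau> (\<Phi> \<tau>) (U m) V)"
proof (rule ccontr)
  assume "\<not> ?thesis"
  then have freq: "\<exists>\<^sub>F \<tau> in at_right 0. \<exists>U m. U 0 = u 0 \<and> chain \<tau> (\<Phi> \<tau>) U m \<and> real m * \<tau> \<le> T0 \<and>
      \<not> (norm (U m - u (real m * \<tau>)) \<le> \<eta> \<and> (\<exists>V. MS_step \<tau> (\<Phi> \<tau>) (U m) V))"
    by (simp add: not_eventually) 
  have u: "u \<in> GF \<phi>" using umin by (simp add: GF_min_def)
  have cu: "continuous_on {0..} u" by (rule GF_continuous[OF u])
  define S where "S = T0 + 1"
  have S: "S > 0" using T0 by (simp add: S_def)
  have "\<exists>\<tau> j U m N Q e. \<tau> > 0 \<and> \<tau> < inverse (real (Suc i)) \<and> i \<le> j \<and> real m * \<tau> \<le> T0 \<and> N \<le> m \<and>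
      follows \<phi> u (1 / (real j + 2)) \<tau> U N Q \<and> \<not> (norm (U m - u (real m * \<tau>)) \<le> \<eta> \<and> e) \<and>
      (N = m \<and> e \<or> T j - 1 / (real j + 2) \<le> Q N \<and> (grad \<phi> (u (T j)) = 0 \<longrightarrow> norm (U m - u (T j)) \<le> 1 / (real j + 2) \<and> e))" for i :: nat
  proof -
    have "\<forall>\<^sub>F \<tau> in at_right (0::real). \<tau> < inverse (real (Suc i))"
      by (intro order_tendstoD(2)[OF tendsto_ident_at]) simp
    then have "\<forall>\<^sub>F \<tau> in at_right 0. \<tau> > 0 \<and> \<tau> < inverse (real (Suc i)) \<and> (\<exists>j\<ge>i. tracks \<phi> u (T j) (1 / (real j + 2)) \<tau> (\<Phi> \<tau>))"
      by (intro eventually_conj eventually_pos_at_right_0 track)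
    from frequently_ex[OF frequently_eventually_frequently[OF freq this]]
    obtain \<tau> U m j where a: "U 0 = u 0" "chain \<tau> (\<Phi> \<tau>) U m" "real m * \<tau> \<le> T0"
      "\<not> (norm (U m - u (real m * \<tau>)) \<le> \<eta> \<and> (\<exists>V. MS_step \<tau> (\<Phi> \<tau>) (U m) V))"
      "\<tau> > 0" "\<tau> < inverse (real (Suc i))" "i \<le> j" "tracks \<phi> u (T j) (1 / (real j + 2)) \<tau> (\<Phi> \<tau>)"
      by (elim exE conjE)
    from a(8)[unfolded tracks_def, rule_format, OF conjI[OF a(1,2)]]
    obtain N Q where "N \<le> m" "follows \<phi> u (1 / (real j + 2)) \<tau> U N Q"
      "N = m \<and> (\<exists>V. MS_step \<tau> (\<Phi> \<tau>) (U m) V) \<or> T j - 1 / (real j + 2) \<le> Q N \<and>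
       (grad \<phi> (u (T j)) = 0 \<longrightarrow> norm (U m - u (T j)) \<le> 1 / (real j + 2) \<and> (\<exists>V. MS_step \<tau> (\<Phi> \<tau>) (U m) V))"
      by (elim exE conjE)
    with a show ?thesis by blast
  qed
  then have "\<forall>i. \<exists>\<tau> j U m N Q e. \<tau> > 0 \<and> \<tau> < inverse (real (Suc i)) \<and> i \<le> j \<and> real m * \<tau> \<le> T0 \<and> N \<le> m \<and>
      follows \<phi> u (1 / (real j + 2)) \<tau> U N Q \<and> \<not> (norm (U m - u (real m * \<tau>)) \<le> \<eta> \<and> e) \<and>
      (N = m \<and> e \<or> T j - 1 / (real j + 2) \<le> Q N \<and> (grad \<phi> (u (T j)) = 0 \<longrightarrow> norm (U m - u (T j)) \<le> 1 / (real j + 2) \<and> e))"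
    by blast
  then obtain \<tau> j U m N Q e where H: "\<forall>i. \<tau> i > 0 \<and> \<tau> i < inverse (real (Suc i)) \<and> i \<le> j i \<and> real (m i) * \<tau> i \<le> T0 \<and> N i \<le> m i \<and>
      follows \<phi> u (1 / (real (j i) + 2)) (\<tau> i) (U i) (N i) (Q i) \<and> \<not> (norm (U i (m i) - u (real (m i) * \<tau> i)) \<le> \<eta> \<and> e i) \<and>
      (N i = m i \<and> e i \<or> T (j i) - 1 / (real (j i) + 2) \<le> Q i (N i) \<and>
        (grad \<phi> (u (T (j i))) = 0 \<longrightarrow> norm (U i (m i) - u (T (j i))) \<le> 1 / (real (j i) + 2) \<and> e i))"
    unfolding choice_iff by (elim exE)
  define \<delta> where "\<delta> i = 1 / (real (j i) + 2)" for i
  have \<tau>: "\<tau> i > 0" and \<tau>': "\<tau> i < inverse (real (Suc i))" and ij: "i \<le> j i" and mT: "real (m i) * \<tau> i \<le> T0"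
    and Nm: "N i \<le> m i" and fol: "follows \<phi> u (\<delta> i) (\<tau> i) (U i) (N i) (Q i)"
    and bad: "\<not> (norm (U i (m i) - u (real (m i) * \<tau> i)) \<le> \<eta> \<and> e i)"
    and alt: "N i = m i \<and> e i \<or> T (j i) - \<delta> i \<le> Q i (N i) \<and>
        (grad \<phi> (u (T (j i))) = 0 \<longrightarrow> norm (U i (m i) - u (T (j i))) \<le> \<delta> i \<and> e i)" for i
    using H[rule_format, of i] by (auto simp: \<delta>_def)
  have \<tau>0: "\<tau> \<longlonglongrightarrow> 0"
    by (rule Lim_null_comparison[OF _ LIMSEQ_inverse_real_of_nat]) (use \<tau> \<tau>' in \<open>auto simp: less_imp_le intro!: always_eventually\<close>)
  have \<delta>0: "\<delta> \<longlonglongrightarrow> 0"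
  proof (rule Lim_null_comparison[OF _ LIMSEQ_inverse_real_of_nat])
    have "norm (\<delta> i) \<le> inverse (real (Suc i))" for i
      using ij[of i] unfolding \<delta>_def inverse_eq_divide by (simp add: frac_le)
    then show "\<forall>\<^sub>F i in sequentially. norm (\<delta> i) \<le> inverse (real (Suc i))" by simp
  qed
  have \<delta>: "\<delta> i \<le> 1 / 2" "0 \<le> \<delta> i" "\<delta> i < 1" for i by (auto simp: \<delta>_def field_simps)
  obtain k Z \<sigma> where k: "strict_mono (k :: nat \<Rightarrow> nat)" and \<sigma>: "0 \<le> \<sigma>" "\<sigma> \<le> S"
    and lim: "(\<lambda>i. min (Q (k i) (N (k i))) S) \<longlonglongrightarrow> \<sigma>"
    and pas: "\<And>s. (\<And>i. 0 \<le> s i \<and> s i \<le> S) \<Longrightarrow> s \<longlonglongrightarrow> \<sigma> \<Longrightarrow> (\<lambda>i. passage (\<delta> (k i)) (\<tau> (k i)) (N (k i)) (Q (k i)) (s i)) \<longlonglongrightarrow> Z"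
    and Z: "0 \<le> Z" "Z \<le> \<sigma>" "u \<sigma> = u Z"
    and const: "Z < \<sigma> \<Longrightarrow> (\<forall>s\<ge>Z. u s = u Z) \<and> grad \<phi> (u Z) = 0"
    by (rule limit_of_followers[OF C1 umin S fol \<tau> \<tau>0 \<delta>(1) \<delta>0]) blast
  define s where "s i = min (Q (k i) (N (k i))) S" for i
  define t where "t i = real (m (k i)) * \<tau> (k i)" for i
  note end_N = follows_end[OF fol \<delta>(3) \<tau>]
  have s: "0 \<le> s i \<and> s i \<le> S" for i using end_N(2)[of "k i"] S by (auto simp: s_def)
  have s_lim: "s \<longlonglongrightarrow> \<sigma>" using lim unfolding s_def[abs_def] .
  have near_Q: "norm (U i (N i) - u (Q i (N i))) \<le> \<delta> i" for i
    using follows_index(3)[OF fol \<delta>(3) \<tau>, of "Q i (N i)" i] end_N by simp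
  define p where "p i = passage (\<delta> (k i)) (\<tau> (k i)) (N (k i)) (Q (k i)) (s i)" for i
  have p: "p \<longlonglongrightarrow> Z" unfolding p_def by (rule pas[OF s s_lim])
  have p_le: "p i \<le> t i" for i
  proof -
    let ?n = "LEAST n. s i \<le> Q (k i) n"
    have n: "?n \<le> N (k i)" "p i \<le> real ?n * \<tau> (k i)"
      using follows_index(1,5)[OF fol[of "k i"] \<delta>(3) \<tau>, of "s i"] s[of i] by (auto simp: s_def p_def)
    have "real ?n * \<tau> (k i) \<le> t i"
      unfolding t_def using n(1) Nm[of "k i"] \<tau>[of "k i"] by (intro mult_right_mono) auto
    then show ?thesis using n(2) by linarith
  qed
  have t0: "0 \<le> t i" for i using \<tau>[of "k i"] by (simp add: t_def)
  have \<delta>k: "(\<lambda>i. \<delta> (k i)) \<longlonglongrightarrow> 0" using LIMSEQ_subseq_LIMSEQ[OF \<delta>0 k] by (simp add: o_def)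
  have \<tau>k: "(\<lambda>i. \<tau> (k i)) \<longlonglongrightarrow> 0" using LIMSEQ_subseq_LIMSEQ[OF \<tau>0 k] by (simp add: o_def)
  have T_large: "\<forall>\<^sub>F i in sequentially. X + 1 \<le> T (j (k i))" for X
  proof -
    have "\<forall>\<^sub>F i in sequentially. X + 1 \<le> real i"
      using filterlim_real_sequentially by (simp add: filterlim_at_top)
    then show ?thesis
    proof eventually_elim
      case (elim i)
      have "real i \<le> real (j (k i))" using ij[of "k i"] seq_suble[OF k, of i] by simp
      then show ?case using elim T[of "j (k i)"] by linarith
    qed
  qed
  have "\<forall>\<^sub>F i in sequentially. norm (U (k i) (m (k i)) - u (t i)) \<le> \<eta> \<and> e (k i)"
  proof (cases "\<sigma> < S")
    case True
    have "\<forall>\<^sub>F i in sequentially. s i < S" by (rule order_tendstoD(2)[OF s_lim True])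
    with T_large[of S] have ev: "\<forall>\<^sub>F i in sequentially. N (k i) = m (k i) \<and> e (k i) \<and> s i = Q (k i) (N (k i))"
    proof eventually_elim
      case (elim i)
      then have "Q (k i) (N (k i)) < S" by (simp add: s_def)
      then show ?case using alt[of "k i"] elim \<delta>(3)[of "k i"] by (auto simp: s_def)
    qed
    have t_lim: "t \<longlonglongrightarrow> Z"
    proof (rule Lim_transform[OF p])
      show "(\<lambda>i. t i - p i) \<longlonglongrightarrow> 0"
      proof (rule Lim_null_comparison[OF _ \<tau>k])
        show "\<forall>\<^sub>F i in sequentially. norm (t i - p i) \<le> \<tau> (k i)"
          using ev
        proof eventually_elim
          case (elim i)
          have "t i - \<tau> (k i) \<le> p i"
            using follows_index(4)[OF fol \<delta>(3) \<tau>, of "Q (k i) (N (k i))" "k i"] end_N[of "k i"] elim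
            by (simp add: t_def p_def)
          then show ?case using p_le[of i] by simp
        qed
      qed
    qed
    have ut: "(\<lambda>i. u (t i)) \<longlonglongrightarrow> u \<sigma>"
      using continuous_on_tendsto_compose[OF cu t_lim] Z t0 by simp
    have us: "(\<lambda>i. u (s i)) \<longlonglongrightarrow> u \<sigma>"
      using continuous_on_tendsto_compose[OF cu s_lim] \<sigma> s by simp
    have "(\<lambda>i. \<delta> (k i) + norm (u (s i) - u (t i))) \<longlonglongrightarrow> 0 + norm (u \<sigma> - u \<sigma>)"
      by (intro tendsto_intros \<delta>k ut us)
    then have "\<forall>\<^sub>F i in sequentially. \<delta> (k i) + norm (u (s i) - u (t i)) < \<eta>"
      using \<eta> by (intro order_tendstoD(2)) auto
    with ev show ?thesis
    proof eventually_elim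
      case (elim i)
      then show ?case
        using near_Q[of "k i"] norm_triangle_ineq[of "U (k i) (m (k i)) - u (s i)" "u (s i) - u (t i)"] by simp
    qed
  next
    case False
    then have \<sigma>S: "\<sigma> = S" using \<sigma> by simp
    have "Z \<le> T0" using p_le mT by (intro LIMSEQ_le_const2[OF p]) (auto simp: t_def intro: order_trans)
    then have Z\<sigma>: "Z < \<sigma>" using \<sigma>S by (simp add: S_def)
    have con: "u r = u Z" if "r \<ge> Z" for r using const[OF Z\<sigma>] that by blast
    have gZ: "grad \<phi> (u Z) = 0" using const[OF Z\<sigma>] by blast
    have "(\<lambda>i. min (t i) Z) \<longlonglongrightarrow> Z"
    proof (rule tendsto_sandwich[of "\<lambda>i. min (p i) Z" _ _ "\<lambda>_. Z"])
      show "(\<lambda>i. min (p i) Z) \<longlonglongrightarrow> Z" using tendsto_min[OF p tendsto_const, of Z] by simp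
      show "\<forall>\<^sub>F i in sequentially. min (p i) Z \<le> min (t i) Z" using p_le by (intro always_eventually allI min.mono) auto
    qed (auto intro: always_eventually)
    then have "(\<lambda>i. u (min (t i) Z)) \<longlonglongrightarrow> u Z"
      by (rule continuous_on_tendsto_compose[OF cu]) (use Z t0 in auto)
    then have "(\<lambda>i. \<delta> (k i) + norm (u (min (t i) Z) - u Z)) \<longlonglongrightarrow> 0 + norm (u Z - u Z)"
      by (intro tendsto_intros \<delta>k)
    then have "\<forall>\<^sub>F i in sequentially. \<delta> (k i) + norm (u (min (t i) Z) - u Z) < \<eta>"
      using \<eta> by (intro order_tendstoD(2)) auto
    moreover have "\<forall>\<^sub>F i in sequentially. s i > Z" by (rule order_tendstoD(1)[OF s_lim Z\<sigma>])
    ultimately show ?thesis using T_large[of Z]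
    proof eventually_elim
      case (elim i)
      have "norm (u (t i) - u Z) \<le> norm (u (min (t i) Z) - u Z)"
        using con[of "t i"] by (cases "t i \<le> Z") (auto simp: min_def)
      moreover have "norm (U (k i) (m (k i)) - u Z) \<le> \<delta> (k i) \<and> e (k i)"
        using alt[of "k i"]
      proof
        assume "N (k i) = m (k i) \<and> e (k i)"
        moreover have "u (Q (k i) (N (k i))) = u Z" using elim by (intro con) (simp add: s_def)
        ultimately show ?thesis using near_Q[of "k i"] by simp
      next
        have uT: "u (T (j (k i))) = u Z" using elim by (intro con) simp
        assume "T (j (k i)) - \<delta> (k i) \<le> Q (k i) (N (k i)) \<and>
          (grad \<phi> (u (T (j (k i)))) = 0 \<longrightarrow> norm (U (k i) (m (k i)) - u (T (j (k i)))) \<le> \<delta> (k i) \<and> e (k i))"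
        then show ?thesis unfolding uT using gZ by blast
      qed
      ultimately show ?case
        using elim norm_triangle_ineq4[of "U (k i) (m (k i)) - u Z" "u (t i) - u Z"] by simp
    qed
  qed
  then have "\<exists>i. norm (U (k i) (m (k i)) - u (t i)) \<le> \<eta> \<and> e (k i)"
    using eventually_happens'[OF sequentially_bot] by blast
  then show False using bad by (auto simp: t_def)
qed

text \<open>
  For given \<open>\<tau>\<close> take the largest \<open>j \<le> 1/\<tau>\<close> for which a parameter exists.
\<close>
lemma diagonal_choice:
  fixes A :: "nat \<Rightarrow> real \<Rightarrow> 'b \<Rightarrow> bool"
  assumes "\<And>j. \<forall>\<^sub>F \<tau> in at_right 0. \<exists>p. A j \<tau> p"
  shows "\<exists>\<Phi>. \<forall>J. \<forall>\<^sub>F \<tau> in at_right 0. \<exists>j\<ge>J. A j \<tau> (\<Phi> \<tau>)"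
proof -
  define I where "I \<tau> = {j. real j * \<tau> \<le> 1 \<and> (\<exists>p. A j \<tau> p)}" for \<tau>
  define \<Phi> where "\<Phi> \<tau> = (SOME p. A (Max (I \<tau>)) \<tau> p)" for \<tau>
  have "\<forall>\<^sub>F \<tau> in at_right 0. \<exists>j\<ge>J. A j \<tau> (\<Phi> \<tau>)" for J
    using assms[of J] eventually_pos_at_right_0 eventually_mult_le_at_right_0[OF zero_less_one, of "real J"]
  proof eventually_elim
    case (elim \<tau>)
    then have J: "J \<in> I \<tau>" by (simp add: I_def)
    have "j \<le> nat \<lceil>1 / \<tau>\<rceil>" if "j \<in> I \<tau>" for j
    proof -
      have "real j \<le> 1 / \<tau>" using that elim by (simp add: I_def field_simps)
      then show ?thesis by linarith
    qed
    then have fin: "finite (I \<tau>)" by (intro finite_subset[of "I \<tau>" "{..nat \<lceil>1 / \<tau>\<rceil>}"]) auto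
    have ex: "\<exists>p. A j \<tau> p" if "j \<in> I \<tau>" for j using that by (simp add: I_def)
    have "Max (I \<tau>) \<in> I \<tau>" using fin J by (intro Max_in) auto
    from someI_ex[OF ex[OF this]] have "A (Max (I \<tau>)) \<tau> (\<Phi> \<tau>)" unfolding \<Phi>_def .
    then show ?case using Max_ge[OF fin J] by blast
  qed
  then show ?thesis by blast
qed

lemma tendsto_ennreal_0I:
  assumes "\<And>e::real. e > 0 \<Longrightarrow> \<forall>\<^sub>F x in F. f x \<le> ennreal e"
  shows "(f \<longlongrightarrow> 0) F"
proof (rule order_tendstoI)
  fix a :: ennreal assume "0 < a"
  then obtain b where b: "0 < b" "b < a" using dense by blast
  then obtain e where e: "b = ennreal e" "e \<ge> 0" by (cases b) auto
  then have "e > 0" using b by (cases "e = 0") auto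
  from assms[OF this] show "\<forall>\<^sub>F x in F. f x < a"
    by (rule eventually_mono) (use b e in \<open>auto intro: le_less_trans\<close>)
qed simp

lemma step_index:
  fixes t \<tau> :: real
  assumes "\<tau> > 0" "t > 0"
  shows "1 \<le> nat \<lceil>t / \<tau>\<rceil>" "(real (nat \<lceil>t / \<tau>\<rceil>) - 1) * \<tau> < t" "t \<le> real (nat \<lceil>t / \<tau>\<rceil>) * \<tau>"
    and "(real n - 1) * \<tau> < t \<Longrightarrow> t \<le> real n * \<tau> \<Longrightarrow> nat \<lceil>t / \<tau>\<rceil> = n"
proof -
  have pos: "t / \<tau> > 0" using assms by simp
  then have c: "\<lceil>t / \<tau>\<rceil> \<ge> 1" by linarith
  then have r: "real (nat \<lceil>t / \<tau>\<rceil>) = of_int \<lceil>t / \<tau>\<rceil>" by simp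
  show "1 \<le> nat \<lceil>t / \<tau>\<rceil>" using c by linarith
  have "of_int \<lceil>t / \<tau>\<rceil> - 1 < t / \<tau>" "t / \<tau> \<le> of_int \<lceil>t / \<tau>\<rceil>" by linarith+
  then show "(real (nat \<lceil>t / \<tau>\<rceil>) - 1) * \<tau> < t" "t \<le> real (nat \<lceil>t / \<tau>\<rceil>) * \<tau>"
    unfolding r by (simp_all only: pos_less_divide_eq[OF assms(1)] pos_divide_le_eq[OF assms(1)])
  assume "(real n - 1) * \<tau> < t" "t \<le> real n * \<tau>"
  then have "real n - 1 < t / \<tau>" "t / \<tau> \<le> real n" using assms(1) by (auto simp: pos_less_divide_eq pos_divide_le_eq)
  then have "\<lceil>t / \<tau>\<rceil> = int n" by (intro ceiling_unique) auto
  then show "nat \<lceil>t / \<tau>\<rceil> = n" by simp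
qed

lemma num_steps:
  assumes "\<tau> > 0" "T > 0" shows "T \<le> real (num_steps \<tau> T) * \<tau>" "real (num_steps \<tau> T) * \<tau> < T + \<tau>"
proof -
  have "T \<le> real (nat \<lceil>T / \<tau>\<rceil>) * \<tau>" by (rule step_index(3)[OF assms])
  then show "T \<le> real (num_steps \<tau> T) * \<tau>" unfolding num_steps_def by (rule LeastI)
  have "num_steps \<tau> T \<le> nat \<lceil>T / \<tau>\<rceil>" unfolding num_steps_def by (rule Least_le) (rule step_index(3)[OF assms])
  then have "real (num_steps \<tau> T) * \<tau> \<le> real (nat \<lceil>T / \<tau>\<rceil>) * \<tau>" using assms by (intro mult_right_mono of_nat_mono) auto
  then show "real (num_steps \<tau> T) * \<tau> < T + \<tau>" using step_index(2)[OF assms] by (simp add: algebra_simps)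
qed

lemma MM_on_interpolation:
  assumes \<tau>: "\<tau> > 0" and U: "U 0 = u0" "chain \<tau> \<psi> U (num_steps \<tau> T)"
  shows "(\<lambda>t. U (nat \<lceil>t / \<tau>\<rceil>)) \<in> MM_on \<tau> \<psi> u0 T"
  unfolding MM_on_def
proof (intro CollectI exI[of _ U] conjI ballI)
  show "MS_step \<tau> \<psi> (U (n - 1)) (U n)" if "n \<in> {1..num_steps \<tau> T}" for n
    using U(2) that by (cases n) (auto simp: chain_def)
  show "U (nat \<lceil>t / \<tau>\<rceil>) = U n"
    if "n \<in> {1..num_steps \<tau> T}" "t \<in> {(real n - 1) * \<tau><..real n * \<tau>} \<inter> {0..T}" for n t
  proof -
    have "0 \<le> (real n - 1) * \<tau>" using that \<tau> by simp
    then have "t > 0" using that by auto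
    then show ?thesis using step_index(4)[OF \<tau>, of t n] that by simp
  qed
qed (use U in auto)

lemma MM_on_chain:
  assumes w: "w \<in> MM_on \<tau> \<psi> u0 T" and \<tau>: "\<tau> > 0" and T: "T > 0"
  obtains U where "U 0 = u0" "w 0 = u0" "chain \<tau> \<psi> U (num_steps \<tau> T)"
    "\<And>t. 0 < t \<Longrightarrow> t \<le> T \<Longrightarrow> nat \<lceil>t / \<tau>\<rceil> \<le> num_steps \<tau> T \<and> w t = U (nat \<lceil>t / \<tau>\<rceil>)"
proof -
  let ?N = "num_steps \<tau> T"
  obtain U where U: "U 0 = u0" "w 0 = u0" and st: "\<And>n. n \<in> {1..?N} \<Longrightarrow> MS_step \<tau> \<psi> (U (n - 1)) (U n)"
    and wU: "\<And>n t. n \<in> {1..?N} \<Longrightarrow> t \<in> {(real n - 1) * \<tau><..real n * \<tau>} \<inter> {0..T} \<Longrightarrow> w t = U n"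
    using w unfolding MM_on_def by blast
  show thesis
  proof (rule that[of U, OF U])
    show "chain \<tau> \<psi> U ?N" using st[of "Suc n" for n] by (simp add: chain_def)
    fix t assume t: "0 < t" "t \<le> T"
    let ?n = "nat \<lceil>t / \<tau>\<rceil>"
    note I = step_index(1-3)[OF \<tau> t(1)]
    have "t \<le> real ?N * \<tau>" using t(2) num_steps(1)[OF \<tau> T] by linarith
    with I(2) have "(real ?n - 1) * \<tau> < real ?N * \<tau>" by (rule less_le_trans)
    then have "real ?n - 1 < real ?N" using \<tau> mult_less_cancel_right_pos by blast
    then have "?n \<le> ?N" by linarith
    then show "?n \<le> ?N \<and> w t = U ?n" using I t wU[of ?n t] by auto
  qed
qed

lemma MM_nonempty:
  assumes \<tau>: "\<tau> > 0" and "never_stuck \<tau> \<psi> u0"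
  shows "MM \<tau> \<psi> u0 \<noteq> {}"
proof -
  obtain G where G: "u0 \<in> G" "\<And>U. U \<in> G \<Longrightarrow> \<exists>V. MS_step \<tau> \<psi> U V"
    "\<And>U V. U \<in> G \<Longrightarrow> MS_step \<tau> \<psi> U V \<Longrightarrow> V \<in> G"
    using assms(2) unfolding never_stuck_def by blast
  have "\<exists>U. \<forall>n. (U n \<in> G \<and> (n = 0 \<longrightarrow> U n = u0)) \<and> MS_step \<tau> \<psi> (U n) (U (Suc n))"
    by (rule dependent_nat_choice) (use G in blast)+
  then obtain U where U: "U 0 = u0" "\<And>n. MS_step \<tau> \<psi> (U n) (U (Suc n))" by blast
  have "(\<lambda>t. U (nat \<lceil>t / \<tau>\<rceil>)) \<in> MM \<tau> \<psi> u0"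
    unfolding MM_def
  proof (intro CollectI bexI[of _ U] conjI allI impI ballI)
    show "U \<in> MS \<tau> \<psi> u0"
      unfolding MS_def using U by (auto simp: Suc_le_eq gr0_conv_Suc)
    show "U (nat \<lceil>t / \<tau>\<rceil>) = U n" if "1 \<le> n" "t \<in> {(real n - 1) * \<tau><..real n * \<tau>}" for n t
    proof -
      have "0 \<le> (real n - 1) * \<tau>" using that \<tau> by simp
      then have "t > 0" using that by auto
      then show ?thesis using step_index(4)[OF \<tau>, of t n] that by simp
    qed
  qed (use U in auto)
  then show ?thesis by blast
qed

lemma MM_chain:
  assumes w: "w \<in> MM \<tau> \<psi> u0" and \<tau>: "\<tau> > 0"
  obtains U where "U 0 = u0" "w 0 = u0" "\<And>n. chain \<tau> \<psi> U n" "\<And>t. 0 < t \<Longrightarrow> w t = U (nat \<lceil>t / \<tau>\<rceil>)"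
proof -
  obtain U where U: "U 0 = u0" "w 0 = u0" and st: "\<And>n. n \<ge> 1 \<Longrightarrow> MS_step \<tau> \<psi> (U (n - 1)) (U n)"
    and wU: "\<And>n t. n \<ge> 1 \<Longrightarrow> t \<in> {(real n - 1) * \<tau><..real n * \<tau>} \<Longrightarrow> w t = U n"
    using w unfolding MM_def MS_def by blast
  show thesis
  proof (rule that[of U, OF U])
    show "chain \<tau> \<psi> U n" for n using st[of "Suc n" for n] by (simp add: chain_def)
    show "w t = U (nat \<lceil>t / \<tau>\<rceil>)" if "0 < t" for t using step_index(1-3)[OF \<tau> that] wU by simp
  qed
qed

theorem theorem4p8:
  fixes \<phi> :: "'a::{real_inner,banach} \<Rightarrow> real"
    and \<tau>\<^sub>s \<phi>\<^sub>s :: real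
    and u :: "real \<Rightarrow> 'a"
  assumes "C1 \<phi>"
    and "\<tau>\<^sub>s > 0"
    and "\<And>x. 1 / (2 * \<tau>\<^sub>s) * (norm x)\<^sup>2 + \<phi> x \<ge> - \<phi>\<^sub>s"
    and "u \<in> GF_min \<phi>"
  shows "strongly_approximable_compact \<phi> u \<and>
    ((\<exists>B :: 'a set. finite B \<and> span B = UNIV) \<or>
       Liminf at_top (\<lambda>t. ereal (norm (grad \<phi> (u t)))) = 0
     \<longrightarrow> strongly_approximable \<phi> u)"
proof -
  have u: "u \<in> GF \<phi>" using assms(4) by (simp add: GF_min_def)
  define findim where "findim \<longleftrightarrow> (\<exists>B :: 'a set. finite B \<and> span B = UNIV)"
  define liminf0 where "liminf0 \<longleftrightarrow> Liminf at_top (\<lambda>t. ereal (norm (grad \<phi> (u t)))) = 0"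
  define B0 where "B0 = (if findim then SOME B :: 'a set. finite B \<and> span B = UNIV else {})"
  have B0: "finite B0" "findim \<Longrightarrow> span B0 = UNIV"
    using someI_ex[of "\<lambda>B :: 'a set. finite B \<and> span B = UNIV"] unfolding B0_def findim_def by auto
  \<comment> \<open>The horizons tend to infinity, through points of small gradient if there are such.\<close>
  have "\<exists>T>0. real j \<le> T \<and> (liminf0 \<longrightarrow> norm (grad \<phi> (u T)) \<le> 1 / (real j + 2) / 128)" for j
  proof (cases liminf0)
    case True
    define c where "c = 1 / (real j + 2) / 128"
    have c: "c > 0" by (simp add: c_def)
    have "\<exists>T\<ge>real j + 1. norm (grad \<phi> (u T)) < c"
    proof (rule ccontr)
      assume "\<not> ?thesis"
      then have "\<forall>\<^sub>F t in at_top. ereal c \<le> ereal (norm (grad \<phi> (u t)))"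
        by (intro eventually_at_top_linorderI[of "real j + 1"]) (auto simp: not_less)
      from Liminf_bounded[OF this] show False using True c by (simp add: liminf0_def)
    qed
    then obtain T where "T \<ge> real j + 1" "norm (grad \<phi> (u T)) < c" by blast
    then show ?thesis by (intro exI[of _ T]) (auto simp: c_def)
  qed (auto intro!: exI[of _ "real j + 1"])
  then obtain T where T: "\<And>j. T j > 0" "\<And>j. real j \<le> T j"
    "\<And>j. liminf0 \<Longrightarrow> norm (grad \<phi> (u (T j))) \<le> 1 / (real j + 2) / 128"
    by metis
  define A where "A j \<tau> \<psi> \<longleftrightarrow> Lip (\<lambda>v. \<psi> v - \<phi> v) \<le> ennreal (1 / (real j + 2)) \<and>
      tracks \<phi> u (T j) (1 / (real j + 2)) \<tau> \<psi> \<and>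
      (findim \<or> liminf0 \<longrightarrow> never_stuck \<tau> \<psi> (u 0))"
    for j \<tau> \<psi>
  have "\<forall>\<^sub>F \<tau> in at_right 0. \<exists>\<psi>. A j \<tau> \<psi>" for j
  proof -
    have \<delta>: "0 < 1 / (real j + 2)" "1 / (real j + 2) < 1" by (auto simp: field_simps)
    from tracking_potential[OF assms(1,3,2) u \<delta> T(1) B0(1)]
    show ?thesis
    proof (rule eventually_mono)
      fix \<tau>
      assume "\<exists>\<psi>. Lip (\<lambda>v. \<psi> v - \<phi> v) \<le> ennreal (1 / (real j + 2)) \<and> tracks \<phi> u (T j) (1 / (real j + 2)) \<tau> \<psi> \<and>
        (norm (grad \<phi> (u (T j))) \<le> 1 / (real j + 2) / 128 \<or> span B0 = UNIV \<longrightarrow> never_stuck \<tau> \<psi> (u 0))"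
      then show "\<exists>\<psi>. A j \<tau> \<psi>" unfolding A_def using T(3)[of j] B0(2) by blast
    qed
  qed
  from diagonal_choice[of A, OF this]
  obtain \<Phi> where \<Phi>: "\<And>J. \<forall>\<^sub>F \<tau> in at_right 0. \<exists>j\<ge>J. A j \<tau> (\<Phi> \<tau>)" by blast
  have within: "at 0 within {0<..<1} \<le> at_right (0::real)" by (intro at_le) auto
  have Lip: "((\<lambda>\<tau>. Lip (\<lambda>x. \<Phi> \<tau> x - \<phi> x)) \<longlongrightarrow> 0) (at 0 within {0<..<1})"
  proof (rule tendsto_mono[OF within], rule tendsto_ennreal_0I)
    fix e :: real assume "e > 0"
    then obtain J where J: "inverse (real (Suc J)) < e" using reals_Archimedean by blast
    show "\<forall>\<^sub>F \<tau> in at_right 0. Lip (\<lambda>x. \<Phi> \<tau> x - \<phi> x) \<le> ennreal e"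
      using \<Phi>[of J]
    proof eventually_elim
      case (elim \<tau>)
      then obtain j where j: "J \<le> j" "Lip (\<lambda>v. \<Phi> \<tau> v - \<phi> v) \<le> ennreal (1 / (real j + 2))" by (auto simp: A_def)
      have "1 / (real j + 2) \<le> inverse (real (Suc J))" using j(1) unfolding inverse_eq_divide by (intro divide_left_mono) auto
      then have "ennreal (1 / (real j + 2)) \<le> ennreal e" using J by (intro ennreal_leI) linarith
      then show ?case using j(2) by (rule order_trans[rotated])
    qed
  qed
  have track: "\<forall>\<^sub>F \<tau> in at_right 0. \<exists>j\<ge>J. tracks \<phi> u (T j) (1 / (real j + 2)) \<tau> (\<Phi> \<tau>)" for J
    using \<Phi>[of J] by (rule eventually_mono) (auto simp: A_def)
  have close: "\<forall>\<^sub>F \<tau> in at_right 0. 0 < \<tau> \<and> \<tau> \<le> 1 \<and>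
      (\<forall>U m. U 0 = u 0 \<and> chain \<tau> (\<Phi> \<tau>) U m \<and> real m * \<tau> \<le> T0 + 1 \<longrightarrow>
        (\<exists>V. MS_step \<tau> (\<Phi> \<tau>) (U m) V) \<and> (\<forall>t. 0 \<le> t \<and> (real m - 1) * \<tau> \<le> t \<and> t \<le> real m * \<tau> \<longrightarrow> norm (u t - U m) \<le> e))"
    if e: "e > 0" and T0: "T0 > 0" for e T0
  proof -
    have "uniformly_continuous_on {0..T0 + 1} u"
      using GF_continuous[OF u] by (intro compact_uniformly_continuous) (auto intro: continuous_on_subset)
    then obtain d where d: "d > 0" "\<And>s t. s \<in> {0..T0 + 1} \<Longrightarrow> t \<in> {0..T0 + 1} \<Longrightarrow> dist t s < d \<Longrightarrow> dist (u t) (u s) < e / 2"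
      using e unfolding uniformly_continuous_on_def by (metis half_gt_zero)
    have "T0 + 1 \<ge> 0" "e / 2 > 0" using T0 e by auto
    note tr = uniform_tracking[OF assms(1,4) T(2) track this]
    have "\<forall>\<^sub>F \<tau> in at_right (0::real). \<tau> < d" by (rule order_tendstoD(2)[OF tendsto_ident_at d(1)])
    with tr eventually_pos_at_right_0 eventually_mult_le_at_right_0[OF zero_less_one, of 1]
    show ?thesis
    proof eventually_elim
      case (elim \<tau>)
      have "norm (u t - U m) \<le> e"
        if c: "norm (U m - u (real m * \<tau>)) \<le> e / 2" and m: "real m * \<tau> \<le> T0 + 1"
          and t: "0 \<le> t" "(real m - 1) * \<tau> \<le> t" "t \<le> real m * \<tau>" for U :: "nat \<Rightarrow> 'a" and m t
      proof -
        have "dist (real m * \<tau>) t < d" using t elim by (simp add: dist_real_def algebra_simps)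
        then have "dist (u (real m * \<tau>)) (u t) < e / 2" using t m by (intro d(2)) auto
        then show ?thesis
          using c norm_triangle_ineq4[of "u t - u (real m * \<tau>)" "U m - u (real m * \<tau>)"]
          by (simp add: dist_norm norm_minus_commute)
      qed
      then show ?case using elim by auto
    qed
  qed
  have compact: "((\<lambda>\<tau>. Dist_on T0 u (MM_on \<tau> (\<Phi> \<tau>) (u 0) T0)) \<longlongrightarrow> 0) (at 0 within {0<..<1})" if T0: "T0 > 0" for T0
  proof (rule tendsto_mono[OF within], rule tendsto_ennreal_0I)
    fix e :: real assume e: "e > 0"
    show "\<forall>\<^sub>F \<tau> in at_right 0. Dist_on T0 u (MM_on \<tau> (\<Phi> \<tau>) (u 0) T0) \<le> ennreal e"
      using close[OF e T0]
    proof eventually_elim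
      case (elim \<tau>)
      then have \<tau>: "0 < \<tau>" "\<tau> \<le> 1" by auto
      let ?N = "num_steps \<tau> T0"
      have n0: "T0 \<le> real ?N * \<tau>" "real ?N * \<tau> \<le> T0 + 1" using num_steps[OF \<tau>(1) T0] \<tau> by auto
      have n_le: "real n * \<tau> \<le> T0 + 1" if "n \<le> ?N" for n
      proof -
        have "real n * \<tau> \<le> real ?N * \<tau>" using that \<tau> by (intro mult_right_mono of_nat_mono) auto
        then show ?thesis using n0(2) by linarith
      qed
      have ext: "\<exists>V. MS_step \<tau> (\<Phi> \<tau>) (U n) V" if "U 0 = u 0" "chain \<tau> (\<Phi> \<tau>) U n" "n \<le> ?N" for U n
        using elim that n_le[OF that(3)] by blast
      have "\<exists>U. U 0 = u 0 \<and> chain \<tau> (\<Phi> \<tau>) U n" if "n \<le> ?N" for n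
        using that
      proof (induction n)
        case 0
        show ?case by (intro exI[of _ "\<lambda>_. u 0"]) (simp add: chain_def)
      next
        case (Suc n)
        then obtain U where U: "U 0 = u 0" "chain \<tau> (\<Phi> \<tau>) U n" by auto
        then obtain V where "MS_step \<tau> (\<Phi> \<tau>) (U n) V" using ext Suc.prems by fastforce
        then have "chain \<tau> (\<Phi> \<tau>) (U(Suc n := V)) (Suc n)" using U(2) by (auto simp: chain_def less_Suc_eq)
        moreover have "(U(Suc n := V)) 0 = u 0" using U(1) by simp
        ultimately show ?case by blast
      qed
      then obtain U where "U 0 = u 0" "chain \<tau> (\<Phi> \<tau>) U ?N" by blast
      from MM_on_interpolation[OF \<tau>(1) this]
      have ne: "MM_on \<tau> (\<Phi> \<tau>) (u 0) T0 \<noteq> {}" by blast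
      have "dist_on T0 u w \<le> e" if w: "w \<in> MM_on \<tau> (\<Phi> \<tau>) (u 0) T0" for w
      proof -
        obtain U where U: "U 0 = u 0" "w 0 = u 0" and ch: "chain \<tau> (\<Phi> \<tau>) U ?N"
          and wU: "\<And>t. 0 < t \<Longrightarrow> t \<le> T0 \<Longrightarrow> nat \<lceil>t / \<tau>\<rceil> \<le> ?N \<and> w t = U (nat \<lceil>t / \<tau>\<rceil>)"
          using MM_on_chain[OF w \<tau>(1) T0] by blast
        have "min (norm (u t - w t)) 1 \<le> e" if t: "t \<in> {0..T0}" for t
        proof (cases "t = 0")
          case False
          then have t0: "t > 0" using t by simp
          let ?n = "nat \<lceil>t / \<tau>\<rceil>"
          note I = step_index(1-3)[OF \<tau>(1) t0]
          have "w t = U ?n" "chain \<tau> (\<Phi> \<tau>) U ?n" "real ?n * \<tau> \<le> T0 + 1"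
            using t t0 wU[of t] chain_prefix[OF ch] n_le by auto
          then have "norm (u t - w t) \<le> e" using elim U(1) I t0 by (metis less_imp_le)
          then show ?thesis by simp
        qed (use U e in simp)
        then show ?thesis unfolding dist_on_def using T0 by (intro cSUP_least) auto
      qed
      then show ?case using ne unfolding Dist_on_def by (auto intro!: SUP_least ennreal_leI)
    qed
  qed
  have global: "((\<lambda>\<tau>. Dist_inf u (MM \<tau> (\<Phi> \<tau>) (u 0))) \<longlongrightarrow> 0) (at 0 within {0<..<1})" if hyp: "findim \<or> liminf0"
  proof (rule tendsto_mono[OF within], rule tendsto_ennreal_0I)
    fix e :: real assume e: "e > 0"
    define T0 where "T0 = 1 / e"
    have T0: "T0 > 0" using e by (simp add: T0_def)
    show "\<forall>\<^sub>F \<tau> in at_right 0. Dist_inf u (MM \<tau> (\<Phi> \<tau>) (u 0)) \<le> ennreal e"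
      using close[OF e T0] \<Phi>[of 0]
    proof eventually_elim
      case (elim \<tau>)
      then have \<tau>: "0 < \<tau>" "\<tau> \<le> 1" by auto
      have "never_stuck \<tau> (\<Phi> \<tau>) (u 0)" using elim(2) hyp unfolding A_def by blast
      then have ne: "MM \<tau> (\<Phi> \<tau>) (u 0) \<noteq> {}" by (rule MM_nonempty[OF \<tau>(1)])
      have "dist_inf u w \<le> e" if w: "w \<in> MM \<tau> (\<Phi> \<tau>) (u 0)" for w
      proof -
        obtain U where U: "U 0 = u 0" "w 0 = u 0" and ch: "\<And>n. chain \<tau> (\<Phi> \<tau>) U n"
          and wU: "\<And>t. 0 < t \<Longrightarrow> w t = U (nat \<lceil>t / \<tau>\<rceil>)"
          using MM_chain[OF w \<tau>(1)] by blast
        have "1 / (1 + t) * min (norm (u t - w t)) 1 \<le> e" if t: "t \<in> {0..}" for t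
        proof -
          consider "t = 0" | "0 < t" "t \<le> T0" | "T0 < t" using t by fastforce
          then show ?thesis
          proof cases
            case 1
            then show ?thesis using U e by simp
          next
            case 2
            let ?n = "nat \<lceil>t / \<tau>\<rceil>"
            note I = step_index(1-3)[OF \<tau>(1) 2(1)]
            have wt: "w t = U ?n" by (rule wU[OF 2(1)])
            have "real ?n * \<tau> \<le> T0 + 1" using I(2) 2 \<tau> by (simp add: algebra_simps)
            then have "norm (u t - w t) \<le> e" using elim U(1) I 2 ch wt by (metis less_imp_le)
            moreover have "1 / (1 + t) * min (norm (u t - w t)) 1 \<le> 1 * min (norm (u t - w t)) 1"
              using 2 by (intro mult_right_mono) auto
            ultimately show ?thesis by simp
          next
            case 3
            have "1 / (1 + t) * min (norm (u t - w t)) 1 \<le> 1 / (1 + t) * 1" using t by (intro mult_left_mono) auto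
            also have "\<dots> \<le> 1 / T0" using 3 T0 by (simp add: frac_le)
            finally show ?thesis by (simp add: T0_def)
          qed
        qed
        then show ?thesis unfolding dist_inf_def by (intro cSUP_least) auto
      qed
      then show ?case using ne unfolding Dist_inf_def by (auto intro!: SUP_least ennreal_leI)
    qed
  qed
  have "strongly_approximable_compact \<phi> u"
    unfolding strongly_approximable_compact_def using u Lip compact
    by (intro conjI exI[of _ 1] exI[of _ \<Phi>]) auto
  moreover have "strongly_approximable \<phi> u" if "findim \<or> liminf0"
    unfolding strongly_approximable_def using u Lip global[OF that]
    by (intro conjI exI[of _ 1] exI[of _ \<Phi>]) auto
  ultimately show ?thesis unfolding findim_def liminf0_def by blast
qed

end
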